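(* Let $n,s$ be integers satisfying $s\leq \frac{n}{2^{17}\log n}$. Let $\mathcal{F}\subset \Sigma_n$ be a family of permutations such that $\nu(\mathcal{F})<s$ and $\tau(\mathcal{F})\geq s$. Then $|\mathcal{F}|\leq (s-1)(n-1)!-d_{n,1}+1$. Moreover, in the case of equality, $\mathcal{F}$ is of the form $\rho\mathcal{F}_0\pi$ or $\rho\mathcal{F}_0^{-1}\pi$ for some $\rho,\pi\in\Sigma_n$, where \[\mathcal{F}_0=\bigcup_{i=2}^{s-1}\Sigma_n[(1,i)]\cup\Sigma_{n,\sigma}[(1,1)]\cup\{\sigma\}\] for some permutation $\sigma$ satisfying $\sigma(1)\notin [s-1]$.
   Context: $\Sigma_n$ is the set of permutations of $[n]$; a permutation is identified with its graph $\{(i,\sigma(i))\}\subset[n]^2$, two permutations intersect iff they agree at some point, and $\nu(\mathcal{F})$ is the maximum number of pairwise non-intersecting members of $\mathcal{F}$. The covering number $\tau(\mathcal{F})$ is the smallest size of a set $X\subset[n]^2$ of pairs such that every permutation in $\mathcal{F}$ contains some pair of $X$ (i.e. $\pi(x)=y$ for some $(x,y)\in X$). $\Sigma_n[(x,y)]$ is the set of permutations mapping $x$ to $y$; $\Sigma_{n,\sigma}$ is the set of permutations intersecting $\sigma$, and $\Sigma_{n,\sigma}[(1,1)]$ is the set of those mapping $1$ to $1$. $d_{n,1}$ is the number of derangements (fixed-point-free permutations) $\pi$ of $[n]$ with $\pi(x)=y$ for a fixed pair $x\neq y$. For a family $\mathcal G$, $\rho\mathcal G\pi=\{\rho\circ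 g\circ\pi: g\in\mathcal G\}$ and $\mathcal G^{-1}=\{g^{-1}:g\in\mathcal G\}$. *)

theory Defs
  imports Complex_Main "HOL-Combinatorics.Permutations"
begin

definition Sym :: "nat \<Rightarrow> (nat \<Rightarrow> nat) set" where
  "Sym n = {p. p permutes {1..n}}"

definition perm_intersect :: "nat \<Rightarrow> (nat \<Rightarrow> nat) \<Rightarrow> (nat \<Rightarrow> nat) \<Rightarrow> bool" where
  "perm_intersect n p q \<longleftrightarrow> (\<exists>i\<in>{1..n}. p i = q i)"

definition nu :: "nat \<Rightarrow> (nat \<Rightarrow> nat) set \<Rightarrow> nat" where
  "nu n F = Max {card G | G. G \<subseteq> F \<and>
      (\<forall>p\<in>G. \<forall>q\<in>G. p \<noteq> q \<longrightarrow> \<not> perm_intersect n p q)}"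

definition tau :: "nat \<Rightarrow> (nat \<Rightarrow> nat) set \<Rightarrow> nat" where
  "tau n F = Min {card X | X. X \<subseteq> {1..n} \<times> {1..n} \<and>
      (\<forall>p\<in>F. \<exists>(x, y)\<in>X. p x = y)}"

definition Sym_pair :: "nat \<Rightarrow> nat \<Rightarrow> nat \<Rightarrow> (nat \<Rightarrow> nat) set" where
  "Sym_pair n x y = {p \<in> Sym n. p x = y}"

definition d1 :: "nat \<Rightarrow> nat" where
  "d1 n = card {p \<in> Sym n. (\<forall>i\<in>{1..n}. p i \<noteq> i) \<and> p 1 = 2}"

definition F0 :: "nat \<Rightarrow> nat \<Rightarrow> (nat \<Rightarrow> nat) \<Rightarrow> (nat \<Rightarrow> nat) set" where
  "F0 n s \<sigma> = (\<Union>i\<in>{2..s-1}. Sym_pair n 1 i)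
      \<union> {p \<in> Sym_pair n 1 1. perm_intersect n p \<sigma>} \<union> {\<sigma>}"

end

theory Submission
  imports Defs "HOL-Library.FuncSet"
begin

text \<open>
  Call a set \<open>A\<close> of pairs a core of \<open>F\<close> if some nonempty subfamily of the members containing \<open>A\<close> is
  \<open>R\<close>-spread outside \<open>A\<close>: adding \<open>k\<close> further pairs cuts it down by a factor of at least
  \<open>R\<^sup>k\<close>; here \<open>R = n / 2^11\<close>. A random colouring of the pairs shows
  that pairwise disjoint small cores extend to pairwise disjoint members. Hence the small cores have
  matching number less than \<open>s\<close>, while the members containing no small core are negligible in number.
  A branching argument on the cores now bounds \<open>F\<close>: if fewer than \<open>s - 1\<close> pairs have a dense star in \<open>F\<close>,
  then \<open>F\<close> is too small. So there are \<open>s - 1\<close> dense stars, and as \<open>tau n F \<ge> s\<close> some \<open>\<sigma>\<close> in \<open>F\<close> avoids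
  all of them. One of the stars must be almost disjoint from the permutations avoiding \<open>\<sigma>\<close>, which
  costs about \<open>d1 n\<close>, so the other stars are almost full; then every member of the exceptional star lying
  on no other star meets every member off the stars. Counting gives the bound, with equality only if
  the pairs lie on one line and \<open>\<sigma>\<close> is the only member off the stars.
\<close>

section \<open>Disjoint members of spread families\<close>

text \<open>The bound and the equality case are obtained together: a family at least as large as the
  bound is shown to be extremal, so each error term must stay below what a wrong structure would
  cost. The \<open>d1 n\<close> missing from the exceptional star cancels exactly, and the cheapest
  defect to be detected is about \<open>fact (n - 3)\<close> permutations (two stars not on a line).
  Cores may therefore have up to \<open>M\<close> pairs, where \<open>n \<le> 2 ^ M\<close>: this
  pushes the coreless remainder below \<open>fact (n - 3) / 512\<close>. The same \<open>M\<close>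
  is the number of colours reserved for each member. Every colour divides the mean uncovered rest by
  4, and \<open>4 ^ M \<ge> n ^ 2\<close> beats the union bound over fewer than \<open>n\<close>
  members with \<open>n\<close> pairs each. Disjointness asks for \<open>32 * s * M \<le> R\<close>;
  with \<open>R = n / 2 ^ 11\<close> this is \<open>2 ^ 16 * s * M \<le> n\<close>, and
  \<open>M \<le> 2 * ln n\<close> leads to the \<open>2 ^ 17\<close> of the theorem. The divisor
  \<open>2 ^ 11\<close> leaves room for the factor 3 lost in
  \<open>n! / (n - j)! \<ge> (n / 3) ^ j\<close> and for families filling only 1/512 of a star, as 3
  * 512 < 2048.\<close>

lemma sum_Pow_power_card:
  assumes "finite X"
  shows "(\<Sum>W\<in>Pow X. k ^ card (X - W)) = (k + 1 :: nat) ^ card X"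
  using prod_add[OF assms, of "\<lambda>_. 1" "\<lambda>_. k"] by (simp add: add.commute)

lemma two_powr_minus_one_ge:
  "(2::real) powr z - 1 \<ge> z * ln 2"
proof -
  have "1 + z * ln 2 \<le> exp (z * ln 2)"
    by (rule exp_ge_add_one_self)
  then show ?thesis by (simp add: powr_def algebra_simps)
qed

text \<open>\<open>W\<close> is the class of one colour in a random colouring with
  \<open>k + 1\<close> colours, hence the weight \<open>k ^ card (X - W)\<close>;
  \<open>\<chi> W \<omega>\<close> is what the other colours still have to cover. The map from
  \<open>(W, \<omega>)\<close> to \<open>(Z, T, \<omega>)\<close> with
  \<open>T = \<chi> W \<omega>\<close> and \<open>Z = W \<union> T\<close> is injective, and
  \<open>T\<close> is a subset of one member \<open>S\<close> determined by \<open>Z\<close>. So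
  \<open>2 powr (4 * card T - card S)\<close> has mean at most 1: spreadness pays for
  \<open>(16 * k) ^ card T\<close>, and \<open>2 ^ card S\<close> pays for the choice of
  \<open>T\<close>. Replacing the power by its tangent at 0 bounds the mean of
  \<open>4 * card T\<close> by that of \<open>card S\<close>.\<close>

lemma fragment_step:
  fixes f :: "'w \<Rightarrow> 'a set" and R :: real and k :: nat
  assumes fin: "finite \<Omega>" "finite X"
    and sub: "\<And>\<omega>. \<omega> \<in> \<Omega> \<Longrightarrow> f \<omega> \<subseteq> X"
    and spread: "\<And>B. real (card {\<omega>\<in>\<Omega>. B \<subseteq> f \<omega>}) * R ^ card B \<le> real (card \<Omega>)"
    and k: "16 * real k \<le> R"
  obtains \<chi> where
    "\<And>W \<omega>. \<omega> \<in> \<Omega> \<Longrightarrow> \<chi> W \<omega> \<subseteq> f \<omega> - W"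
    "\<And>W \<omega>. \<omega> \<in> \<Omega> \<Longrightarrow> \<exists>\<omega>'\<in>\<Omega>. f \<omega>' \<subseteq> W \<union> \<chi> W \<omega>"
    "4 * (\<Sum>W\<in>Pow X. real (k ^ card (X - W)) * (\<Sum>\<omega>\<in>\<Omega>. real (card (\<chi> W \<omega>))))
      \<le> real ((k + 1) ^ card X) * (\<Sum>\<omega>\<in>\<Omega>. real (card (f \<omega>)))"
proof -
  \<comment> \<open>Sets that may replace \<open>f \<omega>\<close>. The restriction on size
    survives to the end, where the canonical member must be no larger than
    \<open>f \<omega>\<close>.\<close>
  define E where "E W \<omega> \<omega>' \<longleftrightarrow> \<omega>' \<in> \<Omega> \<and> f \<omega>' \<subseteq> W \<union> f \<omega> \<and> card (f \<omega>') \<le> card (f \<omega>)" for W \<omega> \<omega>'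
  define h where "h W \<omega> = arg_min (\<lambda>\<omega>'. card (f \<omega>' - W)) (E W \<omega>)" for W \<omega>
  define \<chi> where "\<chi> W \<omega> = f (h W \<omega>) - W" for W \<omega>
  define g where "g Z = arg_min (\<lambda>\<omega>. card (f \<omega>)) (\<lambda>\<omega>. \<omega> \<in> \<Omega> \<and> f \<omega> \<subseteq> Z)" for Z
  have ff: "finite (f \<omega>)" if "\<omega> \<in> \<Omega>" for \<omega>
    using sub[OF that] fin(2) finite_subset by blast
  have hE: "E W \<omega> (h W \<omega>)" and hmin: "\<And>\<omega>'. E W \<omega> \<omega>' \<Longrightarrow> card (\<chi> W \<omega>) \<le> card (f \<omega>' - W)"
    if "\<omega> \<in> \<Omega>" for W \<omega>
  proof -
    have e: "E W \<omega> \<omega>" using that by (auto simp: E_def)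
    show "E W \<omega> (h W \<omega>)" unfolding h_def using e by (rule arg_min_natI)
    show "card (\<chi> W \<omega>) \<le> card (f \<omega>' - W)" if "E W \<omega> \<omega>'" for \<omega>'
      unfolding \<chi>_def h_def using that by (rule arg_min_nat_le)
  qed
  have gE: "g Z \<in> \<Omega>" "f (g Z) \<subseteq> Z" and gmin: "card (f (g Z)) \<le> card (f \<omega>)"
    if "\<omega> \<in> \<Omega>" "f \<omega> \<subseteq> Z" for Z \<omega>
  proof -
    have "g Z \<in> \<Omega> \<and> f (g Z) \<subseteq> Z"
      unfolding g_def by (rule arg_min_natI[where k = \<omega>]) (use that in auto)
    then show "g Z \<in> \<Omega>" "f (g Z) \<subseteq> Z" by auto
    show "card (f (g Z)) \<le> card (f \<omega>)"
      unfolding g_def by (rule arg_min_nat_le) (use that in auto)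
  qed
  have c1: "\<chi> W \<omega> \<subseteq> f \<omega> - W" if "\<omega> \<in> \<Omega>" for W \<omega>
    using hE[OF that, of W] by (auto simp: E_def \<chi>_def)
  have c2: "h W \<omega> \<in> \<Omega>" "f (h W \<omega>) \<subseteq> W \<union> \<chi> W \<omega>" if "\<omega> \<in> \<Omega>" for W \<omega>
    using hE[OF that, of W] by (auto simp: E_def \<chi>_def)
  let ?G = "\<lambda>W \<omega>. f (g (W \<union> \<chi> W \<omega>))"
  have G1: "card (?G W \<omega>) \<le> card (f \<omega>)" if "\<omega> \<in> \<Omega>" for W \<omega>
    using gmin[OF c2[OF that]] hE[OF that, of W] unfolding E_def by (meson le_trans)
  \<comment> \<open>Minimality of the fragment forces it into the canonical member of \<open>W \<union> \<chi>\<close>, so a fragment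
    costs only the choice of a subset of that member.\<close>
  have G2: "\<chi> W \<omega> \<subseteq> ?G W \<omega>" if w: "\<omega> \<in> \<Omega>" for W \<omega>
  proof -
    note gg = gE[OF c2[OF w], of W]
    have s: "?G W \<omega> - W \<subseteq> \<chi> W \<omega>" using gg by auto
    have "E W \<omega> (g (W \<union> \<chi> W \<omega>))"
      unfolding E_def using gg G1[OF w] c1[OF w, of W] by auto
    from hmin[OF w this] have "card (\<chi> W \<omega>) \<le> card (?G W \<omega> - W)" .
    moreover have "finite (\<chi> W \<omega>)" using ff[OF w] c1[OF w] by (meson finite_Diff finite_subset)
    ultimately have "?G W \<omega> - W = \<chi> W \<omega>" using s by (metis card_seteq)
    then show ?thesis by auto
  qed
  let ?P = "Pow X \<times> \<Omega>"
  let ?wt = "\<lambda>W. real (k ^ card (X - W))"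
  have fP: "finite ?P" using fin by auto
  define Zs where "Zs = {Z \<in> Pow X. \<exists>\<omega>\<in>\<Omega>. f \<omega> \<subseteq> Z}"
  define D where "D = (SIGMA Z:Zs. SIGMA T:Pow (f (g Z)). {\<omega>\<in>\<Omega>. T \<subseteq> f \<omega>})"
  \<comment> \<open>An upper bound for the term of any \<open>(W, \<omega>)\<close> encoded by the
    triple: \<open>k ^ card (X - W)\<close> splits into \<open>k ^ card (X - Z)\<close> and
    \<open>k ^ card T\<close>, and \<open>16 * k \<le> R\<close>.\<close>
  define v where "v = (\<lambda>(Z, T, \<omega> :: 'w). real (k ^ card (X - Z)) * (R ^ card (T :: 'a set) / 2 ^ card (f (g Z))))"
  define \<phi> where "\<phi> = (\<lambda>(W, \<omega>). (W \<union> \<chi> W \<omega>, \<chi> W \<omega>, \<omega>))"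
  have fZ: "finite Zs" using fin by (auto simp: Zs_def)
  have gZ: "g Z \<in> \<Omega>" if "Z \<in> Zs" for Z using that gE(1) unfolding Zs_def by blast
  have fgZ: "finite (f (g Z))" if "Z \<in> Zs" for Z using ff[OF gZ[OF that]] .
  have R0: "R \<ge> 0" using k by (meson dual_order.trans mult_nonneg_nonneg of_nat_0_le_iff zero_le_numeral)
  have "(\<Sum>(W, \<omega>)\<in>?P. ?wt W * (2 powr (4 * real (card (\<chi> W \<omega>)) - real (card (?G W \<omega>)))))
      \<le> (\<Sum>p\<in>?P. v (\<phi> p))"
  proof (rule sum_mono, clarify)
    fix W \<omega> assume W: "W \<subseteq> X" and w: "\<omega> \<in> \<Omega>"
    let ?T = "\<chi> W \<omega>"
    have Tf: "finite ?T" using ff[OF w] c1[OF w] by (meson finite_Diff finite_subset)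
    have e: "X - W = (X - (W \<union> ?T)) \<union> ?T" "(X - (W \<union> ?T)) \<inter> ?T = {}"
      using c1[OF w, of W] sub[OF w] by auto
    have cd: "card (X - W) = card (X - (W \<union> ?T)) + card ?T"
      using e Tf fin by (metis card_Un_disjoint finite_Diff)
    have "2 powr (4 * real (card ?T) - real (card (?G W \<omega>))) = 16 ^ card ?T / (2::real) ^ card (?G W \<omega>)"
      by (simp add: powr_diff powr_realpow powr_powr[symmetric] flip: powr_powr)
    then have "?wt W * 2 powr (4 * real (card ?T) - real (card (?G W \<omega>)))
        = real (k ^ card (X - (W \<union> ?T))) * ((16 * real k) ^ card ?T / 2 ^ card (?G W \<omega>))"
      by (simp add: cd power_add power_mult_distrib)
    also have "\<dots> \<le> real (k ^ card (X - (W \<union> ?T))) * (R ^ card ?T / 2 ^ card (?G W \<omega>))"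
      by (intro mult_left_mono divide_right_mono power_mono k) auto
    finally show "?wt W * 2 powr (4 * real (card ?T) - real (card (?G W \<omega>))) \<le> v (\<phi> (W, \<omega>))"
      by (simp add: v_def \<phi>_def)
  qed
  also have "\<dots> = (\<Sum>p\<in>\<phi> ` ?P. v p)"
  proof -
    have "inj_on \<phi> ?P"
    proof (rule inj_onI)
      fix p p' assume "p \<in> ?P" "p' \<in> ?P" and eq: "\<phi> p = \<phi> p'"
      obtain W \<omega> W' \<omega>' where p: "p = (W, \<omega>)" "p' = (W', \<omega>')" "\<omega> \<in> \<Omega>" "\<omega>' \<in> \<Omega>"
        using \<open>p \<in> ?P\<close> \<open>p' \<in> ?P\<close> by auto
      have e: "\<omega> = \<omega>'" "\<chi> W \<omega> = \<chi> W' \<omega>'" "W \<union> \<chi> W \<omega> = W' \<union> \<chi> W' \<omega>'"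
        using eq p by (auto simp: \<phi>_def)
      have "W = (W \<union> \<chi> W \<omega>) - \<chi> W \<omega>" "W' = (W' \<union> \<chi> W' \<omega>') - \<chi> W' \<omega>'"
        using c1[OF p(3), of W] c1[OF p(4), of W'] by auto
      then show "p = p'" using e p by metis
    qed
    then show ?thesis by (simp add: sum.reindex)
  qed
  also have "\<dots> \<le> (\<Sum>p\<in>D. v p)"
  proof (rule sum_mono2)
    show "finite D" unfolding D_def using fZ fgZ fin by (intro finite_SigmaI) auto
    show "\<phi> ` ?P \<subseteq> D"
    proof (rule image_subsetI)
      fix p assume "p \<in> ?P"
      then obtain W \<omega> where p: "p = (W, \<omega>)" and W: "W \<subseteq> X" and w: "\<omega> \<in> \<Omega>"
        by auto
      have "W \<union> \<chi> W \<omega> \<in> Zs"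
        unfolding Zs_def using c2[OF w, of W] c1[OF w, of W] sub[OF w] W by auto
      then show "\<phi> p \<in> D"
        unfolding D_def \<phi>_def p using G2[OF w, of W] c1[OF w, of W] w by auto
    qed
    show "0 \<le> v b" if "b \<in> D - \<phi> ` ?P" for b unfolding v_def using R0 by (auto split: prod.split)
  qed
  also have "\<dots> = (\<Sum>Z\<in>Zs. \<Sum>T\<in>Pow (f (g Z)). \<Sum>\<omega>\<in>{\<omega>\<in>\<Omega>. T \<subseteq> f \<omega>}. v (Z, T, \<omega>))"
    unfolding D_def using fZ fgZ fin by (simp add: sum.Sigma finite_SigmaI)
  also have "\<dots> \<le> (\<Sum>Z\<in>Zs. real (k ^ card (X - Z)) * real (card \<Omega>))"
  proof (rule sum_mono)
    fix Z assume Z: "Z \<in> Zs"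
    let ?S = "f (g Z)"
    have "(\<Sum>T\<in>Pow ?S. \<Sum>\<omega>\<in>{\<omega>\<in>\<Omega>. T \<subseteq> f \<omega>}. v (Z, T, \<omega>))
      = (\<Sum>T\<in>Pow ?S. real (k ^ card (X - Z)) / 2 ^ card ?S * (real (card {\<omega>\<in>\<Omega>. T \<subseteq> f \<omega>}) * R ^ card T))"
      by (simp add: v_def mult_ac)
    also have "\<dots> \<le> (\<Sum>T\<in>Pow ?S. real (k ^ card (X - Z)) / 2 ^ card ?S * real (card \<Omega>))"
      by (intro sum_mono mult_left_mono spread) auto
    also have "\<dots> = real (k ^ card (X - Z)) * real (card \<Omega>)"
      using fgZ[OF Z] by (simp add: card_Pow)
    finally show "(\<Sum>T\<in>Pow ?S. \<Sum>\<omega>\<in>{\<omega>\<in>\<Omega>. T \<subseteq> f \<omega>}. v (Z, T, \<omega>)) \<le> real (k ^ card (X - Z)) * real (card \<Omega>)" .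
  qed
  also have "\<dots> \<le> (\<Sum>Z\<in>Pow X. real (k ^ card (X - Z)) * real (card \<Omega>))"
    using fin by (intro sum_mono2) (auto simp: Zs_def)
  also have "\<dots> = (\<Sum>(W, \<omega>)\<in>?P. ?wt W)"
    using fin by (simp add: sum.cartesian_product[symmetric] mult.commute)
  finally have "(\<Sum>(W, \<omega>)\<in>?P. ?wt W * (2 powr (4 * real (card (\<chi> W \<omega>)) - real (card (?G W \<omega>))) - 1)) \<le> 0"
    by (simp add: case_prod_unfold right_diff_distrib sum_subtractf)
  moreover have "(\<Sum>(W, \<omega>)\<in>?P. ?wt W * (4 * real (card (\<chi> W \<omega>)) - real (card (?G W \<omega>)))) * ln 2
    \<le> (\<Sum>(W, \<omega>)\<in>?P. ?wt W * (2 powr (4 * real (card (\<chi> W \<omega>)) - real (card (?G W \<omega>))) - 1))"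
    unfolding sum_distrib_right
    by (intro sum_mono) (auto simp: mult.assoc intro!: mult_left_mono two_powr_minus_one_ge)
  ultimately have "(\<Sum>(W, \<omega>)\<in>?P. ?wt W * (4 * real (card (\<chi> W \<omega>)) - real (card (?G W \<omega>)))) * ln 2 \<le> 0"
    by linarith
  then have "(\<Sum>(W, \<omega>)\<in>?P. ?wt W * (4 * real (card (\<chi> W \<omega>)) - real (card (?G W \<omega>)))) \<le> 0"
    by (simp add: mult_le_0_iff)
  then have "4 * (\<Sum>(W, \<omega>)\<in>?P. ?wt W * real (card (\<chi> W \<omega>))) \<le> (\<Sum>(W, \<omega>)\<in>?P. ?wt W * real (card (?G W \<omega>)))"
    by (simp add: case_prod_unfold right_diff_distrib sum_subtractf sum_distrib_left mult_ac)
  also have "\<dots> \<le> (\<Sum>(W, \<omega>)\<in>?P. ?wt W * real (card (f \<omega>)))"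
    by (intro sum_mono) (auto intro!: mult_left_mono G1)
  also have "\<dots> = (\<Sum>W\<in>Pow X. ?wt W) * (\<Sum>\<omega>\<in>\<Omega>. real (card (f \<omega>)))"
    by (simp add: sum.cartesian_product[symmetric] sum_product)
  also have "(\<Sum>W\<in>Pow X. ?wt W) = real ((k + 1) ^ card X)"
    unfolding sum_Pow_power_card[OF fin(2), symmetric] by simp
  finally have c3: "4 * (\<Sum>W\<in>Pow X. ?wt W * (\<Sum>\<omega>\<in>\<Omega>. real (card (\<chi> W \<omega>))))
      \<le> real ((k + 1) ^ card X) * (\<Sum>\<omega>\<in>\<Omega>. real (card (f \<omega>)))"
    by (simp add: sum.cartesian_product[symmetric] sum_distrib_left)
  show ?thesis
    using that[of \<chi>] c1 c2 c3 by blast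
qed

text \<open>The colours in \<open>C\<close> are revealed one at a time. After each, the fragments
  replace the sets, with one colour fewer and a quarter of the mean size; being subsets, they
  inherit spreadness. The index set \<open>\<Omega>\<close> stays fixed because different indices
  may come to share a fragment. Once \<open>C\<close> is exhausted, failure means that every
  remaining set is nonempty, so the mean size is at least 1.\<close>

lemma card_failing_colourings_le:
  fixes f :: "'w \<Rightarrow> 'a set" and R :: real and Q :: "'c set"
  assumes "finite C" "finite \<Omega>" "finite X" "finite Q" "C \<subseteq> Q"
    and "\<And>\<omega>. \<omega> \<in> \<Omega> \<Longrightarrow> f \<omega> \<subseteq> X"
    and "\<And>B. real (card {\<omega>\<in>\<Omega>. B \<subseteq> f \<omega>}) * R ^ card B \<le> real (card \<Omega>)"
    and "16 * real (card Q) \<le> R"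
  shows "real (card \<Omega>) * 4 ^ card C * real (card {c \<in> X \<rightarrow>\<^sub>E Q. \<forall>\<omega>\<in>\<Omega>. \<not> f \<omega> \<subseteq> {x\<in>X. c x \<in> C}})
    \<le> real (card Q ^ card X) * (\<Sum>\<omega>\<in>\<Omega>. real (card (f \<omega>)))"
  using assms
proof (induction C arbitrary: X Q f rule: finite_induct)
  case empty
  let ?B = "{c \<in> X \<rightarrow>\<^sub>E Q. \<forall>\<omega>\<in>\<Omega>. \<not> f \<omega> \<subseteq> {x\<in>X. c x \<in> {}}}"
  have le: "card ?B \<le> card Q ^ card X"
    unfolding card_funcsetE[OF empty.prems(2), symmetric]
    using empty.prems(2,3) by (intro card_mono finite_PiE) auto
  show ?case
  proof (cases "?B = {}")
    case True
    show ?thesis unfolding True by (simp add: sum_nonneg)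
  next
    case False
    then have ne: "f \<omega> \<noteq> {}" if "\<omega> \<in> \<Omega>" for \<omega> using that by auto
    have "1 \<le> card (f \<omega>)" if "\<omega> \<in> \<Omega>" for \<omega>
    proof -
      have "finite (f \<omega>)" using empty.prems that finite_subset by blast
      then show ?thesis using ne[OF that] by (simp add: Suc_leI card_gt_0_iff)
    qed
    then have "real (card \<Omega>) \<le> (\<Sum>\<omega>\<in>\<Omega>. real (card (f \<omega>)))"
      using sum_mono[of \<Omega> "\<lambda>_. 1::real" "\<lambda>\<omega>. real (card (f \<omega>))"] by simp
    then have "real (card \<Omega>) * real (card ?B) \<le> (\<Sum>\<omega>\<in>\<Omega>. real (card (f \<omega>))) * real (card Q ^ card X)"
      using le by (intro mult_mono) (auto simp: sum_nonneg simp flip: of_nat_power)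
    then show ?thesis by (simp add: mult_ac)
  qed
next
  case (insert a C)
  let ?Q = "Q - {a}"
  have a: "a \<in> Q" and CQ: "C \<subseteq> ?Q" using insert.prems insert.hyps by auto
  have cQ: "card Q = card ?Q + 1" using a insert.prems by (metis Suc_eq_plus1 card.remove)
  have kR: "16 * real (card ?Q) \<le> R" using insert.prems(7) cQ by simp
  obtain \<chi> where \<chi>: "\<And>W \<omega>. \<omega> \<in> \<Omega> \<Longrightarrow> \<chi> W \<omega> \<subseteq> f \<omega> - W"
    "\<And>W \<omega>. \<omega> \<in> \<Omega> \<Longrightarrow> \<exists>\<omega>'\<in>\<Omega>. f \<omega>' \<subseteq> W \<union> \<chi> W \<omega>"
    "4 * (\<Sum>W\<in>Pow X. real (card ?Q ^ card (X - W)) * (\<Sum>\<omega>\<in>\<Omega>. real (card (\<chi> W \<omega>))))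
      \<le> real ((card ?Q + 1) ^ card X) * (\<Sum>\<omega>\<in>\<Omega>. real (card (f \<omega>)))"
    by (rule fragment_step[OF insert.prems(1,2,5,6) kR]) (assumption | (rule that; assumption))+
  let ?L = "{c \<in> X \<rightarrow>\<^sub>E Q. \<forall>\<omega>\<in>\<Omega>. \<not> f \<omega> \<subseteq> {x\<in>X. c x \<in> insert a C}}"
  define B where "B W = {c \<in> (X - W) \<rightarrow>\<^sub>E ?Q. \<forall>\<omega>\<in>\<Omega>. \<not> \<chi> W \<omega> \<subseteq> {x\<in>X - W. c x \<in> C}}" for W
  have fB: "finite (B W)" for W
    unfolding B_def by (rule finite_subset[of _ "(X - W) \<rightarrow>\<^sub>E ?Q"])
      (use insert.prems(2,3) in \<open>auto intro!: finite_PiE\<close>)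
  \<comment> \<open>A failing colouring is recorded as the class \<open>W\<close> of
    \<open>a\<close> and a colouring of the rest that fails for the fragments with the colours
    \<open>C\<close>.\<close>
  define \<psi> where "\<psi> = (\<lambda>c. ({x\<in>X. c x = a}, restrict c (X - {x\<in>X. c x = a})))"
  have "inj_on \<psi> ?L"
  proof (rule inj_onI)
    fix c c' assume c: "c \<in> ?L" "c' \<in> ?L" and e: "\<psi> c = \<psi> c'"
    then have W: "{x\<in>X. c x = a} = {x\<in>X. c' x = a}"
      and r: "restrict c (X - {x\<in>X. c x = a}) = restrict c' (X - {x\<in>X. c' x = a})"
      unfolding \<psi>_def by auto
    show "c = c'"
    proof
      fix x
      show "c x = c' x"
      proof (cases "x \<in> X")
        case False
        then show ?thesis using c by (auto simp: PiE_def extensional_def)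
      next
        case True
        show ?thesis
        proof (cases "c x = a")
          case True
          then have "x \<in> {x\<in>X. c' x = a}" using W \<open>x \<in> X\<close> by blast
          then show ?thesis using True by simp
        next
          case False
          then have "x \<in> X - {x\<in>X. c x = a}" "x \<in> X - {x\<in>X. c' x = a}"
            using W \<open>x \<in> X\<close> by blast+
          then show ?thesis using fun_cong[OF r, of x] by simp
        qed
      qed
    qed
  qed
  moreover have "\<psi> ` ?L \<subseteq> (SIGMA W:Pow X. B W)"
  proof (rule image_subsetI)
    fix c assume c: "c \<in> ?L"
    let ?W = "{x\<in>X. c x = a}"
    have "restrict c (X - ?W) \<in> (X - ?W) \<rightarrow>\<^sub>E ?Q" using c by (auto simp: PiE_def)
    moreover have "\<not> \<chi> ?W \<omega> \<subseteq> {x\<in>X - ?W. restrict c (X - ?W) x \<in> C}" if w: "\<omega> \<in> \<Omega>" for \<omega>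
    proof
      assume "\<chi> ?W \<omega> \<subseteq> {x\<in>X - ?W. restrict c (X - ?W) x \<in> C}"
      then have "\<chi> ?W \<omega> \<subseteq> {x\<in>X. c x \<in> insert a C}" by auto
      moreover obtain \<omega>' where "\<omega>' \<in> \<Omega>" "f \<omega>' \<subseteq> ?W \<union> \<chi> ?W \<omega>" using \<chi>(2)[OF w] by blast
      ultimately have "f \<omega>' \<subseteq> {x\<in>X. c x \<in> insert a C}" by auto
      with c \<open>\<omega>' \<in> \<Omega>\<close> show False by blast
    qed
    ultimately show "\<psi> c \<in> (SIGMA W:Pow X. B W)" unfolding \<psi>_def B_def by auto
  qed
  ultimately have "card ?L \<le> card (SIGMA W:Pow X. B W)"
    using insert.prems fB by (intro card_inj_on_le) (auto intro: finite_SigmaI)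
  also have "\<dots> = (\<Sum>W\<in>Pow X. card (B W))" using insert.prems fB by simp
  finally have L: "card ?L \<le> (\<Sum>W\<in>Pow X. card (B W))" .
  have IH: "real (card \<Omega>) * 4 ^ card C * real (card (B W))
      \<le> real (card ?Q ^ card (X - W)) * (\<Sum>\<omega>\<in>\<Omega>. real (card (\<chi> W \<omega>)))" if "W \<in> Pow X" for W
    unfolding B_def
  proof (rule insert.IH)
    show "\<chi> W \<omega> \<subseteq> X - W" if "\<omega> \<in> \<Omega>" for \<omega>
      using \<chi>(1)[OF that, of W] insert.prems(5)[OF that] by auto
    show "real (card {\<omega> \<in> \<Omega>. B \<subseteq> \<chi> W \<omega>}) * R ^ card B \<le> real (card \<Omega>)" for B
    proof -
      have "card {\<omega> \<in> \<Omega>. B \<subseteq> \<chi> W \<omega>} \<le> card {\<omega> \<in> \<Omega>. B \<subseteq> f \<omega>}"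
        using \<chi>(1) insert.prems(1) by (intro card_mono) (simp, blast)
      moreover have "R \<ge> 0" using insert.prems(7) by (meson dual_order.trans mult_nonneg_nonneg of_nat_0_le_iff zero_le_numeral)
      ultimately have "real (card {\<omega> \<in> \<Omega>. B \<subseteq> \<chi> W \<omega>}) * R ^ card B \<le> real (card {\<omega> \<in> \<Omega>. B \<subseteq> f \<omega>}) * R ^ card B"
        by (intro mult_right_mono) auto
      then show ?thesis using insert.prems(6)[of B] by linarith
    qed
    show "16 * real (card ?Q) \<le> R" by (fact kR)
  qed (use insert.prems CQ in auto)
  have "real (card \<Omega>) * 4 ^ card (insert a C) * real (card ?L)
      \<le> 4 * (real (card \<Omega>) * 4 ^ card C * (\<Sum>W\<in>Pow X. real (card (B W))))"
  proof -
    have "real (card ?L) \<le> (\<Sum>W\<in>Pow X. real (card (B W)))" using L by (simp flip: of_nat_sum)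
    then have "(4 * real (card \<Omega>) * 4 ^ card C) * real (card ?L) \<le> (4 * real (card \<Omega>) * 4 ^ card C) * (\<Sum>W\<in>Pow X. real (card (B W)))"
      by (intro mult_left_mono) auto
    then show ?thesis using insert.hyps by (simp add: mult_ac)
  qed
  also have "\<dots> \<le> 4 * (\<Sum>W\<in>Pow X. real (card ?Q ^ card (X - W)) * (\<Sum>\<omega>\<in>\<Omega>. real (card (\<chi> W \<omega>))))"
    unfolding sum_distrib_left[of "real (card \<Omega>) * 4 ^ card C"] by (intro mult_left_mono sum_mono IH) auto
  also have "\<dots> \<le> real (card Q ^ card X) * (\<Sum>\<omega>\<in>\<Omega>. real (card (f \<omega>)))"
    using \<chi>(3) cQ by simp
  finally show ?case .
qed

text \<open>Each \<open>i\<close> owns \<open>M\<close> of the \<open>card I * M\<close> colours. A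
  colouring fails for a given \<open>i\<close> with probability at most \<open>m / 4 ^ M\<close>, so
  some colouring fails for no \<open>i\<close>; the members found then lie in disjoint colour
  classes.\<close>

lemma spread_families_disjoint_members:
  fixes f :: "'i \<Rightarrow> 'w \<Rightarrow> 'a set" and R :: real
  assumes I: "finite I" and X: "finite X"
    and \<Omega>: "\<And>i. i \<in> I \<Longrightarrow> finite (\<Omega> i) \<and> \<Omega> i \<noteq> {}"
    and sub: "\<And>i \<omega>. i \<in> I \<Longrightarrow> \<omega> \<in> \<Omega> i \<Longrightarrow> f i \<omega> \<subseteq> X \<and> card (f i \<omega>) \<le> m"
    and spread: "\<And>i B. i \<in> I \<Longrightarrow> real (card {\<omega>\<in>\<Omega> i. B \<subseteq> f i \<omega>}) * R ^ card B \<le> real (card (\<Omega> i))"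
    and R: "16 * real (card I * M) \<le> R"
    and M: "0 < M" "card I * m < 4 ^ M"
  shows "\<exists>\<omega>. (\<forall>i\<in>I. \<omega> i \<in> \<Omega> i) \<and> (\<forall>i\<in>I. \<forall>j\<in>I. i \<noteq> j \<longrightarrow> f i (\<omega> i) \<inter> f j (\<omega> j) = {})"
proof (cases "I = {}")
  case True
  then show ?thesis by auto
next
  case False
  define Q where "Q = I \<times> {..<M}"
  define C :: "'i \<Rightarrow> ('i \<times> nat) set" where "C i = {i} \<times> {..<M}" for i
  define fail where "fail i = {c \<in> X \<rightarrow>\<^sub>E Q. \<forall>\<omega>\<in>\<Omega> i. \<not> f i \<omega> \<subseteq> {x\<in>X. c x \<in> C i}}" for i
  have Q: "finite Q" "card Q = card I * M" using I by (auto simp: Q_def card_cartesian_product)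
  have total: "card (X \<rightarrow>\<^sub>E Q) = card Q ^ card X" using X by (rule card_funcsetE)
  have finP: "finite (X \<rightarrow>\<^sub>E Q)" using X Q by (simp add: finite_PiE)
  show ?thesis
  proof (cases "\<exists>c \<in> X \<rightarrow>\<^sub>E Q. \<forall>i\<in>I. c \<notin> fail i")
    case True
    then obtain c where c: "c \<in> X \<rightarrow>\<^sub>E Q" and good: "\<And>i. i \<in> I \<Longrightarrow> c \<notin> fail i" by blast
    have "\<forall>i\<in>I. \<exists>\<omega>. \<omega> \<in> \<Omega> i \<and> f i \<omega> \<subseteq> {x\<in>X. c x \<in> C i}"
      using good c unfolding fail_def by blast
    then obtain \<omega> where w: "\<And>i. i \<in> I \<Longrightarrow> \<omega> i \<in> \<Omega> i \<and> f i (\<omega> i) \<subseteq> {x\<in>X. c x \<in> C i}" by metis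
    have "f i (\<omega> i) \<inter> f j (\<omega> j) = {}" if "i \<in> I" "j \<in> I" "i \<noteq> j" for i j
    proof -
      have "{x\<in>X. c x \<in> C i} \<inter> {x\<in>X. c x \<in> C j} = {}" using that by (auto simp: C_def)
      then show ?thesis using w[OF that(1)] w[OF that(2)] by blast
    qed
    then show ?thesis using w by blast
  next
    case False
    have K: "card Q ^ card X > 0" using I Q(2) M(1) \<open>I \<noteq> {}\<close> by auto
    have f: "real (card (fail i)) * 4 ^ M \<le> real (card Q ^ card X) * real m" if i: "i \<in> I" for i
    proof -
      have "real (card (\<Omega> i)) * 4 ^ card (C i) * real (card (fail i))
          \<le> real (card Q ^ card X) * (\<Sum>\<omega>\<in>\<Omega> i. real (card (f i \<omega>)))" (is "?l \<le> ?c * _")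
        unfolding fail_def
      proof (rule card_failing_colourings_le)
        show "C i \<subseteq> Q" "finite (C i)" using i by (auto simp: C_def Q_def)
        show "16 * real (card Q) \<le> R" using R Q(2) by simp
      qed (use \<Omega>[OF i] X Q sub[OF i] spread[OF i] in auto)
      also have "\<dots> \<le> ?c * (\<Sum>\<omega>\<in>\<Omega> i. real m)"
        using sub[OF i] by (intro mult_left_mono sum_mono) auto
      finally have "real (card (\<Omega> i)) * (real (card (fail i)) * 4 ^ M) \<le> real (card (\<Omega> i)) * (real (card Q ^ card X) * real m)"
        by (simp add: C_def card_cartesian_product mult_ac)
      moreover have "real (card (\<Omega> i)) > 0" using \<Omega>[OF i] by (simp add: card_gt_0_iff)
      ultimately show ?thesis by (simp only: mult_le_cancel_left_pos)
    qed
    have "card Q ^ card X \<le> card (\<Union>i\<in>I. fail i)"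
      unfolding total[symmetric] using False I finP by (intro card_mono) (auto simp: fail_def)
    also have "\<dots> \<le> (\<Sum>i\<in>I. card (fail i))" using I by (rule card_UN_le)
    finally have "real (card Q ^ card X) * 4 ^ M \<le> (\<Sum>i\<in>I. real (card (fail i))) * 4 ^ M"
      by (simp flip: of_nat_sum)
    also have "\<dots> \<le> (\<Sum>i\<in>I. real (card Q ^ card X) * real m)"
      unfolding sum_distrib_right by (intro sum_mono f)
    also have "\<dots> = real (card Q ^ card X) * real (card I * m)" by simp
    finally have "4 ^ M \<le> real (card I * m)"
      using K by (simp only: of_nat_0_less_iff mult_le_cancel_left_pos)
    also have "\<dots> < real (4 ^ M)" using M(2) by (simp only: of_nat_less_iff)
    finally show ?thesis by simp
  qed
qed

section \<open>Cores\<close>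

text \<open>Testing only \<open>B\<close> disjoint from \<open>A\<close> measures spreadness in the
  link of \<open>A\<close>. The witness \<open>P\<close> may be much smaller than the set of all
  members containing \<open>A\<close>, which makes the property monotone in
  \<open>F\<close>.\<close>

definition spread_core :: "real \<Rightarrow> ('p \<Rightarrow> 'a set) \<Rightarrow> 'p set \<Rightarrow> 'a set \<Rightarrow> bool" where
  "spread_core R gr F A \<longleftrightarrow> (\<exists>P\<subseteq>F. P \<noteq> {} \<and> (\<forall>p\<in>P. A \<subseteq> gr p) \<and>
     (\<forall>B. B \<inter> A = {} \<longrightarrow> real (card {p\<in>P. B \<subseteq> gr p}) * R ^ card B \<le> real (card P)))"

lemma spread_core_mono: "spread_core r gr P A \<Longrightarrow> P \<subseteq> Q \<Longrightarrow> spread_core r gr Q A"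
  unfolding spread_core_def by (meson order_trans)

text \<open>Members of \<open>P i\<close> through a point of another core are discarded. There are
  at most \<open>card I * M\<close> such points, each lying in at most a fraction
  \<open>1 / R\<close> of \<open>P i\<close>, so at least half of \<open>P i\<close> survives. With
  \<open>A i\<close> removed, the survivors are spread with parameter \<open>R / 2\<close>: for
  nonempty \<open>B\<close> the halved base of \<open>R ^ card B\<close> absorbs the factor
  2.\<close>

lemma disjoint_spread_cores:
  fixes R :: real and gr :: "'p \<Rightarrow> 'a set"
  assumes I: "finite I" and X: "finite X"
    and F: "\<And>i. i \<in> I \<Longrightarrow> finite (F i)"
    and gr: "\<And>i p. i \<in> I \<Longrightarrow> p \<in> F i \<Longrightarrow> gr p \<subseteq> X \<and> card (gr p) \<le> m"
    and core: "\<And>i. i \<in> I \<Longrightarrow> spread_core R gr (F i) (A i)"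
    and disj: "\<And>i j. i \<in> I \<Longrightarrow> j \<in> I \<Longrightarrow> i \<noteq> j \<Longrightarrow> A i \<inter> A j = {}"
    and q: "\<And>i. i \<in> I \<Longrightarrow> card (A i) \<le> M"
    and R: "32 * real (card I * M) \<le> R"
    and M: "0 < M" "card I * m < 4 ^ M"
  shows "\<exists>p. (\<forall>i\<in>I. p i \<in> F i) \<and> (\<forall>i\<in>I. \<forall>j\<in>I. i \<noteq> j \<longrightarrow> gr (p i) \<inter> gr (p j) = {})"
proof -
  have "\<forall>i\<in>I. \<exists>P\<subseteq>F i. P \<noteq> {} \<and> (\<forall>p\<in>P. A i \<subseteq> gr p) \<and>
     (\<forall>B. B \<inter> A i = {} \<longrightarrow> real (card {p\<in>P. B \<subseteq> gr p}) * R ^ card B \<le> real (card P))"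
    using core unfolding spread_core_def by blast
  then obtain P where P: "\<And>i. i \<in> I \<Longrightarrow> P i \<subseteq> F i \<and> P i \<noteq> {} \<and> (\<forall>p\<in>P i. A i \<subseteq> gr p) \<and>
     (\<forall>B. B \<inter> A i = {} \<longrightarrow> real (card {p\<in>P i. B \<subseteq> gr p}) * R ^ card B \<le> real (card (P i)))"
    by metis
  have fP: "finite (P i)" if "i \<in> I" for i using P[OF that] F[OF that] finite_subset by blast
  have cP: "0 < card (P i)" if "i \<in> I" for i using P[OF that] fP[OF that] by (simp add: card_gt_0_iff)
  define U where "U = (\<Union>i\<in>I. A i)"
  define \<Omega> where "\<Omega> i = {p\<in>P i. gr p \<inter> U \<subseteq> A i}" for i
  have fA: "finite (A i)" if i: "i \<in> I" for i
  proof -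
    obtain p where "p \<in> P i" using P[OF i] by blast
    then show ?thesis using P[OF i] gr[OF i] X by (meson finite_subset subsetD)
  qed
  have U: "finite U" "card U \<le> card I * M"
  proof -
    show "finite U" unfolding U_def using I fA by auto
    have "card U \<le> (\<Sum>i\<in>I. card (A i))" unfolding U_def using I by (rule card_UN_le)
    also have "\<dots> \<le> (\<Sum>i\<in>I. M)" using q by (intro sum_mono) auto
    finally show "card U \<le> card I * M" by simp
  qed
  have half: "card (P i) \<le> 2 * card (\<Omega> i)" if i: "i \<in> I" for i
  proof -
    have R1: "R \<ge> 1"
    proof -
      have "card I * M \<ge> 1" using i I M by (metis One_nat_def Suc_leI card_gt_0_iff empty_iff nat_0_less_mult_iff)
      then have "real (card I * M) \<ge> 1" by linarith
      then show ?thesis using R by linarith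
    qed
    have sub: "P i - \<Omega> i \<subseteq> (\<Union>x\<in>U - A i. {p\<in>P i. {x} \<subseteq> gr p})" by (auto simp: \<Omega>_def)
    have "card (P i - \<Omega> i) \<le> card (\<Union>x\<in>U - A i. {p\<in>P i. {x} \<subseteq> gr p})"
      using sub U fP[OF i] by (intro card_mono) auto
    also have "\<dots> \<le> (\<Sum>x\<in>U - A i. card {p\<in>P i. {x} \<subseteq> gr p})"
      using U by (intro card_UN_le) auto
    finally have "real (card (P i - \<Omega> i)) * R \<le> (\<Sum>x\<in>U - A i. real (card {p\<in>P i. {x} \<subseteq> gr p})) * R"
      using R1 by (intro mult_right_mono) (auto simp flip: of_nat_sum)
    also have "\<dots> \<le> (\<Sum>x\<in>U - A i. real (card (P i)))"
      unfolding sum_distrib_right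
    proof (rule sum_mono)
      fix x assume "x \<in> U - A i"
      then have "{x} \<inter> A i = {}" by auto
      then have "real (card {p \<in> P i. {x} \<subseteq> gr p}) * R ^ card {x} \<le> real (card (P i))"
        using P[OF i] by blast
      then show "real (card {p \<in> P i. {x} \<subseteq> gr p}) * R \<le> real (card (P i))" by simp
    qed
    also have "\<dots> = real (card (U - A i)) * real (card (P i))" by simp
    also have "\<dots> \<le> (R / 2) * real (card (P i))"
    proof (rule mult_right_mono)
      have "card (U - A i) \<le> card I * M" using U by (meson Diff_subset card_mono le_trans)
      then have "real (card (U - A i)) \<le> real (card I * M)" by (simp only: of_nat_le_iff)
      then show "real (card (U - A i)) \<le> R / 2" using R by linarith
    qed simp
    finally have "R * (2 * real (card (P i - \<Omega> i))) \<le> R * real (card (P i))" by (simp add: mult_ac)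
    then have "2 * real (card (P i - \<Omega> i)) \<le> real (card (P i))" using R1 by simp
    moreover have "card (P i - \<Omega> i) = card (P i) - card (\<Omega> i)" "card (\<Omega> i) \<le> card (P i)"
      using fP[OF i] by (auto simp: \<Omega>_def intro!: card_Diff_subset card_mono)
    ultimately show ?thesis by linarith
  qed
  have "\<exists>p. (\<forall>i\<in>I. p i \<in> \<Omega> i) \<and> (\<forall>i\<in>I. \<forall>j\<in>I. i \<noteq> j \<longrightarrow> (gr (p i) - A i) \<inter> (gr (p j) - A j) = {})"
  proof (rule spread_families_disjoint_members[where R = "R / 2" and M = M and m = m])
    show "finite (\<Omega> i) \<and> \<Omega> i \<noteq> {}" if i: "i \<in> I" for i
    proof -
      have "finite (\<Omega> i)" using fP[OF i] by (auto simp: \<Omega>_def)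
      moreover have "card (\<Omega> i) > 0" using half[OF i] cP[OF i] by linarith
      ultimately show ?thesis by (simp add: card_gt_0_iff)
    qed
    show "gr p - A i \<subseteq> X \<and> card (gr p - A i) \<le> m" if "i \<in> I" "p \<in> \<Omega> i" for i p
    proof -
      have "p \<in> F i" using that P[OF that(1)] by (auto simp: \<Omega>_def)
      then have g: "gr p \<subseteq> X" "card (gr p) \<le> m" using gr[OF that(1)] by auto
      then have "card (gr p - A i) \<le> card (gr p)" using X finite_subset by (intro card_mono) auto
      then show ?thesis using g by auto
    qed
    show "real (card {p \<in> \<Omega> i. B \<subseteq> gr p - A i}) * (R / 2) ^ card B \<le> real (card (\<Omega> i))" if i: "i \<in> I" for i B
    proof (cases "B = {} \<or> B \<inter> A i \<noteq> {} \<or> infinite B")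
      case True
      then consider "B = {}" | "B \<inter> A i \<noteq> {}" | "infinite B" by blast
      then show ?thesis
      proof cases
        case 1 then show ?thesis by simp
      next
        case 2
        then have e: "{p \<in> \<Omega> i. B \<subseteq> gr p - A i} = {}" by auto
        show ?thesis unfolding e by simp
      next
        case 3
        have e: "{p \<in> \<Omega> i. B \<subseteq> gr p - A i} = {}"
        proof (rule ccontr)
          assume "{p \<in> \<Omega> i. B \<subseteq> gr p - A i} \<noteq> {}"
          then obtain p where "p \<in> \<Omega> i" "B \<subseteq> gr p" by auto
          then have "B \<subseteq> X" using P[OF i] gr[OF i] unfolding \<Omega>_def by blast
          then show False using 3 X finite_subset by blast
        qed
        show ?thesis unfolding e by simp
      qed
    next
      case False
      then have b: "B \<inter> A i = {}" "card B \<ge> 1" by (auto simp: Suc_le_eq card_gt_0_iff)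
      have R0: "R \<ge> 0" using R by (meson dual_order.trans mult_nonneg_nonneg of_nat_0_le_iff zero_le_numeral)
      have "card {p \<in> \<Omega> i. B \<subseteq> gr p - A i} \<le> card {p \<in> P i. B \<subseteq> gr p}"
        using fP[OF i] by (intro card_mono) (auto simp: \<Omega>_def)
      then have "2 * real (card {p \<in> \<Omega> i. B \<subseteq> gr p - A i}) * (R / 2) ^ card B \<le> 2 * real (card {p \<in> P i. B \<subseteq> gr p}) * (R / 2) ^ card B"
        using R0 by (intro mult_right_mono) auto
      also have "\<dots> = real (card {p \<in> P i. B \<subseteq> gr p}) * R ^ card B * (2 / 2 ^ card B)"
        by (simp add: power_divide)
      also have "\<dots> \<le> real (card {p \<in> P i. B \<subseteq> gr p}) * R ^ card B * 1"
      proof (rule mult_left_mono)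
        have "(2::real) ^ 1 \<le> 2 ^ card B" using b(2) by (intro power_increasing) auto
        then show "2 / 2 ^ card B \<le> (1::real)" by simp
      qed (use R0 in auto)
      also have "\<dots> \<le> real (card (P i))" using P[OF i] b by simp
      also have "\<dots> \<le> 2 * real (card (\<Omega> i))" using half[OF i] by linarith
      finally show ?thesis by simp
    qed
    show "16 * real (card I * M) \<le> R / 2" using R by linarith
  qed (use I X M in auto)
  then obtain p where p: "\<And>i. i \<in> I \<Longrightarrow> p i \<in> \<Omega> i"
    and d: "\<And>i j. i \<in> I \<Longrightarrow> j \<in> I \<Longrightarrow> i \<noteq> j \<Longrightarrow> (gr (p i) - A i) \<inter> (gr (p j) - A j) = {}" by blast
  have "gr (p i) \<inter> gr (p j) = {}" if ij: "i \<in> I" "j \<in> I" "i \<noteq> j" for i j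
  proof -
    have "gr (p i) \<inter> A j \<subseteq> A i" "gr (p j) \<inter> A i \<subseteq> A j"
      using p[OF ij(1)] p[OF ij(2)] ij by (auto simp: \<Omega>_def U_def)
    then show ?thesis using d[OF ij] disj[OF ij] by blast
  qed
  moreover have "p i \<in> F i" if "i \<in> I" for i using p[OF that] P[OF that] by (auto simp: \<Omega>_def)
  ultimately show ?thesis by blast
qed

text \<open>\<open>A\<close> is of maximal size among the sets contained in at least a fraction
  \<open>1 / R ^ card A\<close> of \<open>F'\<close>. Larger sets fall below their threshold, which
  is precisely the spread condition for the members of \<open>F'\<close> containing
  \<open>A\<close>. Thus \<open>A\<close> is a core inside a member of \<open>F'\<close>, and has to
  be larger than \<open>q\<close>.\<close>

lemma coreless_members_bound:
  fixes R :: real and gr :: "'p \<Rightarrow> 'a set"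
  assumes F: "finite F" and gr: "\<And>p. p \<in> F \<Longrightarrow> finite (gr p)" and R: "R > 0"
    and F': "F' = {p\<in>F. \<forall>A\<subseteq>gr p. card A \<le> q \<longrightarrow> \<not> spread_core R gr F A}"
    and ne: "F' \<noteq> {}"
  obtains p A where "p \<in> F'" "A \<subseteq> gr p" "q < card A"
    "real (card F') \<le> R ^ card A * real (card {p\<in>F'. A \<subseteq> gr p})"
proof -
  have fF': "finite F'" using F F' by auto
  define ok where "ok A \<longleftrightarrow> (\<exists>p\<in>F'. A \<subseteq> gr p) \<and> real (card F') \<le> R ^ card A * real (card {p\<in>F'. A \<subseteq> gr p})" for A
  have "ok {}" unfolding ok_def using ne by auto
  define A where "A = arg_max card ok"
  have bd: "card A \<le> (\<Sum>p\<in>F'. card (gr p))" if "ok A" for A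
  proof -
    obtain p where p: "p \<in> F'" "A \<subseteq> gr p" using \<open>ok A\<close> unfolding ok_def by blast
    then have "card A \<le> card (gr p)" using gr F' by (intro card_mono) auto
    also have "\<dots> \<le> (\<Sum>p\<in>F'. card (gr p))" using p fF' by (intro member_le_sum) auto
    finally show ?thesis .
  qed
  then have bd': "\<forall>y. ok y \<longrightarrow> card y < Suc (\<Sum>p\<in>F'. card (gr p))" by (simp add: le_imp_less_Suc)
  have okA: "ok A" unfolding A_def using \<open>ok {}\<close> bd' by (rule arg_max_natI)
  have maxA: "card B \<le> card A" if "ok B" for B
    unfolding A_def using that bd' by (rule arg_max_nat_le)
  let ?P = "{p\<in>F'. A \<subseteq> gr p}"
  have fA: "finite A" using okA gr F' unfolding ok_def by (metis (no_types, lifting) finite_subset mem_Collect_eq)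
  have "spread_core R gr F A"
    unfolding spread_core_def
  proof (intro exI conjI allI impI ballI)
    show "?P \<subseteq> F" using F' by auto
    show "?P \<noteq> {}" using okA unfolding ok_def by auto
    show "A \<subseteq> gr p" if "p \<in> ?P" for p using that by auto
    fix B assume B: "B \<inter> A = {}"
    have e: "{p\<in>?P. B \<subseteq> gr p} = {p\<in>F'. A \<union> B \<subseteq> gr p}" by auto
    show "real (card {p\<in>?P. B \<subseteq> gr p}) * R ^ card B \<le> real (card ?P)"
    proof (cases "{p\<in>F'. A \<union> B \<subseteq> gr p} = {}")
      case True
      show ?thesis unfolding e True by simp
    next
      case ne: False
      then have fB: "finite B" using gr F' finite_subset[of B] by auto
      show ?thesis
      proof (cases "B = {}")
        case True then show ?thesis by simp
      next
        case False
        have c: "card (A \<union> B) = card A + card B" using fA fB B by (simp add: card_Un_disjoint inf_commute)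
        then have "card (A \<union> B) > card A" using False fB by (simp add: card_gt_0_iff)
        then have "\<not> ok (A \<union> B)" using maxA by (meson not_le)
        then have "R ^ card (A \<union> B) * real (card {p\<in>F'. A \<union> B \<subseteq> gr p}) < real (card F')"
          using ne unfolding ok_def by auto
        also have "\<dots> \<le> R ^ card A * real (card ?P)" using okA unfolding ok_def by simp
        finally have "R ^ card A * (real (card {p\<in>F'. A \<union> B \<subseteq> gr p}) * R ^ card B) < R ^ card A * real (card ?P)"
          by (simp add: c power_add mult_ac)
        then show ?thesis unfolding e using R by simp
      qed
    qed
  qed
  moreover obtain p where p: "p \<in> F'" "A \<subseteq> gr p" using okA unfolding ok_def by blast
  ultimately have "q < card A" using F' by (metis (mono_tags, lifting) mem_Collect_eq not_le)
  then show ?thesis using that p okA unfolding ok_def by blast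
qed

section \<open>Covers of set families with bounded matching number\<close>

text \<open>Every member is reached from the empty set in \<open>t\<close> steps, each adding one of
  at most \<open>m\<close> points; the set \<open>U\<close> of candidates may depend on the set
  \<open>B\<close> reached so far.\<close>

lemma card_le_power_of_branching:
  assumes "finite \<W>" "\<And>A. A \<in> \<W> \<Longrightarrow> finite A \<and> card A = t"
    and branch: "\<And>B. card B < t \<Longrightarrow> finite B \<Longrightarrow> \<exists>A\<in>\<W>. B \<subseteq> A \<Longrightarrow> \<exists>U. finite U \<and> card U \<le> m \<and> (\<forall>A\<in>\<W>. B \<subseteq> A \<longrightarrow> (A - B) \<inter> U \<noteq> {})"
  shows "card \<W> \<le> m ^ t"
proof -
  have "card {A\<in>\<W>. B \<subseteq> A} \<le> m ^ j" if "finite B" "card B + j = t" for B j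
    using that
  proof (induction j arbitrary: B)
    case 0
    have "{A\<in>\<W>. B \<subseteq> A} \<subseteq> {B}"
      using assms(2) 0 by (metis (no_types, lifting) add.right_neutral card_subset_eq insertI1 mem_Collect_eq subsetI)
    then have "card {A\<in>\<W>. B \<subseteq> A} \<le> card {B}" by (intro card_mono) auto
    then show ?case by simp
  next
    case (Suc j)
    show ?case
    proof (cases "\<exists>A\<in>\<W>. B \<subseteq> A")
      case False
      then have e: "{A\<in>\<W>. B \<subseteq> A} = {}" by auto
      show ?thesis unfolding e by simp
    next
      case True
      then obtain U where U: "finite U" "card U \<le> m" "\<And>A. A \<in> \<W> \<Longrightarrow> B \<subseteq> A \<Longrightarrow> (A - B) \<inter> U \<noteq> {}"
        using branch[of B] Suc.prems by auto
      have "{A\<in>\<W>. B \<subseteq> A} \<subseteq> (\<Union>x\<in>U - B. {A\<in>\<W>. insert x B \<subseteq> A})" using U(3) by fastforce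
      then have "card {A\<in>\<W>. B \<subseteq> A} \<le> card (\<Union>x\<in>U - B. {A\<in>\<W>. insert x B \<subseteq> A})"
        using assms(1) U(1) by (intro card_mono) auto
      also have "\<dots> \<le> (\<Sum>x\<in>U - B. card {A\<in>\<W>. insert x B \<subseteq> A})"
        using U(1) by (intro card_UN_le) auto
      also have "\<dots> \<le> (\<Sum>x\<in>U - B. m ^ j)"
        using Suc.prems by (intro sum_mono Suc.IH) auto
      also have "\<dots> = card (U - B) * m ^ j" by simp
      also have "\<dots> \<le> m * m ^ j"
        using U by (intro mult_right_mono) (auto intro: le_trans[OF card_mono[OF U(1)]])
      finally show ?thesis by simp
    qed
  qed
  from this[of "{}" t] show ?thesis by simp
qed

definition matching_at_most :: "nat \<Rightarrow> 'a set set \<Rightarrow> bool" where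
  "matching_at_most u \<C> \<longleftrightarrow> (\<forall>\<M>\<subseteq>\<C>. (\<forall>A\<in>\<M>. \<forall>B\<in>\<M>. A \<noteq> B \<longrightarrow> A \<inter> B = {}) \<longrightarrow> card \<M> \<le> u)"

lemma matching_at_most_mono: "matching_at_most u \<C> \<Longrightarrow> \<D> \<subseteq> \<C> \<Longrightarrow> matching_at_most u \<D>"
  unfolding matching_at_most_def by (meson order_trans)

text \<open>The family is first enlarged to a maximal one with the same bounds, since maximality is
  what makes branching possible. Its minimal members of top size are counted by branching, the
  smaller ones are left to the induction. Single points are kept apart in \<open>Y\<close> because
  the application bounds their stars differently, by not being heavy.\<close>

lemma matching_at_most_cover:
  fixes \<C> :: "'a set set"
  assumes X: "finite X" and "\<And>A. A \<in> \<C> \<Longrightarrow> A \<subseteq> X \<and> A \<noteq> {} \<and> card A \<le> t" and "matching_at_most u \<C>"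
  shows "\<exists>Y \<W>. finite Y \<and> card Y \<le> u \<and>
    (\<forall>j\<in>{2..t}. finite (\<W> j) \<and> (\<forall>B\<in>\<W> j. card B = j) \<and> card (\<W> j) \<le> (u * j) ^ j) \<and>
    (\<forall>A\<in>\<C>. A \<inter> Y \<noteq> {} \<or> (\<exists>j\<in>{2..t}. \<exists>B\<in>\<W> j. B \<subseteq> A))"
  using assms(2,3)
proof (induction t arbitrary: \<C>)
  case 0
  have "\<C> = {}"
  proof (rule ccontr)
    assume "\<C> \<noteq> {}"
    then obtain A where A: "A \<in> \<C>" by blast
    then have "finite A" using 0(1) X finite_subset by blast
    then show False using 0(1)[OF A] by auto
  qed
  then show ?case by (intro exI[of _ "{}"] exI[of _ "\<lambda>_. {}"]) auto
next
  case (Suc t)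
  define adm where "adm \<D> \<longleftrightarrow> (\<forall>A\<in>\<D>. A \<subseteq> X \<and> A \<noteq> {} \<and> card A \<le> Suc t) \<and> matching_at_most u \<D>" for \<D> :: "'a set set"
  have finX: "finite A" if "A \<subseteq> X" for A using that X finite_subset by blast
  have "finite {\<D>. adm \<D>}"
    by (rule finite_subset[of _ "Pow (Pow X)"]) (use X in \<open>auto simp: adm_def\<close>)
  moreover have "\<C> \<in> {\<D>. adm \<D>}" using Suc.prems by (auto simp: adm_def)
  ultimately obtain \<D> where sub: "\<C> \<subseteq> \<D>" and adm: "adm \<D>" and max: "\<And>\<E>. adm \<E> \<Longrightarrow> \<D> \<subseteq> \<E> \<Longrightarrow> \<D> = \<E>"
    using finite_has_maximal2[of "{\<D>. adm \<D>}" \<C>] by auto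
  have fD: "finite \<D>" by (rule finite_subset[of _ "Pow X"]) (use X adm in \<open>auto simp: adm_def\<close>)
  have D: "A \<subseteq> X \<and> A \<noteq> {} \<and> card A \<le> Suc t" if "A \<in> \<D>" for A using that adm by (auto simp: adm_def)
  \<comment> \<open>Whatever meets or lies inside a minimal member does the same for every member
    above it.\<close>
  define \<T> where "\<T> = {A\<in>\<D>. \<forall>B\<in>\<D>. \<not> B \<subset> A}"
  have below: "\<exists>B\<in>\<T>. B \<subseteq> A" if "A \<in> \<D>" for A
    using finite_has_minimal2[OF fD that] unfolding \<T>_def by blast
  define \<E> where "\<E> = {A\<in>\<T>. card A \<le> t}"
  have "\<exists>Y \<W>. finite Y \<and> card Y \<le> u \<and>
    (\<forall>j\<in>{2..t}. finite (\<W> j) \<and> (\<forall>B\<in>\<W> j. card B = j) \<and> card (\<W> j) \<le> (u * j) ^ j) \<and>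
    (\<forall>A\<in>\<E>. A \<inter> Y \<noteq> {} \<or> (\<exists>j\<in>{2..t}. \<exists>B\<in>\<W> j. B \<subseteq> A))" (is "\<exists>Y \<W>. ?cov Y \<W>")
  proof (rule Suc.IH)
    show "A \<subseteq> X \<and> A \<noteq> {} \<and> card A \<le> t" if "A \<in> \<E>" for A
      using that D by (auto simp: \<E>_def \<T>_def)
    show "matching_at_most u \<E>"
      using adm unfolding adm_def \<E>_def \<T>_def by (blast intro: matching_at_most_mono)
  qed
  then obtain Y \<W> where "?cov Y \<W>" by (elim exE)
  then have Y: "finite Y" "card Y \<le> u"
    and W: "\<And>j. j \<in> {2..t} \<Longrightarrow> finite (\<W> j) \<and> (\<forall>B\<in>\<W> j. card B = j) \<and> card (\<W> j) \<le> (u * j) ^ j"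
    and cov: "\<And>A. A \<in> \<E> \<Longrightarrow> A \<inter> Y \<noteq> {} \<or> (\<exists>j\<in>{2..t}. \<exists>B\<in>\<W> j. B \<subseteq> A)"
    by auto
  define V where "V = {A\<in>\<T>. card A = Suc t}"
  have fV: "finite V" using fD by (auto simp: V_def \<T>_def)
  have cV: "card V \<le> (u * Suc t) ^ Suc t"
  proof (rule card_le_power_of_branching)
    show "finite V" by (rule fV)
    show "finite A \<and> card A = Suc t" if "A \<in> V" for A
      using that D finX unfolding V_def \<T>_def by auto
    fix B assume B: "card B < Suc t" "finite B" "\<exists>A\<in>V. B \<subseteq> A"
    \<comment> \<open>Since \<open>B\<close> could not be added to the maximal family, there is a matching that avoids \<open>B\<close>
      but meets every member of the family.\<close>
    have "\<exists>\<M>\<subseteq>\<D>. (\<forall>A\<in>\<M>. \<forall>B\<in>\<M>. A \<noteq> B \<longrightarrow> A \<inter> B = {}) \<and> (\<forall>A\<in>\<M>. A \<inter> B = {}) \<and>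
      (\<forall>A\<in>\<D>. \<exists>C\<in>\<M>. A \<inter> C \<noteq> {})"
    \<comment> \<open>Admissible families contain only nonempty sets, so maximality says nothing
      about the empty \<open>B\<close>; there a maximal matching does the job.\<close>
    proof (cases "B = {}")
      case True
      define pd where "pd = {\<M>. \<M> \<subseteq> \<D> \<and> (\<forall>A\<in>\<M>. \<forall>B\<in>\<M>. A \<noteq> B \<longrightarrow> A \<inter> B = {})}"
      have "finite pd" using fD by (auto simp: pd_def)
      moreover have "{} \<in> pd" by (auto simp: pd_def)
      ultimately obtain \<M> where M: "\<M> \<in> pd" and mx: "\<forall>\<N>\<in>pd. \<M> \<subseteq> \<N> \<longrightarrow> \<M> = \<N>"
        using finite_has_maximal2[of pd "{}"] by auto
      have "\<exists>C\<in>\<M>. A \<inter> C \<noteq> {}" if A: "A \<in> \<D>" for A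
      proof (rule ccontr)
        assume n: "\<not> (\<exists>C\<in>\<M>. A \<inter> C \<noteq> {})"
        then have "insert A \<M> \<in> pd" using M A by (auto simp: pd_def)
        then have "A \<in> \<M>" using mx by blast
        then show False using n D[OF A] by blast
      qed
      then show ?thesis using M True by (intro exI[of _ \<M>]) (auto simp: pd_def)
    next
      case False
      obtain A0 where A0: "A0 \<in> V" "B \<subseteq> A0" using B(3) by blast
      have BX: "B \<subseteq> X" using A0 D by (auto simp: V_def \<T>_def)
      have "B \<subset> A0" using A0 B(1) by (auto simp: V_def)
      then have BD: "B \<notin> \<D>" using A0 by (auto simp: V_def \<T>_def)
      then have "\<not> adm (insert B \<D>)" using max[of "insert B \<D>"] by blast
      then have "\<not> matching_at_most u (insert B \<D>)" using adm BX False B(1) by (auto simp: adm_def)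
      then obtain \<N> where N: "\<N> \<subseteq> insert B \<D>" "\<forall>A\<in>\<N>. \<forall>B\<in>\<N>. A \<noteq> B \<longrightarrow> A \<inter> B = {}" "card \<N> > u"
        unfolding matching_at_most_def by (meson not_le)
      have mD: "matching_at_most u \<D>" using adm by (auto simp: adm_def)
      have BN: "B \<in> \<N>"
      proof (rule ccontr)
        assume "B \<notin> \<N>"
        then have "\<N> \<subseteq> \<D>" using N(1) by auto
        then show False using mD N(2,3) unfolding matching_at_most_def by (meson not_le)
      qed
      define \<M> where "\<M> = \<N> - {B}"
      have M: "\<M> \<subseteq> \<D>" "\<forall>A\<in>\<M>. \<forall>B\<in>\<M>. A \<noteq> B \<longrightarrow> A \<inter> B = {}" "\<forall>A\<in>\<M>. A \<inter> B = {}"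
        using N BN unfolding \<M>_def by auto
      have fN: "finite \<N>" using N(1) fD finite_subset by blast
      have cM: "card \<M> \<ge> u" using N(3) BN fN unfolding \<M>_def by simp
      have "\<exists>C\<in>\<M>. A \<inter> C \<noteq> {}" if A: "A \<in> \<D>" for A
      proof (rule ccontr)
        assume n: "\<not> (\<exists>C\<in>\<M>. A \<inter> C \<noteq> {})"
        then have "A \<notin> \<M>" using D[OF A] by blast
        then have "card (insert A \<M>) > u" using cM fN unfolding \<M>_def by simp
        moreover have "insert A \<M> \<subseteq> \<D>" using M A by auto
        moreover have "\<forall>C\<in>insert A \<M>. \<forall>C'\<in>insert A \<M>. C \<noteq> C' \<longrightarrow> C \<inter> C' = {}"
          using M(2) n by blast
        ultimately show False using mD unfolding matching_at_most_def by (meson not_le)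
      qed
      then show ?thesis using M by (intro exI[of _ \<M>]) auto
    qed
    then obtain \<M> where M: "\<M> \<subseteq> \<D>" "\<forall>A\<in>\<M>. \<forall>B\<in>\<M>. A \<noteq> B \<longrightarrow> A \<inter> B = {}" "\<forall>A\<in>\<M>. A \<inter> B = {}"
      "\<forall>A\<in>\<D>. \<exists>C\<in>\<M>. A \<inter> C \<noteq> {}"
      by (elim exE conjE) (rule that; assumption)
    show "\<exists>U. finite U \<and> card U \<le> u * Suc t \<and> (\<forall>A\<in>V. B \<subseteq> A \<longrightarrow> (A - B) \<inter> U \<noteq> {})"
    proof (intro exI[of _ "\<Union>\<M>"] conjI ballI impI)
      have fM: "finite \<M>" using M(1) fD finite_subset by blast
      show "finite (\<Union>\<M>)" using fM M(1) D finX by blast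
      have "card \<M> \<le> u" using M(1,2) adm unfolding adm_def matching_at_most_def by blast
      have "card (\<Union>\<M>) \<le> (\<Sum>A\<in>\<M>. card A)" using fM by (metis card_Union_le_sum_card)
      also have "\<dots> \<le> (\<Sum>A\<in>\<M>. Suc t)" using M(1) D by (intro sum_mono) blast
      also have "\<dots> \<le> u * Suc t" using \<open>card \<M> \<le> u\<close> by (simp del: mult_Suc_right mult_Suc)
      finally show "card (\<Union>\<M>) \<le> u * Suc t" .
      fix A assume "A \<in> V" "B \<subseteq> A"
      then have "A \<in> \<D>" by (auto simp: V_def \<T>_def)
      then obtain C where "C \<in> \<M>" "A \<inter> C \<noteq> {}" using M(4) by blast
      then show "(A - B) \<inter> \<Union>\<M> \<noteq> {}" using M(3) by blast
    qed
  qed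
  show ?case
  proof (cases t)
    case 0
    \<comment> \<open>The minimal members are singletons, hence form a matching themselves.\<close>
    have sing: "\<exists>x. A = {x}" if "A \<in> \<D>" for A
    proof -
      have "card A = 1" using D[OF that] finX 0 by (metis One_nat_def card_0_eq le_Suc_eq le_zero_eq)
      then show ?thesis by (simp add: card_1_singleton_iff)
    qed
    have "card \<D> \<le> u"
    proof -
      have "\<forall>A\<in>\<D>. \<forall>B\<in>\<D>. A \<noteq> B \<longrightarrow> A \<inter> B = {}" using sing by fastforce
      then show ?thesis using adm unfolding adm_def matching_at_most_def by blast
    qed
    moreover have "card (\<Union>\<D>) \<le> card \<D>"
    proof -
      have "card (\<Union>\<D>) \<le> (\<Sum>A\<in>\<D>. card A)" using fD by (metis card_Union_le_sum_card)
      also have "\<dots> \<le> (\<Sum>A\<in>\<D>. 1)" using D 0 by (intro sum_mono) fastforce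
      finally show ?thesis by simp
    qed
    moreover have "finite (\<Union>\<D>)" using fD D finX by blast
    moreover have "A \<inter> \<Union>\<D> \<noteq> {}" if "A \<in> \<C>" for A using that sub D by blast
    ultimately show ?thesis using 0
      by (intro exI[of _ "\<Union>\<D>"] exI[of _ "\<lambda>_. {}"]) auto
  next
    case (Suc t')
    define \<W>' where "\<W>' = \<W>(Suc t := V)"
    have "finite (\<W>' j) \<and> (\<forall>B\<in>\<W>' j. card B = j) \<and> card (\<W>' j) \<le> (u * j) ^ j" if "j \<in> {2..Suc t}" for j
    proof (cases "j = Suc t")
      case True
      show ?thesis unfolding True using cV fV by (auto simp: \<W>'_def V_def simp del: mult_Suc_right power_Suc)
    next
      case False
      then show ?thesis using W[of j] that by (auto simp: \<W>'_def)
    qed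
    moreover have "A \<inter> Y \<noteq> {} \<or> (\<exists>j\<in>{2..Suc t}. \<exists>B\<in>\<W>' j. B \<subseteq> A)" if A: "A \<in> \<C>" for A
    proof -
      obtain B where B: "B \<in> \<T>" "B \<subseteq> A" using below sub A by blast
      show ?thesis
      proof (cases "card B \<le> t")
        case True
        then have "B \<in> \<E>" using B by (auto simp: \<E>_def)
        from cov[OF this] show ?thesis
        proof
          assume "B \<inter> Y \<noteq> {}" then show ?thesis using B by blast
        next
          assume "\<exists>j\<in>{2..t}. \<exists>C\<in>\<W> j. C \<subseteq> B"
          then obtain j C where j: "j \<in> {2..t}" "C \<in> \<W> j" "C \<subseteq> B" by blast
          then have "C \<in> \<W>' j" by (auto simp: \<W>'_def)
          then show ?thesis using j B by (intro disjI2 bexI[of _ j] bexI[of _ C]) auto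
        qed
      next
        case False
        then have "B \<in> \<W>' (Suc t)" using B D[of B] by (auto simp: \<W>'_def V_def \<T>_def)
        then show ?thesis using B Suc by (intro disjI2 bexI[of _ "Suc t"] bexI[of _ B]) auto
      qed
    qed
    ultimately show ?thesis using Y by (intro exI[of _ Y] exI[of _ \<W>']) auto
  qed
qed

section \<open>Counting permutations with forbidden cells\<close>

definition graph :: "nat \<Rightarrow> (nat \<Rightarrow> nat) \<Rightarrow> (nat \<times> nat) set" where
  "graph n p = (\<lambda>i. (i, p i)) ` {1..n}"

lemma mem_graph [simp]: "(i, j) \<in> graph n p \<longleftrightarrow> i \<in> {1..n} \<and> p i = j"
  by (auto simp: graph_def)

lemma finite_graph [simp]: "finite (graph n p)"
  by (simp add: graph_def)

lemma card_graph [simp]: "card (graph n p) = n"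
  by (simp add: graph_def card_image inj_on_def)

lemma graph_subset: "p \<in> Sym n \<Longrightarrow> graph n p \<subseteq> {1..n} \<times> {1..n}"
  unfolding graph_def Sym_def by (auto dest: permutes_in_image)

lemma perm_intersect_iff: "perm_intersect n p q \<longleftrightarrow> graph n p \<inter> graph n q \<noteq> {}"
  by (auto simp: perm_intersect_def graph_def)

lemma perm_intersect_sym: "perm_intersect n p q \<longleftrightarrow> perm_intersect n q p"
  unfolding perm_intersect_def by metis

lemma finite_Sym [simp]: "finite (Sym n)"
  by (simp add: Sym_def finite_permutations)

lemma comp_Sym: "p \<in> Sym n \<Longrightarrow> q \<in> Sym n \<Longrightarrow> p \<circ> q \<in> Sym n"
  by (simp add: Sym_def permutes_compose)

lemma inv_Sym: "p \<in> Sym n \<Longrightarrow> inv p \<in> Sym n"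
  by (simp add: Sym_def permutes_inv)

text \<open>Composition with the inverse of \<open>p0\<close> turns the permutations through
  \<open>C\<close> into those fixing every row of \<open>C\<close>.\<close>

lemma card_Sym_extending:
  assumes p0: "p0 \<in> Sym n" and C: "C \<subseteq> graph n p0"
  shows "card {p \<in> Sym n. C \<subseteq> graph n p} = fact (n - card C)"
proof -
  have i0: "inj p0" "bij p0" using p0 by (auto simp: Sym_def permutes_inj permutes_bij)
  have D: "fst ` C \<subseteq> {1..n}" using C by auto
  have cC: "card (fst ` C) = card C"
  proof (rule card_image)
    show "inj_on fst C" by (rule inj_on_subset[OF _ C]) (auto simp: inj_on_def graph_def)
  qed
  have "bij_betw (\<lambda>q. p0 \<circ> q) {q. q permutes ({1..n} - fst ` C)} {p \<in> Sym n. C \<subseteq> graph n p}"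
  proof (rule bij_betw_byWitness[where f' = "\<lambda>p. inv p0 \<circ> p"])
    show "\<forall>a\<in>{q. q permutes ({1..n} - fst ` C)}. inv p0 \<circ> (p0 \<circ> a) = a"
      using i0 by (simp add: o_assoc[symmetric] fun_eq_iff)
    show "\<forall>a'\<in>{p \<in> Sym n. C \<subseteq> graph n p}. p0 \<circ> (inv p0 \<circ> a') = a'"
      using i0 by (simp add: fun_eq_iff bij_is_surj surj_f_inv_f)
    show "(\<lambda>q. p0 \<circ> q) ` {q. q permutes ({1..n} - fst ` C)} \<subseteq> {p \<in> Sym n. C \<subseteq> graph n p}"
    proof (rule image_subsetI)
      fix q assume q: "q \<in> {q. q permutes ({1..n} - fst ` C)}"
      then have "q permutes {1..n}" using permutes_subset by blast
      then have "p0 \<circ> q \<in> Sym n" using p0 by (simp add: Sym_def permutes_compose)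
      moreover have "C \<subseteq> graph n (p0 \<circ> q)"
      proof
        fix e assume e: "e \<in> C"
        then have "q (fst e) = fst e" using q by (auto simp: permutes_def)
        then show "e \<in> graph n (p0 \<circ> q)" using e C by (cases e) auto
      qed
      ultimately show "p0 \<circ> q \<in> {p \<in> Sym n. C \<subseteq> graph n p}" by simp
    qed
    show "(\<lambda>p. inv p0 \<circ> p) ` {p \<in> Sym n. C \<subseteq> graph n p} \<subseteq> {q. q permutes ({1..n} - fst ` C)}"
    proof (rule image_subsetI)
      fix p assume p: "p \<in> {p \<in> Sym n. C \<subseteq> graph n p}"
      then have s: "inv p0 \<circ> p permutes {1..n}" using comp_Sym[OF inv_Sym[OF p0]] by (auto simp: Sym_def)
      have "(inv p0 \<circ> p) x = x" if x: "x \<in> fst ` C" for x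
      proof -
        obtain y where "(x, y) \<in> C" using x by auto
        then have "p x = y" "p0 x = y" using p C by auto
        then show ?thesis using i0(1) by (simp add: inv_f_eq)
      qed
      then show "inv p0 \<circ> p \<in> {q. q permutes ({1..n} - fst ` C)}"
        using s permutes_superset[OF s, of "{1..n} - fst ` C"] by auto
    qed
  qed
  then have "card {p \<in> Sym n. C \<subseteq> graph n p} = card {q. q permutes ({1..n} - fst ` C)}"
    by (rule bij_betw_same_card[symmetric])
  also have "\<dots> = fact (card ({1..n} - fst ` C))"
    by (rule card_permutations) auto
  also have "card ({1..n} - fst ` C) = n - card C"
    using D cC by (simp add: card_Diff_subset finite_subset[OF D])
  finally show ?thesis .
qed

lemma card_Sym_containing_le: "card {p \<in> Sym n. C \<subseteq> graph n p} \<le> fact (n - card C)"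
proof (cases "\<exists>p0\<in>Sym n. C \<subseteq> graph n p0")
  case True
  then show ?thesis by (auto simp: card_Sym_extending)
next
  case False
  then have e: "{p \<in> Sym n. C \<subseteq> graph n p} = {}" by auto
  show ?thesis unfolding e by simp
qed

text \<open>Cells are added one at a time, exchanging the values \<open>p a\<close> and
  \<open>b\<close>. No value used by \<open>C\<close> is moved: it differs from \<open>b\<close> by
  injectivity of \<open>snd\<close>, and from \<open>p a\<close> by injectivity of
  \<open>p\<close>.\<close>

lemma partial_permutation_extends:
  assumes "finite C" "C \<subseteq> {1..n} \<times> {1..n}" "inj_on fst C" "inj_on snd C"
  shows "\<exists>p\<in>Sym n. C \<subseteq> graph n p"
  using assms
proof (induction C)
  case empty
  have "id \<in> Sym n" by (simp add: Sym_def permutes_id)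
  then show ?case by auto
next
  case (insert e C)
  obtain a b where e: "e = (a, b)" by (cases e)
  obtain p where p: "p \<in> Sym n" "C \<subseteq> graph n p" using insert by auto
  have ab: "a \<in> {1..n}" "b \<in> {1..n}" using insert.prems e by auto
  then have "p a \<in> {1..n}" using p(1) by (simp only: Sym_def mem_Collect_eq permutes_in_image)
  then have "transpose (p a) b \<in> Sym n" using ab by (simp add: Sym_def permutes_swap_id)
  then have "transpose (p a) b \<circ> p \<in> Sym n" using p by (intro comp_Sym)
  moreover have "insert e C \<subseteq> graph n (transpose (p a) b \<circ> p)"
  proof (intro subsetI)
    fix z assume z: "z \<in> insert e C"
    show "z \<in> graph n (transpose (p a) b \<circ> p)"
    proof (cases "z = e")
      case True
      then show ?thesis using e ab by simp
    next
      case False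
      obtain r y where ry: "z = (r, y)" by (cases z)
      have zC: "(r, y) \<in> C" using z False ry by auto
      have r: "r \<noteq> a" using insert.prems(2) insert.hyps(2) zC e
        by (metis fst_conv inj_on_insert insert_Diff_single insert_absorb imageI Diff_insert_absorb)
      have y: "y \<noteq> b" using insert.prems(3) insert.hyps(2) zC e
        by (metis snd_conv inj_on_insert insert_Diff_single insert_absorb imageI Diff_insert_absorb)
      have pr: "p r = y" "r \<in> {1..n}" using zC p(2) by auto
      have "inj p" using p(1) by (simp add: Sym_def permutes_inj)
      then have "y \<noteq> p a" using pr r by (auto dest: injD)
      then show ?thesis using ry pr y by simp
    qed
  qed
  ultimately show ?case by blast
qed

section \<open>Lower bounds by switching\<close>

definition avoiding :: "nat \<Rightarrow> (nat \<times> nat) set \<Rightarrow> (nat \<times> nat) set \<Rightarrow> (nat \<Rightarrow> nat) set" where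
  "avoiding n C Z = {p \<in> Sym n. C \<subseteq> graph n p \<and> graph n p \<inter> Z = {}}"

lemma finite_avoiding [simp]: "finite (avoiding n C Z)"
  by (simp add: avoiding_def)

text \<open>Composing with a transposition removes the cell \<open>(i, j)\<close> from a permutation, and almost every
  transposition moving \<open>i\<close> creates no forbidden cell.\<close>

lemma avoiding_switch:
  assumes C: "finite C" and Z: "finite Z"
    and row: "card {y. (i, y) \<in> Z} \<le> 2" and col: "card {r. (r, j) \<in> Z} \<le> 2"
    and i: "i \<in> {1..n}" "i \<notin> fst ` C" and m: "m + card C + 5 \<le> n"
  shows "m * card {p \<in> avoiding n C Z. p i = j} \<le> card (avoiding n C (insert (i, j) Z))"
proof -
  \<comment> \<open>Rows that may be exchanged with \<open>i\<close>. At most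
    \<open>card C + 5\<close> rows are excluded: \<open>i\<close>, those of \<open>C\<close>, two
    rows whose value would be forbidden in row \<open>i\<close>, and two in which \<open>j\<close>
    is forbidden.\<close>
  define K where "K p = {k\<in>{1..n}. k \<noteq> i \<and> k \<notin> fst ` C \<and> (i, p k) \<notin> Z \<and> (k, j) \<notin> Z}" for p :: "nat \<Rightarrow> nat"
  let ?A = "{p \<in> avoiding n C Z. p i = j}"
  let ?S = "SIGMA p:?A. K p"
  let ?g = "\<lambda>(p, k). p \<circ> transpose i k"
  have fK: "finite (K p)" for p by (auto simp: K_def)
  have K: "m \<le> card (K p)" if "p \<in> ?A" for p
  proof -
    have ip: "inj p" using that by (auto simp: avoiding_def Sym_def permutes_inj)
    have fin1: "finite {y. (i, y) \<in> Z}"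
      by (rule finite_subset[of _ "snd ` Z"]) (use Z in force)+
    have fin2: "finite {r. (r, j) \<in> Z}"
      by (rule finite_subset[of _ "fst ` Z"]) (use Z in force)+
    have sub: "p ` {k. (i, p k) \<in> Z} \<subseteq> {y. (i, y) \<in> Z}" by auto
    have ip': "inj_on p {k. (i, p k) \<in> Z}" using ip by (rule inj_on_subset) simp
    have f1: "finite {k. (i, p k) \<in> Z}" using finite_subset[OF sub fin1] ip' by (rule finite_imageD)
    have "card {k. (i, p k) \<in> Z} \<le> card {y. (i, y) \<in> Z}" using ip' sub fin1 by (rule card_inj_on_le)
    then have c1: "card {k. (i, p k) \<in> Z} \<le> 2" using row by linarith
    let ?T = "{i} \<union> fst ` C \<union> {k. (i, p k) \<in> Z} \<union> {r. (r, j) \<in> Z}"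
    have "card ?T \<le> card {i} + card (fst ` C) + card {k. (i, p k) \<in> Z} + card {r. (r, j) \<in> Z}"
      by (meson add_mono card_Un_le le_refl le_trans)
    also have "\<dots> \<le> card C + 5" using c1 col card_image_le[OF C, of fst] by simp
    finally have "card ?T \<le> card C + 5" .
    moreover have "card {1..n} - card ?T \<le> card ({1..n} - ?T)"
      using C f1 fin2 by (intro diff_card_le_card_Diff) auto
    moreover have "card ({1..n} - ?T) \<le> card (K p)" using fK by (intro card_mono) (auto simp: K_def)
    ultimately show ?thesis using m by simp
  qed
  have "m * card ?A \<le> (\<Sum>p\<in>?A. card (K p))"
    using sum_bounded_below[of ?A m "\<lambda>p. card (K p)"] K by (simp add: mult.commute)
  also have "\<dots> = card ?S" using fK by (intro card_SigmaI[symmetric]) auto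
  also have "\<dots> \<le> card (avoiding n C (insert (i, j) Z))"
  proof (rule card_inj_on_le)
    \<comment> \<open>After the switch, \<open>k\<close> is the row with value \<open>j\<close>, so
      both \<open>k\<close> and \<open>p\<close> can be recovered.\<close>
    show "inj_on ?g ?S"
    proof (rule inj_onI)
      fix u v assume u: "u \<in> ?S" and v: "v \<in> ?S" and e: "?g u = ?g v"
      obtain p k q l where uv: "u = (p, k)" "v = (q, l)" by (cases u, cases v)
      have e': "p \<circ> transpose i k = q \<circ> transpose i l" using e uv by simp
      have pq: "p i = j" "q i = j" "inj p" using u v uv by (auto simp: avoiding_def Sym_def permutes_inj)
      have eq: "(p \<circ> transpose i k) k = (p \<circ> transpose i k) l"
        unfolding e' using pq(1,2) fun_cong[OF e', of k] by simp
      have "inj (p \<circ> transpose i k)" using pq(3) by (simp add: inj_compose)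
      then have kl: "k = l" using eq by (rule injD)
      then have "p \<circ> transpose i k \<circ> transpose i k = q \<circ> transpose i k \<circ> transpose i k" using e' by simp
      then have "p = q" by (simp add: o_assoc[symmetric])
      then show "u = v" using uv kl by simp
    qed
    show "?g ` ?S \<subseteq> avoiding n C (insert (i, j) Z)"
    proof (rule image_subsetI)
      fix u assume u: "u \<in> ?S"
      obtain p k where uv: "u = (p, k)" by (cases u)
      have p: "p \<in> Sym n" "C \<subseteq> graph n p" "graph n p \<inter> Z = {}" "p i = j"
        and k: "k \<in> {1..n}" "k \<noteq> i" "k \<notin> fst ` C" "(i, p k) \<notin> Z" "(k, j) \<notin> Z"
        using u uv by (auto simp: avoiding_def K_def)
      have ip: "inj p" using p(1) by (auto simp: Sym_def permutes_inj)
      have "p \<circ> transpose i k \<in> Sym n"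
        using p(1) i k by (intro comp_Sym) (auto simp: Sym_def permutes_swap_id)
      moreover have "C \<subseteq> graph n (p \<circ> transpose i k)"
      proof
        fix e assume e: "e \<in> C"
        then have "fst e \<noteq> i" "fst e \<noteq> k" using i k by auto
        then show "e \<in> graph n (p \<circ> transpose i k)" using e p(2) by (cases e) auto
      qed
      moreover have "(r, (p \<circ> transpose i k) r) \<notin> insert (i, j) Z" if "r \<in> {1..n}" for r
      proof -
        have "(r, p r) \<in> graph n p" using that by simp
        then have "(r, p r) \<notin> Z" using p(3) by blast
        moreover have "p k \<noteq> j" using k ip p(4) by (auto dest: injD)
        ultimately show ?thesis using k p(4) by (auto simp: transpose_def)
      qed
      then have "graph n (p \<circ> transpose i k) \<inter> insert (i, j) Z = {}" unfolding graph_def by blast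
      ultimately show "?g u \<in> avoiding n C (insert (i, j) Z)" using uv by (simp add: avoiding_def)
    qed
  qed simp
  finally show ?thesis .
qed

text \<open>Cells are forbidden one at a time. By the switch, permutations through the new cell
  number at most \<open>1 / m\<close> of those avoiding it, so each cell costs at most a factor
  \<open>1 + 1 / m\<close>.\<close>

lemma card_avoiding_ge:
  assumes "finite Z" and C: "finite C" and m: "m + card C + 5 \<le> n"
    and "\<And>i. card {y. (i, y) \<in> Z} \<le> 2" "\<And>j. card {r. (r, j) \<in> Z} \<le> 2"
    and "fst ` Z \<subseteq> {1..n} - fst ` C"
  shows "card (avoiding n C {}) * m ^ card Z \<le> card (avoiding n C Z) * (m + 1) ^ card Z"
  using assms(1,4,5,6)
proof (induction Z)
  case empty
  then show ?case by simp
next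
  case (insert e Z)
  obtain i j where e: "e = (i, j)" by (cases e)
  have row: "card {y. (i, y) \<in> Z} \<le> 2" for i
  proof -
    have "finite {y. (i, y) \<in> insert e Z}"
      by (rule finite_subset[of _ "snd ` insert e Z"]) (use insert.hyps in force)+
    then have "card {y. (i, y) \<in> Z} \<le> card {y. (i, y) \<in> insert e Z}"
      by (rule card_mono) auto
    then show ?thesis using insert.prems(1)[of i] by linarith
  qed
  have col: "card {r. (r, j) \<in> Z} \<le> 2" for j
  proof -
    have "finite {r. (r, j) \<in> insert e Z}"
      by (rule finite_subset[of _ "fst ` insert e Z"]) (use insert.hyps in force)+
    then have "card {r. (r, j) \<in> Z} \<le> card {r. (r, j) \<in> insert e Z}"
      by (rule card_mono) auto
    then show ?thesis using insert.prems(2)[of j] by linarith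
  qed
  have i: "i \<in> {1..n}" "i \<notin> fst ` C" using insert.prems(3) e by auto
  let ?N = "card (avoiding n C Z)" and ?N' = "card (avoiding n C (insert e Z))"
  have "avoiding n C Z = avoiding n C (insert e Z) \<union> {p \<in> avoiding n C Z. p i = j}"
    using e by (auto simp: avoiding_def)
  then have "?N \<le> ?N' + card {p \<in> avoiding n C Z. p i = j}"
    by (metis card_Un_le)
  then have "m * ?N \<le> m * ?N' + m * card {p \<in> avoiding n C Z. p i = j}"
    unfolding distrib_left[symmetric] by (rule mult_le_mono2)
  also have "\<dots> \<le> (m + 1) * ?N'"
    using avoiding_switch[OF C insert.hyps(1) row col i m, of j] e by simp
  finally have s: "m * ?N \<le> (m + 1) * ?N'" .
  have "card (avoiding n C {}) * m ^ card Z \<le> ?N * (m + 1) ^ card Z"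
    using insert.prems(3) by (intro insert.IH row col) auto
  then have "m * (card (avoiding n C {}) * m ^ card Z) \<le> (m * ?N) * (m + 1) ^ card Z"
    unfolding mult.assoc by (rule mult_le_mono2)
  also have "\<dots> \<le> ((m + 1) * ?N') * (m + 1) ^ card Z"
    using s by (intro mult_right_mono) auto
  finally show ?case using insert.hyps by (simp add: algebra_simps)
qed

text \<open>Here 27 is \<open>3 ^ 3\<close>, a bound for \<open>exp 3\<close>. The choice
  \<open>m = n - 7\<close> is forced by \<open>card C + 5 \<le> 7\<close>, and
  \<open>n \<ge> 21\<close> makes the at most \<open>2 * n\<close> cells at most
  \<open>3 * m\<close>.\<close>

lemma fact_le_card_avoiding:
  assumes p0: "p0 \<in> Sym n" "C \<subseteq> graph n p0" and C: "card C \<le> 2" and n: "n \<ge> 21"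
    and Z: "finite Z" "card Z \<le> 2 * n"
    and row: "\<And>i. card {y. (i, y) \<in> Z} \<le> 2" and col: "\<And>j. card {r. (r, j) \<in> Z} \<le> 2"
    and dom: "fst ` Z \<subseteq> {1..n} - fst ` C"
  shows "fact (n - card C) \<le> 27 * card (avoiding n C Z)"
proof -
  define m where "m = n - 7"
  have m: "m + card C + 5 \<le> n" "m > 0" "2 * n \<le> 3 * m" using C n by (auto simp: m_def)
  have fC: "finite C" using finite_subset[OF p0(2)] by simp
  have "card (avoiding n C {}) = fact (n - card C)"
    using card_Sym_extending[OF p0] by (simp add: avoiding_def)
  then have "fact (n - card C) * m ^ card Z \<le> card (avoiding n C Z) * (m + 1) ^ card Z"
    using card_avoiding_ge[OF Z(1) fC m(1) row col dom] by simp
  then have "real (fact (n - card C) * m ^ card Z) \<le> real (card (avoiding n C Z) * (m + 1) ^ card Z)"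
    by (simp only: of_nat_le_iff)
  then have a: "fact (n - card C) * real m ^ card Z \<le> real (card (avoiding n C Z)) * real (m + 1) ^ card Z"
    by simp
  have "real (m + 1) ^ card Z = real m ^ card Z * (1 + 1 / real m) ^ card Z"
    using m(2) by (simp add: power_mult_distrib[symmetric] field_simps)
  also have "(1 + 1 / real m) ^ card Z \<le> 27"
  proof -
    have "(1 + 1 / real m) ^ card Z \<le> exp (1 / real m) ^ card Z"
      by (intro power_mono exp_ge_add_one_self) auto
    also have "\<dots> = exp (real (card Z) / real m)" by (simp add: exp_of_nat_mult[symmetric])
    also have "\<dots> \<le> exp 3"
    proof -
      have "real (card Z) \<le> 3 * real m" using Z(2) m(3) by linarith
      then show ?thesis using m(2) by (simp add: divide_le_eq)
    qed
    also have "exp 3 = exp (1::real) ^ 3" by (simp add: exp_of_nat_mult[symmetric])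
    also have "\<dots> \<le> 3 ^ 3" by (intro power_mono exp_le) auto
    finally show ?thesis by simp
  qed
  finally have "fact (n - card C) * real m ^ card Z \<le> real (card (avoiding n C Z)) * (real m ^ card Z * 27)"
    using a by (meson mult_left_mono of_nat_0_le_iff order_trans zero_le_power)
  then have "real m ^ card Z * fact (n - card C) \<le> real m ^ card Z * (27 * real (card (avoiding n C Z)))"
    by (simp add: mult_ac)
  then have "fact (n - card C) \<le> 27 * real (card (avoiding n C Z))" using m(2) by simp
  then have "real (fact (n - card C)) \<le> real (27 * card (avoiding n C Z))" by simp
  then show ?thesis by (simp only: of_nat_le_iff)
qed

lemma power_self_le_fact: "real j ^ j \<le> 3 ^ j * fact j"
proof (induction j)
  case 0
  then show ?case by simp
next
  case (Suc j)
  have "real (Suc j) ^ j \<le> 3 * real j ^ j"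
  proof (cases "j = 0")
    case False
    have "real (Suc j) ^ j = real j ^ j * (1 + 1 / real j) ^ j"
      using False by (simp add: power_mult_distrib[symmetric] field_simps)
    also have "\<dots> \<le> real j ^ j * 3"
    proof (rule mult_left_mono)
      have "(1 + 1 / real j) ^ j \<le> exp (1 / real j) ^ j"
        by (intro power_mono exp_ge_add_one_self) auto
      also have "exp (1 / real j) ^ j = exp 1" using False by (simp add: exp_of_nat_mult[symmetric])
      also have "exp (1::real) \<le> 3" by (rule exp_le)
      finally show "(1 + 1 / real j) ^ j \<le> 3" .
    qed simp
    finally show ?thesis by (simp add: mult.commute)
  qed simp
  then have "real (Suc j) ^ Suc j \<le> real (Suc j) * (3 * real j ^ j)"
    by (simp add: mult_left_mono del: of_nat_Suc)
  also have "\<dots> \<le> real (Suc j) * (3 * (3 ^ j * fact j))"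
    using Suc by (intro mult_left_mono) auto
  finally show ?case by (simp add: mult_ac)
qed

text \<open>The quotient \<open>n! / (n - j)!\<close> is \<open>(n choose j) * j!\<close>, where
  \<open>n choose j\<close> is at least \<open>(n / j) ^ j\<close> and \<open>j!\<close> is at least
  \<open>(j / 3) ^ j\<close>.\<close>

lemma power_mult_fact_diff_le:
  assumes "j \<le> n"
  shows "real n ^ j * fact (n - j) \<le> 3 ^ j * fact n"
proof (cases "j = 0")
  case False
  have "(real n / real j) ^ j \<le> real (n choose j)"
    using assms by (rule binomial_ge_n_over_k_pow_k)
  then have "real n ^ j \<le> real (n choose j) * real j ^ j"
    using False by (simp add: power_divide divide_le_eq)
  also have "\<dots> \<le> real (n choose j) * (3 ^ j * fact j)"
    by (intro mult_left_mono power_self_le_fact) auto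
  finally have "real n ^ j * fact (n - j) \<le> 3 ^ j * (real (n choose j) * fact j * fact (n - j))"
    by (simp add: mult_ac)
  also have "real (n choose j) * fact j * fact (n - j) = real (fact j * fact (n - j) * (n choose j))"
    by simp
  also have "\<dots> = fact n" unfolding binomial_fact_lemma[OF assms] by simp
  finally show ?thesis .
qed simp

text \<open>Two permutations put at most two cells in each row and column. The rows of
  \<open>C\<close> are left out because their values are already prescribed, possibly on
  \<open>\<tau>\<close> itself: in \<open>d1_upper\<close> one cell of \<open>C\<close> is a fixed
  point.\<close>

lemma fact_le_card_avoiding_rows:
  assumes p0: "p0 \<in> Sym n" "C \<subseteq> graph n p0" and C: "card C \<le> 2" and n: "n \<ge> 21"
    and t: "\<tau> \<in> Sym n" "\<tau>' \<in> Sym n"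
  shows "fact (n - card C) \<le> 27 * card (avoiding n C {e \<in> graph n \<tau> \<union> graph n \<tau>'. fst e \<notin> fst ` C})"
proof (rule fact_le_card_avoiding[OF p0 C n])
  let ?Z = "{e \<in> graph n \<tau> \<union> graph n \<tau>'. fst e \<notin> fst ` C}"
  show "finite ?Z" by simp
  have "card ?Z \<le> card (graph n \<tau> \<union> graph n \<tau>')" by (intro card_mono) auto
  also have "\<dots> \<le> 2 * n" using card_Un_le[of "graph n \<tau>" "graph n \<tau>'"] by simp
  finally show "card ?Z \<le> 2 * n" .
  show "card {y. (i, y) \<in> ?Z} \<le> 2" for i
  proof -
    have "card {y. (i, y) \<in> ?Z} \<le> card {\<tau> i, \<tau>' i}" by (intro card_mono) auto
    also have "\<dots> \<le> 2" by (simp add: card_insert_if)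
    finally show ?thesis .
  qed
  show "card {r. (r, j) \<in> ?Z} \<le> 2" for j
  proof -
    have "inj \<tau>" "inj \<tau>'" using t by (auto simp: Sym_def permutes_inj)
    then have "card {r. (r, j) \<in> ?Z} \<le> card {inv \<tau> j, inv \<tau>' j}" by (intro card_mono) (auto simp: inv_f_f)
    also have "\<dots> \<le> 2" by (simp add: card_insert_if)
    finally show ?thesis .
  qed
  show "fst ` ?Z \<subseteq> {1..n} - fst ` C" by auto
qed

lemma fact_le_card_disjoint:
  assumes p0: "p0 \<in> Sym n" "C \<subseteq> graph n p0" and C: "card C \<le> 2" and n: "n \<ge> 21"
    and t: "\<tau> \<in> Sym n" "\<tau>' \<in> Sym n" and disj: "C \<inter> graph n \<tau> = {}" "C \<inter> graph n \<tau>' = {}"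
  shows "fact (n - card C) \<le> 27 * card {p \<in> Sym n. C \<subseteq> graph n p \<and> \<not> perm_intersect n p \<tau> \<and> \<not> perm_intersect n p \<tau>'}"
proof -
  let ?Z = "{e \<in> graph n \<tau> \<union> graph n \<tau>'. fst e \<notin> fst ` C}"
  have "avoiding n C ?Z \<subseteq> {p \<in> Sym n. C \<subseteq> graph n p \<and> \<not> perm_intersect n p \<tau> \<and> \<not> perm_intersect n p \<tau>'}"
  proof
    fix p assume "p \<in> avoiding n C ?Z"
    then have p: "p \<in> Sym n" "C \<subseteq> graph n p" "graph n p \<inter> ?Z = {}" by (auto simp: avoiding_def)
    have "(i, p i) \<in> C" if i: "(i, p i) \<in> graph n p \<inter> (graph n \<tau> \<union> graph n \<tau>')" for i
    proof -
      have "(i, p i) \<notin> ?Z" using p(3) i by blast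
      then obtain y where "(i, y) \<in> C" using i by auto
      then show ?thesis using p(2) by (metis mem_graph subsetD)
    qed
    then have "graph n p \<inter> (graph n \<tau> \<union> graph n \<tau>') \<subseteq> C" by auto
    then show "p \<in> {p \<in> Sym n. C \<subseteq> graph n p \<and> \<not> perm_intersect n p \<tau> \<and> \<not> perm_intersect n p \<tau>'}"
      using p disj by (auto simp: perm_intersect_iff)
  qed
  then have "card (avoiding n C ?Z) \<le> card {p \<in> Sym n. C \<subseteq> graph n p \<and> \<not> perm_intersect n p \<tau> \<and> \<not> perm_intersect n p \<tau>'}"
    by (intro card_mono) auto
  then show ?thesis using fact_le_card_avoiding_rows[OF p0 C n t] by linarith
qed

section \<open>Stars and the number \<open>d1 n\<close>\<close>

definition star :: "nat \<Rightarrow> nat \<times> nat \<Rightarrow> (nat \<Rightarrow> nat) set" where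
  "star n e = {p \<in> Sym n. e \<in> graph n p}"

lemma finite_star [simp]: "finite (star n e)"
  by (simp add: star_def)

lemma card_stars_common:
  assumes "C \<subseteq> {1..n} \<times> {1..n}" "inj_on fst C" "inj_on snd C"
  shows "card {p \<in> Sym n. C \<subseteq> graph n p} = fact (n - card C)"
proof -
  have "finite C" using assms(1) by (rule finite_subset) simp
  then obtain p0 where "p0 \<in> Sym n" "C \<subseteq> graph n p0"
    using partial_permutation_extends[OF _ assms] by blast
  then show ?thesis by (rule card_Sym_extending)
qed

lemma card_star:
  assumes "e \<in> {1..n} \<times> {1..n}"
  shows "card (star n e) = fact (n - 1)"
  using card_stars_common[of "{e}" n] assms by (simp add: star_def)

text \<open>The map \<open>q \<mapsto> \<sigma> \<circ> \<tau> \<circ> q \<circ> inv \<tau>\<close>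
  turns fixed points of \<open>q\<close> into agreements with \<open>\<sigma>\<close>. With
  \<open>\<tau> 1 = a\<close> and \<open>\<tau> 2 = inv \<sigma> b\<close> it turns
  \<open>q 1 = 2\<close> into the condition that \<open>a\<close> goes to \<open>b\<close>; such a
  \<open>\<tau>\<close> exists because \<open>\<sigma> a \<noteq> b\<close>.\<close>

lemma card_star_disjoint_eq_d1:
  assumes e: "(a, b) \<in> {1..n} \<times> {1..n}" and \<sigma>: "\<sigma> \<in> Sym n" "\<sigma> a \<noteq> b" and n: "2 \<le> n"
  shows "card {p \<in> star n (a, b). \<not> perm_intersect n p \<sigma>} = d1 n"
proof -
  have b\<sigma>: "bij \<sigma>" using \<sigma>(1) by (auto simp: Sym_def permutes_bij)
  define c where "c = inv \<sigma> b"
  have \<sigma>c: "\<sigma> c = b" using b\<sigma> by (simp add: c_def bij_is_surj surj_f_inv_f)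
  have c: "c \<in> {1..n}" using e \<sigma>c \<sigma>(1) by (simp add: Sym_def) (metis atLeastAtMost_iff permutes_in_image)
  have "a \<noteq> c" using \<sigma>(2) \<sigma>c by auto
  then obtain \<tau> where \<tau>: "\<tau> \<in> Sym n" "{(1, a), (2, c)} \<subseteq> graph n \<tau>"
    using partial_permutation_extends[of "{(1, a), (2, c)}" n] e c n by (auto simp: inj_on_def)
  have \<tau>12: "\<tau> 1 = a" "\<tau> 2 = c" using \<tau>(2) by auto
  have b\<tau>: "bij \<tau>" using \<tau>(1) by (auto simp: Sym_def permutes_bij)
  have \<tau>n: "\<tau> i \<in> {1..n} \<longleftrightarrow> i \<in> {1..n}" for i using \<tau>(1) by (simp only: Sym_def mem_Collect_eq permutes_in_image)
  let ?D = "{p \<in> Sym n. (\<forall>i\<in>{1..n}. p i \<noteq> i) \<and> p 1 = 2}"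
  have "bij_betw (\<lambda>q. \<sigma> \<circ> \<tau> \<circ> q \<circ> inv \<tau>) ?D {p \<in> star n (a, b). \<not> perm_intersect n p \<sigma>}"
  proof (rule bij_betw_byWitness[where f' = "\<lambda>p. inv \<tau> \<circ> inv \<sigma> \<circ> p \<circ> \<tau>"])
    show "\<forall>q\<in>?D. inv \<tau> \<circ> inv \<sigma> \<circ> (\<sigma> \<circ> \<tau> \<circ> q \<circ> inv \<tau>) \<circ> \<tau> = q"
      using b\<sigma> b\<tau> by (simp add: fun_eq_iff bij_is_inj inv_f_f)
    show "\<forall>p\<in>{p \<in> star n (a, b). \<not> perm_intersect n p \<sigma>}. \<sigma> \<circ> \<tau> \<circ> (inv \<tau> \<circ> inv \<sigma> \<circ> p \<circ> \<tau>) \<circ> inv \<tau> = p"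
      using b\<sigma> b\<tau> by (simp add: fun_eq_iff bij_is_surj surj_f_inv_f)
    show "(\<lambda>q. \<sigma> \<circ> \<tau> \<circ> q \<circ> inv \<tau>) ` ?D \<subseteq> {p \<in> star n (a, b). \<not> perm_intersect n p \<sigma>}"
    proof (rule image_subsetI)
      fix q assume q: "q \<in> ?D"
      let ?p = "\<sigma> \<circ> \<tau> \<circ> q \<circ> inv \<tau>"
      have "?p \<in> Sym n" using q \<sigma>(1) \<tau>(1) by (auto intro!: comp_Sym inv_Sym)
      moreover have "?p a = b" using q \<tau>12 \<sigma>c b\<tau> by (metis (mono_tags, lifting) bij_is_inj comp_apply inv_f_f mem_Collect_eq)
      moreover have "?p i \<noteq> \<sigma> i" if "i \<in> {1..n}" for i
      proof
        assume "?p i = \<sigma> i"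
        then have "\<tau> (q (inv \<tau> i)) = i" using b\<sigma> by (simp add: bij_is_inj inj_eq)
        then have "q (inv \<tau> i) = inv \<tau> i" using b\<tau> by (metis bij_is_inj inv_f_f)
        moreover have "inv \<tau> i \<in> {1..n}" using \<tau>n that b\<tau> by (metis bij_is_surj surj_f_inv_f)
        ultimately show False using q by auto
      qed
      ultimately show "?p \<in> {p \<in> star n (a, b). \<not> perm_intersect n p \<sigma>}"
        using e by (auto simp: star_def perm_intersect_def)
    qed
    show "(\<lambda>p. inv \<tau> \<circ> inv \<sigma> \<circ> p \<circ> \<tau>) ` {p \<in> star n (a, b). \<not> perm_intersect n p \<sigma>} \<subseteq> ?D"
    proof (rule image_subsetI)
      fix p assume p: "p \<in> {p \<in> star n (a, b). \<not> perm_intersect n p \<sigma>}"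
      then have p': "p \<in> Sym n" "p a = b" "\<And>i. i \<in> {1..n} \<Longrightarrow> p i \<noteq> \<sigma> i"
        by (auto simp: star_def perm_intersect_def)
      let ?q = "inv \<tau> \<circ> inv \<sigma> \<circ> p \<circ> \<tau>"
      have "?q \<in> Sym n" using p'(1) \<sigma>(1) \<tau>(1) by (auto intro!: comp_Sym inv_Sym)
      moreover have "?q 1 = 2" using p'(2) \<tau>12 c_def b\<tau> by (simp add: bij_is_inj inv_f_eq)
      moreover have "?q i \<noteq> i" if "i \<in> {1..n}" for i
      proof
        assume "?q i = i"
        then have "inv \<sigma> (p (\<tau> i)) = \<tau> i" using b\<tau> by (metis bij_is_surj comp_apply surj_f_inv_f)
        then have "p (\<tau> i) = \<sigma> (\<tau> i)" using b\<sigma> by (metis bij_is_surj surj_f_inv_f)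
        then show False using p'(3) \<tau>n that by blast
      qed
      ultimately show "?q \<in> ?D" by auto
    qed
  qed
  then show ?thesis unfolding d1_def by (simp add: bij_betw_same_card)
qed

lemma d1_lower:
  assumes "n \<ge> 21"
  shows "fact (n - 1) \<le> 27 * d1 n"
proof -
  have id: "id \<in> Sym n" by (simp add: Sym_def permutes_id)
  obtain p0 where p0: "p0 \<in> Sym n" "{(1, 2)} \<subseteq> graph n p0"
    using partial_permutation_extends[of "{(1, 2)}" n] assms by auto
  have "fact (n - card {(1::nat, 2::nat)}) \<le> 27 * card {p \<in> Sym n. {(1, 2)} \<subseteq> graph n p \<and> \<not> perm_intersect n p id \<and> \<not> perm_intersect n p id}"
    by (rule fact_le_card_disjoint[OF p0]) (use assms id in auto)
  also have "{p \<in> Sym n. {(1, 2)} \<subseteq> graph n p \<and> \<not> perm_intersect n p id \<and> \<not> perm_intersect n p id}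
      = {p \<in> star n (1, 2). \<not> perm_intersect n p id}" by (auto simp: star_def)
  also have "card \<dots> = d1 n" using assms id by (intro card_star_disjoint_eq_d1) auto
  finally show ?thesis by simp
qed

text \<open>For each \<open>r\<close> in \<open>{3..n}\<close> at least
  \<open>fact (n - 2) / 27\<close> permutations through \<open>(1, 2)\<close> have \<open>r\<close>
  as their only fixed point, and \<open>d1 n\<close> counts none of them. As
  \<open>27 * (n - 1) \<le> 28 * (n - 2)\<close>, they fill at least 1/28 of the star. This gap is
  what rules out a single missing heavy pair in \<open>card_heavy_ge\<close>.\<close>

lemma d1_upper:
  assumes n: "n \<ge> 30"
  shows "28 * d1 n \<le> 27 * fact (n - 1)"
proof -
  have id: "id \<in> Sym n" by (simp add: Sym_def permutes_id)
  define C where "C r = {(1::nat, 2::nat), (r, r)}" for r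
  define N where "N r = avoiding n (C r) {e \<in> graph n id \<union> graph n id. fst e \<notin> fst ` C r}" for r
  let ?D = "{p \<in> star n (1, 2). \<not> perm_intersect n p id}"
  have N: "fact (n - 2) \<le> 27 * card (N r)" if "r \<in> {3..n}" for r
  proof -
    have c2: "card (C r) = 2" using that by (auto simp: C_def)
    have "\<exists>p\<in>Sym n. C r \<subseteq> graph n p"
      by (rule partial_permutation_extends) (use that n in \<open>auto simp: C_def inj_on_def\<close>)
    then obtain p0 where p0: "p0 \<in> Sym n" "C r \<subseteq> graph n p0" by blast
    have "fact (n - card (C r)) \<le> 27 * card (N r)"
      unfolding N_def by (rule fact_le_card_avoiding_rows[OF p0]) (use id n c2 in auto)
    then show ?thesis using c2 by simp
  qed
  have dj: "N r \<inter> N t = {}" if "r \<noteq> t" "r \<in> {3..n}" "t \<in> {3..n}" for r t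
  proof (rule ccontr)
    assume "N r \<inter> N t \<noteq> {}"
    then obtain p where p: "p \<in> N r" "p \<in> N t" by blast
    then have "(t, t) \<in> graph n p" by (auto simp: N_def avoiding_def C_def)
    moreover have "(t, t) \<in> {e \<in> graph n id \<union> graph n id. fst e \<notin> fst ` C r}" using that by (auto simp: C_def)
    ultimately show False using p(1) unfolding N_def avoiding_def by blast
  qed
  have "(n - 2) * fact (n - 2) = (\<Sum>r\<in>{3..n}. fact (n - 2))" using n by simp
  also have "\<dots> \<le> (\<Sum>r\<in>{3..n}. 27 * card (N r))" using N by (intro sum_mono) auto
  also have "\<dots> = 27 * card (\<Union>r\<in>{3..n}. N r)"
    using dj by (subst card_UN_disjoint) (auto simp: N_def sum_distrib_left)
  finally have a: "(n - 2) * fact (n - 2) \<le> 27 * card (\<Union>r\<in>{3..n}. N r)" .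
  have s: "(\<Union>r\<in>{3..n}. N r) \<subseteq> star n (1, 2) - ?D"
    using n by (auto simp: N_def avoiding_def C_def star_def perm_intersect_def)
  have "card (\<Union>r\<in>{3..n}. N r) \<le> card (star n (1, 2) - ?D)"
    using s by (intro card_mono) auto
  also have "\<dots> = fact (n - 1) - d1 n"
  proof -
    have "card (star n (1, 2) - ?D) = card (star n (1, 2)) - card ?D" by (intro card_Diff_subset) auto
    moreover have "card ?D = d1 n" using id n by (intro card_star_disjoint_eq_d1) auto
    moreover have "card (star n (1, 2)) = fact (n - 1)" using n by (intro card_star) auto
    ultimately show ?thesis by simp
  qed
  finally have b: "card (\<Union>r\<in>{3..n}. N r) \<le> fact (n - 1) - d1 n" .
  have f: "fact (n - 1) = (n - 1) * (fact (n - 2) :: nat)"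
    using n fact_reduce[of "n - 1", where 'a = nat] by (simp add: numeral_2_eq_2)
  have "27 * (n - 1) \<le> 28 * (n - 2)" using n by simp
  then have "27 * fact (n - 1) \<le> 28 * ((n - 2) * fact (n - 2))"
    unfolding f by (metis mult.assoc mult_le_mono1)
  moreover have "0 < (n - 2) * (fact (n - 2) :: nat)" using n by (simp add: fact_gt_zero)
  ultimately show ?thesis using a b by linarith
qed

section \<open>Large parameters\<close>

locale large_parameters =
  fixes n s M :: nat
  assumes s2: "2 \<le> s" and n2: "2 \<le> n" and nM: "n \<le> 2 ^ M" and big: "2 ^ 16 * (s * M) \<le> n"
begin

abbreviation R :: real where "R \<equiv> real n / 2 ^ 11"

lemma M_pos: "0 < M"
  using nM n2 by (cases M) auto

lemma big': "65536 * (s * M) \<le> n"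
  using big by simp

lemma n_ge: "2 ^ 17 \<le> n" "s * M \<le> n" "s < n" "M \<le> n"
proof -
  have "2 * 1 \<le> s * M" using s2 M_pos by (intro mult_le_mono) auto
  then show "2 ^ 17 \<le> n" using big' by simp
  show "s * M \<le> n" using big' by simp
  have "s \<le> s * M" "M \<le> s * M" using M_pos s2 by simp_all
  then show "s < n" "M \<le> n" using big' s2 by linarith+
qed

lemma fact_consec: "fact n = n * (fact (n - 1) :: nat)" "fact (n - 1) = (n - 1) * (fact (n - 2) :: nat)"
    "fact (n - 2) = (n - 2) * (fact (n - 3) :: nat)"
proof -
  have "3 \<le> n" using n_ge(1) by simp
  then show "fact n = n * (fact (n - 1) :: nat)" "fact (n - 1) = (n - 1) * (fact (n - 2) :: nat)"
    "fact (n - 2) = (n - 2) * (fact (n - 3) :: nat)"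
    using fact_reduce[of n, where 'a = nat] fact_reduce[of "n - 1", where 'a = nat]
      fact_reduce[of "n - 2", where 'a = nat]
    by (simp_all add: numeral_eq_Suc)
qed

text \<open>Requiring \<open>b\<close> further pairs divides the star by at least
  \<open>((n - 1) / 3) ^ b\<close>, and \<open>3 * R\<close> is at most
  \<open>(n - 1) / 512\<close>. This leaves a surplus of \<open>512 ^ b\<close>; for
  \<open>b \<ge> 1\<close> one factor 512 compensates for the sparseness of
  \<open>P\<close>.\<close>

lemma spread_core_of_large_substar:
  assumes P: "P \<subseteq> star n e" and c: "fact (n - 1) \<le> 512 * card P"
  shows "spread_core R (graph n) P {e}"
  unfolding spread_core_def
proof (intro exI[of _ P] conjI allI impI ballI)
  show "P \<noteq> {}"
  proof
    assume "P = {}"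
    then show False using c by (simp add: fact_nonzero)
  qed
  show "{e} \<subseteq> graph n p" if "p \<in> P" for p using that P by (auto simp: star_def)
  fix B assume B: "B \<inter> {e} = {}"
  show "real (card {p \<in> P. B \<subseteq> graph n p}) * R ^ card B \<le> real (card P)"
  proof (cases "{p \<in> P. B \<subseteq> graph n p} = {} \<or> B = {}")
    case True
    then show ?thesis
    proof
      assume e: "{p \<in> P. B \<subseteq> graph n p} = {}"
      show ?thesis unfolding e by simp
    qed simp
  next
    case False
    then obtain p where p: "p \<in> P" "B \<subseteq> graph n p" by auto
    then have fB: "finite B" using finite_subset by (metis finite_graph)
    define b where "b = card B"
    have b1: "1 \<le> b" using False fB by (simp add: b_def Suc_le_eq card_gt_0_iff)
    have sub: "insert e B \<subseteq> graph n p" using p P by (auto simp: star_def)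
    have cb: "card (insert e B) = Suc b" using B fB by (simp add: b_def)
    have bn: "b \<le> n - 1" using card_mono[OF finite_graph sub] cb by simp
    have "card {p \<in> P. B \<subseteq> graph n p} \<le> card {p \<in> Sym n. insert e B \<subseteq> graph n p}"
      using P by (intro card_mono) (auto simp: star_def)
    also have "\<dots> \<le> fact (n - Suc b)" using card_Sym_containing_le[of n "insert e B"] cb by simp
    finally have "real (card {p \<in> P. B \<subseteq> graph n p}) \<le> real (fact (n - Suc b))"
      by (simp only: of_nat_le_iff)
    then have "real (card {p \<in> P. B \<subseteq> graph n p}) * R ^ b \<le> fact (n - 1 - b) * R ^ b"
      by (intro mult_right_mono) auto
    also have "\<dots> \<le> fact (n - 1 - b) * (real (n - 1) / 1536) ^ b"
    proof (intro mult_left_mono power_mono)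
      have "4 \<le> real n" using n_ge(1) by simp
      then show "R \<le> real (n - 1) / 1536" by (simp add: of_nat_diff)
    qed auto
    also have "\<dots> = (real (n - 1) ^ b * fact (n - 1 - b)) / 1536 ^ b"
      by (simp add: power_divide)
    also have "\<dots> \<le> (3 ^ b * fact (n - 1)) / 1536 ^ b"
      by (intro divide_right_mono power_mult_fact_diff_le bn) auto
    also have "\<dots> = fact (n - 1) * (1 / 512) ^ b"
      by (simp add: power_divide power_mult_distrib[symmetric] field_simps)
    also have "\<dots> \<le> fact (n - 1) * (1 / 512) ^ 1"
      using b1 by (intro mult_left_mono power_decreasing) auto
    also have "\<dots> \<le> real (card P)"
    proof -
      have "real (fact (n - 1)) \<le> real (512 * card P)" using c by (simp only: of_nat_le_iff)
      then show ?thesis by simp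
    qed
    finally show ?thesis by (simp add: b_def)
  qed
qed auto

lemma disjoint_cores_give_disjoint_permutations:
  assumes I: "finite I" "card I \<le> s" and F: "\<And>i. i \<in> I \<Longrightarrow> F i \<subseteq> Sym n"
    and core: "\<And>i. i \<in> I \<Longrightarrow> spread_core R (graph n) (F i) (A i)"
    and disj: "\<And>i j. i \<in> I \<Longrightarrow> j \<in> I \<Longrightarrow> i \<noteq> j \<Longrightarrow> A i \<inter> A j = {}"
    and q: "\<And>i. i \<in> I \<Longrightarrow> card (A i) \<le> M"
  shows "\<exists>p. (\<forall>i\<in>I. p i \<in> F i) \<and> (\<forall>i\<in>I. \<forall>j\<in>I. i \<noteq> j \<longrightarrow> \<not> perm_intersect n (p i) (p j))"
proof -
  have "\<exists>p. (\<forall>i\<in>I. p i \<in> F i) \<and> (\<forall>i\<in>I. \<forall>j\<in>I. i \<noteq> j \<longrightarrow> graph n (p i) \<inter> graph n (p j) = {})"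
  proof (rule disjoint_spread_cores[OF I(1) _ _ _ core disj q])
    show "finite ({1..n} \<times> {1..n})" by simp
    show "finite (F i)" if "i \<in> I" for i using F[OF that] finite_subset by (metis finite_Sym)
    show "graph n p \<subseteq> {1..n} \<times> {1..n} \<and> card (graph n p) \<le> n" if "i \<in> I" "p \<in> F i" for i p
      using F[OF that(1)] that(2) graph_subset by auto
    have "card I * M \<le> s * M" using I(2) by simp
    then have "65536 * (card I * M) \<le> n" using big' by linarith
    then have "real (65536 * (card I * M)) \<le> real n" by (simp only: of_nat_le_iff)
    then show "32 * real (card I * M) \<le> R" by simp
    show "0 < M" by (rule M_pos)
    have "card I * n \<le> s * n" using I(2) by simp
    also have "\<dots> < n * n" using n_ge(3) n2 by simp
    also have "\<dots> \<le> 2 ^ M * 2 ^ M" using nM by (intro mult_le_mono)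
    also have "\<dots> = 4 ^ M" by (simp add: power_mult_distrib[symmetric])
    finally show "card I * n < 4 ^ M" .
  qed
  then show ?thesis by (simp add: perm_intersect_iff)
qed

definition coreless :: "(nat \<Rightarrow> nat) set \<Rightarrow> (nat \<Rightarrow> nat) set" where
  "coreless F = {p\<in>F. \<forall>A\<subseteq>graph n p. card A \<le> M \<longrightarrow> \<not> spread_core R (graph n) F A}"

text \<open>A set of \<open>t > M\<close> pairs lies in at most \<open>fact (n - t)\<close>
  permutations, and \<open>R ^ t * fact (n - t)\<close> is at most \<open>fact n / 512 ^ M\<close>.
  Since \<open>512 ^ M \<ge> (2 ^ M) ^ 4 \<ge> n ^ 4\<close> while
  \<open>fact n \<le> n ^ 3 * fact (n - 3)\<close>, a spare factor \<open>n > 512\<close>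
  remains.\<close>

lemma card_coreless:
  assumes F: "F \<subseteq> Sym n"
  shows "512 * card (coreless F) < fact (n - 3)"
proof (cases "coreless F = {}")
  case True
  then show ?thesis by (simp add: fact_gt_zero)
next
  case False
  have R0: "R > 0" using n2 by simp
  have fF: "finite F" using F by (rule finite_subset) simp
  obtain p A where pA: "p \<in> coreless F" "A \<subseteq> graph n p" "M < card A"
    and le: "real (card (coreless F)) \<le> R ^ card A * real (card {p\<in>coreless F. A \<subseteq> graph n p})"
    by (rule coreless_members_bound[OF fF finite_graph R0 coreless_def False])
  define t where "t = card A"
  have tn: "t \<le> n" using card_mono[OF finite_graph pA(2)] by (simp add: t_def)
  have "card {p\<in>coreless F. A \<subseteq> graph n p} \<le> card {p \<in> Sym n. A \<subseteq> graph n p}"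
    using F by (intro card_mono) (auto simp: coreless_def)
  also have "\<dots> \<le> fact (n - t)" unfolding t_def by (rule card_Sym_containing_le)
  finally have "real (card {p\<in>coreless F. A \<subseteq> graph n p}) \<le> real (fact (n - t))"
    by (simp only: of_nat_le_iff)
  then have "R ^ t * real (card {p\<in>coreless F. A \<subseteq> graph n p}) \<le> R ^ t * fact (n - t)"
    using R0 by (intro mult_left_mono) auto
  also have "\<dots> = (real n ^ t * fact (n - t)) / 2048 ^ t" by (simp add: power_divide)
  also have "\<dots> \<le> (3 ^ t * fact n) / 2048 ^ t"
    by (intro divide_right_mono power_mult_fact_diff_le tn) auto
  also have "\<dots> = (3 / 2048) ^ t * fact n" by (simp add: power_divide)
  also have "\<dots> \<le> (1 / 512) ^ t * fact n" by (intro mult_right_mono power_mono) auto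
  also have "\<dots> \<le> (1 / 512) ^ M * fact n"
    using pA(3) by (intro mult_right_mono power_decreasing) (auto simp: t_def)
  finally have "real (card (coreless F)) \<le> (1 / 512) ^ M * fact n"
    using le unfolding t_def by linarith
  then have c: "real (card (coreless F)) * 512 ^ M \<le> fact n"
    by (simp add: power_divide field_simps)
  have "real n ^ 4 \<le> 512 ^ M"
  proof -
    have "n ^ 4 \<le> (2 ^ M) ^ 4" using nM by (intro power_mono) auto
    also have "\<dots> = 16 ^ M" by (simp add: power_mult[symmetric] mult.commute[of M] power_mult)
    also have "\<dots> \<le> 512 ^ M" by (intro power_mono) auto
    finally have "real (n ^ 4) \<le> real (512 ^ M)" by (simp only: of_nat_le_iff)
    then show ?thesis by simp
  qed
  then have "real (card (coreless F)) * real n ^ 4 \<le> real (card (coreless F)) * 512 ^ M"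
    by (intro mult_left_mono) auto
  also note c
  also have "(fact n :: real) \<le> real n ^ 3 * fact (n - 3)"
  proof -
    have "(fact n :: nat) = n * ((n - 1) * ((n - 2) * fact (n - 3)))"
      unfolding fact_consec(1) fact_consec(2) fact_consec(3) ..
    also have "\<dots> \<le> n * (n * (n * fact (n - 3)))" by (intro mult_le_mono) auto
    finally have "(fact n :: nat) \<le> n ^ 3 * fact (n - 3)" by (simp add: power3_eq_cube mult_ac)
    then have "real (fact n) \<le> real (n ^ 3 * fact (n - 3))" by (simp only: of_nat_le_iff)
    then show ?thesis by simp
  qed
  finally have "real n ^ 3 * (real n * real (card (coreless F))) \<le> real n ^ 3 * fact (n - 3)"
    by (simp add: power_numeral_reduce mult_ac)
  then have "real n * real (card (coreless F)) \<le> fact (n - 3)" using n2 by simp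
  then have "real (n * card (coreless F)) \<le> real (fact (n - 3))" by simp
  then have "n * card (coreless F) \<le> fact (n - 3)" by (simp only: of_nat_le_iff)
  moreover have "512 * card (coreless F) < n * card (coreless F)"
  proof -
    have "finite (coreless F)" using fF by (simp add: coreless_def)
    then have "0 < card (coreless F)" using False by (simp add: card_gt_0_iff)
    then show ?thesis using n_ge(1) by simp
  qed
  ultimately show ?thesis by linarith
qed

text \<open>This bounds the permutations through the sets \<open>\<W> j\<close> of
  \<open>matching_at_most_cover\<close>. One factor \<open>u * j\<close> is kept, so that the result
  is linear in \<open>u\<close>; the other \<open>j - 1\<close> are at most
  \<open>n / 2 ^ 16\<close> and cancel against \<open>fact (n - j)\<close>.\<close>

lemma sum_branching_le:
  assumes u: "u \<le> s"
  shows "512 * (\<Sum>j\<in>{2..M}. (u * j) ^ j * fact (n - j)) \<le> u * (fact (n - 1) :: nat)"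
proof -
  let ?a = "fact (n - 1) :: real"
  have t: "real ((u * j) ^ j * fact (n - j)) \<le> real u * ?a / 256 * (1 / 2) ^ j" if j: "j \<in> {2..M}" for j
  proof -
    obtain i where i: "j = Suc i" "1 \<le> i" using j by (cases j) auto
    have jn: "j \<le> n" using n_ge(4) j by simp
    have "u * j \<le> s * M" using u j by (intro mult_le_mono) auto
    then have "65536 * (u * j) \<le> n" using big' by linarith
    then have "real (65536 * (u * j)) \<le> real n" by (simp only: of_nat_le_iff)
    then have uj: "real (u * j) \<le> real n / 2 ^ 16" by simp
    have k: "real n ^ i * fact (n - j) \<le> 3 ^ j * ?a"
    proof -
      have "real n * (real n ^ i * fact (n - j)) \<le> 3 ^ j * fact n"
        using power_mult_fact_diff_le[OF jn] i by simp
      also have "fact n = real n * ?a" using n2 by (simp add: fact_reduce)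
      finally have "real n * (real n ^ i * fact (n - j)) \<le> real n * (3 ^ j * ?a)" by (simp add: mult_ac)
      then show ?thesis using n2 by simp
    qed
    have "real ((u * j) ^ j * fact (n - j)) = real (u * j) * real (u * j) ^ i * fact (n - j)"
      by (simp add: i)
    also have "\<dots> \<le> real (u * j) * (real n / 2 ^ 16) ^ i * fact (n - j)"
      using uj by (intro mult_right_mono mult_left_mono power_mono) auto
    also have "\<dots> = real (u * j) / (2 ^ 16) ^ i * (real n ^ i * fact (n - j))"
      by (simp add: power_divide)
    also have "\<dots> \<le> real (u * j) / (2 ^ 16) ^ i * (3 ^ j * ?a)"
      by (intro mult_left_mono k) auto
    also have "\<dots> = real u * ?a * (real j * 3 ^ j / (2 ^ 16) ^ i)" by simp
    \<comment> \<open>Summed over \<open>j \<ge> 2\<close>, the powers of 1/2 contribute at most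
      1/2, which turns 1/256 into the required 1/512.\<close>
    also have "\<dots> \<le> real u * ?a * (1 / 256 * (1 / 2) ^ j)"
    proof (intro mult_left_mono)
      \<comment> \<open>Bounding \<open>j\<close> by \<open>2 ^ j\<close> reduces the claim to
        \<open>12 * 256 * 12 ^ i \<le> 2 ^ (16 * i)\<close>; for \<open>i \<ge> 1\<close> the first
        factor is below \<open>2 ^ 12\<close> and each 12 below \<open>2 ^ 4\<close>.\<close>
      have "j < 2 ^ j" by simp
      then have "real j \<le> real (2 ^ j)" by (simp only: of_nat_le_iff less_imp_le)
      then have "real j * 3 ^ j * (256 * 2 ^ j) \<le> 2 ^ j * 3 ^ j * (256 * 2 ^ j)" by simp
      also have "\<dots> = 12 * 256 * 12 ^ i" by (simp add: i power_mult_distrib[symmetric] mult_ac)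
      also have "\<dots> \<le> (2 ^ 16) ^ i"
      proof -
        have "(12 * 256) * 12 ^ i \<le> (2 ^ 12) ^ i * (2 ^ 4 :: real) ^ i"
        proof (intro mult_mono power_mono)
          have "(2 ^ 12 :: real) ^ 1 \<le> (2 ^ 12) ^ i" using i by (intro power_increasing) auto
          then show "12 * 256 \<le> (2 ^ 12 :: real) ^ i" by simp
        qed auto
        then show ?thesis by (simp add: power_mult_distrib[symmetric])
      qed
      finally show "real j * 3 ^ j / (2 ^ 16) ^ i \<le> 1 / 256 * (1 / 2) ^ j"
        by (simp add: field_simps power_divide)
    qed auto
    finally show ?thesis by (simp add: field_simps)
  qed
  have "real (\<Sum>j\<in>{2..M}. (u * j) ^ j * fact (n - j)) \<le> (\<Sum>j\<in>{2..M}. real u * ?a / 256 * (1 / 2) ^ j)"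
    unfolding of_nat_sum by (rule sum_mono) (rule t)
  also have "\<dots> = real u * ?a / 256 * (\<Sum>j\<in>{2..M}. (1 / 2) ^ j)" by (simp add: sum_distrib_left)
  also have "\<dots> \<le> real u * ?a / 256 * (1 / 2)"
  proof (rule mult_left_mono)
    have "(\<Sum>j\<in>{2..m}. (1 / 2 :: real) ^ j) \<le> 1 / 2 - (1 / 2) ^ m \<or> m = 0" for m
    proof (induction m)
      case (Suc m)
      show ?case
      proof (cases "m = 0")
        case False
        then have "{2..Suc m} = insert (Suc m) {2..m}" by auto
        then show ?thesis using Suc False by simp
      qed simp
    qed simp
    then have "(\<Sum>j\<in>{2..M}. (1 / 2 :: real) ^ j) \<le> 1 / 2 - (1 / 2) ^ M" using M_pos by blast
    also have "\<dots> \<le> 1 / 2" by simp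
    finally show "(\<Sum>j\<in>{2..M}. (1 / 2 :: real) ^ j) \<le> 1 / 2" .
  qed auto
  finally have "real (512 * (\<Sum>j\<in>{2..M}. (u * j) ^ j * fact (n - j))) \<le> real (u * fact (n - 1))"
    by (simp add: mult_ac)
  then show ?thesis by (simp only: of_nat_le_iff)
qed

end

section \<open>Extremal families\<close>

lemma card_UN_add_inter_le:
  assumes "finite X" "\<And>x. x \<in> X \<Longrightarrow> finite (S x)" "e \<in> X" "f \<in> X" "e \<noteq> f"
  shows "card (\<Union>x\<in>X. S x) + card (S e \<inter> S f) \<le> (\<Sum>x\<in>X. card (S x))"
proof -
  have "(\<Union>x\<in>X. S x) = (S e \<union> S f) \<union> (\<Union>x\<in>X - {e} - {f}. S x)" using assms by auto
  then have "card (\<Union>x\<in>X. S x) \<le> card (S e \<union> S f) + card (\<Union>x\<in>X - {e} - {f}. S x)"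
    by (metis card_Un_le)
  moreover have "card (S e \<union> S f) + card (S e \<inter> S f) = card (S e) + card (S f)"
    using assms by (intro card_Un_Int[symmetric]) auto
  moreover have "card (\<Union>x\<in>X - {e} - {f}. S x) \<le> (\<Sum>x\<in>X - {e} - {f}. card (S x))"
    using assms by (intro card_UN_le) auto
  moreover have "(\<Sum>x\<in>X. card (S x)) = card (S e) + (card (S f) + (\<Sum>x\<in>X - {e} - {f}. card (S x)))"
    using assms by (simp add: sum.remove[of X e] sum.remove[of "X - {e}" f])
  ultimately show ?thesis by linarith
qed

text \<open>The cell \<open>(r, \<sigma> r)\<close> is compatible with \<open>(a, b)\<close> and
  lies on \<open>\<sigma>\<close> but not on \<open>\<tau>\<close>. Without such a row, the row
  where \<open>\<tau>\<close> takes \<open>b\<close> is also the one where \<open>\<sigma>\<close>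
  does; then both agree off row \<open>a\<close>, hence everywhere.\<close>

lemma permutations_differ_off_pair:
  assumes "\<sigma> \<in> Sym n" "\<tau> \<in> Sym n" "\<sigma> \<noteq> \<tau>" "\<sigma> a \<noteq> b" "\<tau> a \<noteq> b" "b \<in> {1..n}"
  shows "\<exists>r\<in>{1..n}. \<sigma> r \<noteq> \<tau> r \<and> r \<noteq> a \<and> \<sigma> r \<noteq> b"
proof (rule ccontr)
  assume "\<not> ?thesis"
  then have H: "\<sigma> r = \<tau> r \<or> r = a \<or> \<sigma> r = b" if "r \<in> {1..n}" for r using that by blast
  have ps: "\<sigma> permutes {1..n}" "\<tau> permutes {1..n}" using assms by (auto simp: Sym_def)
  have inj: "inj \<sigma>" "inj \<tau>" using ps permutes_inj by auto
  have surj: "\<exists>z\<in>{1..n}. \<tau> z = y" if "y \<in> {1..n}" for y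
    using permutes_image[OF ps(2)] that by (metis imageE)
  obtain c where c: "c \<in> {1..n}" "\<sigma> c = b" using permutes_image[OF ps(1)] assms(6) by (metis imageE)
  obtain c' where c': "c' \<in> {1..n}" "\<tau> c' = b" using surj assms(6) by blast
  have tc: "\<tau> c = b" using H[OF c'(1)] c c' assms(5) inj by (metis injD)
  have off: "\<sigma> r = \<tau> r" if "r \<in> {1..n}" "r \<noteq> a" for r
    using H[OF that(1)] that c tc inj by (metis injD)
  have "\<sigma> x = \<tau> x" for x
  proof (cases "x \<in> {1..n} \<and> x = a")
    case True
    then have "\<sigma> a \<in> {1..n}" using ps(1) by (metis permutes_in_image)
    then obtain z where z: "z \<in> {1..n}" "\<tau> z = \<sigma> a" using surj by blast
    then show ?thesis using off[of z] inj True by (metis injD)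
  next
    case False
    then show ?thesis using off ps by (cases "x \<in> {1..n}") (auto simp: permutes_not_in)
  qed
  then show False using assms(3) by auto
qed

text \<open>\<open>no_matching\<close> and \<open>cover\<close> are the hypotheses on
  \<open>nu\<close> and \<open>tau\<close> freed from \<open>Max\<close> and \<open>Min\<close>.
  \<open>large\<close> says that the claimed bound is reached, with \<open>d1 n\<close> on the other
  side to stay within the natural numbers.\<close>

locale extremal_family = large_parameters +
  fixes F :: "(nat \<Rightarrow> nat) set"
  assumes F: "F \<subseteq> Sym n"
    and no_matching: "\<And>G. G \<subseteq> F \<Longrightarrow> \<forall>p\<in>G. \<forall>q\<in>G. p \<noteq> q \<longrightarrow> \<not> perm_intersect n p q \<Longrightarrow> card G < s"
    and cover: "\<And>X. X \<subseteq> {1..n} \<times> {1..n} \<Longrightarrow> card X < s \<Longrightarrow> \<exists>p\<in>F. graph n p \<inter> X = {}"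
    and large: "(s - 1) * fact (n - 1) + 1 \<le> card F + d1 n"
begin

lemma finF: "finite F"
  using F by (rule finite_subset) simp

lemma perm_intersect_refl: "perm_intersect n p p"
  using n2 by (auto simp: perm_intersect_def)

text \<open>From \<open>s\<close> disjoint cores one would get \<open>s\<close> disjoint members.
  Cores are indexed, not collected in a set, so that one may be repeated:
  \<open>empty_not_core\<close> takes \<open>s\<close> copies of the empty set.\<close>

lemma card_disjoint_cores_less:
  assumes I: "finite I" and core: "\<And>i. i \<in> I \<Longrightarrow> spread_core R (graph n) F (A i) \<and> card (A i) \<le> M"
    and disj: "\<And>i j. i \<in> I \<Longrightarrow> j \<in> I \<Longrightarrow> i \<noteq> j \<Longrightarrow> A i \<inter> A j = {}"
  shows "card I < s"
proof (rule ccontr)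
  assume "\<not> card I < s"
  then obtain J where J: "J \<subseteq> I" "card J = s" "finite J" using obtain_subset_with_card_n[of s I] by auto
  have "\<exists>p. (\<forall>i\<in>J. p i \<in> F) \<and> (\<forall>i\<in>J. \<forall>j\<in>J. i \<noteq> j \<longrightarrow> \<not> perm_intersect n (p i) (p j))"
  proof (rule disjoint_cores_give_disjoint_permutations[where A = A])
    show "A i \<inter> A j = {}" if "i \<in> J" "j \<in> J" "i \<noteq> j" for i j using that J(1) disj by blast
  qed (use J F core in auto)
  then obtain p where p: "\<And>i. i \<in> J \<Longrightarrow> p i \<in> F"
    and d: "\<And>i j. i \<in> J \<Longrightarrow> j \<in> J \<Longrightarrow> i \<noteq> j \<Longrightarrow> \<not> perm_intersect n (p i) (p j)" by blast
  have "inj_on p J" using d perm_intersect_refl by (metis inj_onI)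
  then have "card (p ` J) = s" using J by (simp add: card_image)
  moreover have "card (p ` J) < s"
  proof (rule no_matching)
    show "p ` J \<subseteq> F" using p by blast
    show "\<forall>u\<in>p ` J. \<forall>v\<in>p ` J. u \<noteq> v \<longrightarrow> \<not> perm_intersect n u v" using d by blast
  qed
  ultimately show False by simp
qed

text \<open>Each \<open>{e}\<close> is a core of the family \<open>P e\<close> itself, not merely of
  \<open>F\<close>, so the disjoint permutations obtained from these cores automatically miss the
  members of \<open>T\<close>.\<close>

lemma extend_matching:
  assumes I: "finite I" "card I \<le> s" and T: "T \<subseteq> F" "\<And>p q. p \<in> T \<Longrightarrow> q \<in> T \<Longrightarrow> p \<noteq> q \<Longrightarrow> \<not> perm_intersect n p q"
    and P: "\<And>e. e \<in> I \<Longrightarrow> P e \<subseteq> F \<inter> star n e" "\<And>e. e \<in> I \<Longrightarrow> fact (n - 1) \<le> 512 * card (P e)"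
    and PT: "\<And>e p q. e \<in> I \<Longrightarrow> p \<in> P e \<Longrightarrow> q \<in> T \<Longrightarrow> \<not> perm_intersect n p q"
  shows "card T + card I < s"
proof -
  have "\<exists>p. (\<forall>i\<in>I. p i \<in> P i) \<and> (\<forall>i\<in>I. \<forall>j\<in>I. i \<noteq> j \<longrightarrow> \<not> perm_intersect n (p i) (p j))"
  proof (rule disjoint_cores_give_disjoint_permutations[where A = "\<lambda>e. {e}"])
    show "P e \<subseteq> Sym n" if "e \<in> I" for e using P(1)[OF that] F by auto
    show "spread_core R (graph n) (P e) {e}" if "e \<in> I" for e
      using P[OF that] by (intro spread_core_of_large_substar) auto
    show "card {e} \<le> M" for e :: "nat \<times> nat" using M_pos by simp
  qed (use I in auto)
  then obtain p where p: "\<And>i. i \<in> I \<Longrightarrow> p i \<in> P i"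
    and d: "\<And>i j. i \<in> I \<Longrightarrow> j \<in> I \<Longrightarrow> i \<noteq> j \<Longrightarrow> \<not> perm_intersect n (p i) (p j)" by blast
  have "inj_on p I" using d perm_intersect_refl by (metis inj_onI)
  then have c: "card (p ` I) = card I" by (simp add: card_image)
  have "T \<inter> p ` I = {}" using PT p perm_intersect_refl by blast
  moreover have "finite T" using T(1) finF by (rule finite_subset)
  ultimately have "card (T \<union> p ` I) = card T + card I" using I c by (simp add: card_Un_disjoint)
  moreover have "card (T \<union> p ` I) < s"
  proof (rule no_matching)
    show "T \<union> p ` I \<subseteq> F" using T P(1) p by blast
    show "\<forall>u\<in>T \<union> p ` I. \<forall>v\<in>T \<union> p ` I. u \<noteq> v \<longrightarrow> \<not> perm_intersect n u v"
    proof (intro ballI impI)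
      fix u v assume uv: "u \<in> T \<union> p ` I" "v \<in> T \<union> p ` I" "u \<noteq> v"
      consider "u \<in> T" "v \<in> T" | i where "u \<in> T" "i \<in> I" "v = p i" | i where "v \<in> T" "i \<in> I" "u = p i"
        | i j where "i \<in> I" "j \<in> I" "u = p i" "v = p j" using uv by blast
      then show "\<not> perm_intersect n u v"
      proof cases
        case 1 then show ?thesis using T(2) uv(3) by blast
      next
        case 2 then show ?thesis using PT[OF 2(2) p[OF 2(2)] 2(1)] perm_intersect_sym by blast
      next
        case 3 then show ?thesis using PT[OF 3(2) p[OF 3(2)] 3(1)] by blast
      next
        case 4 then show ?thesis using d uv(3) by blast
      qed
    qed
  qed
  ultimately show ?thesis by simp
qed

section \<open>Heavy pairs\<close>

text \<open>These are the dense stars; the fraction 1/512 is the one at which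
  \<open>spread_core_of_large_substar\<close> makes \<open>{e}\<close> a core.\<close>

definition heavy :: "(nat \<times> nat) set" where
  "heavy = {e \<in> {1..n} \<times> {1..n}. fact (n - 1) \<le> 512 * card (F \<inter> star n e)}"

lemma finite_heavy: "finite heavy"
  by (simp add: heavy_def)

lemma heavy_core: "e \<in> heavy \<Longrightarrow> spread_core R (graph n) F {e} \<and> card {e} \<le> M"
  using spread_core_of_large_substar[of "F \<inter> star n e" e] M_pos
  by (auto simp: heavy_def intro: spread_core_mono)

lemma card_cores_plus_heavy_less:
  assumes X: "X \<subseteq> heavy" and fin: "finite \<A>"
    and core: "\<And>A. A \<in> \<A> \<Longrightarrow> spread_core R (graph n) F A \<and> card A \<le> M \<and> A \<inter> X = {}"
    and disj: "\<forall>A\<in>\<A>. \<forall>B\<in>\<A>. A \<noteq> B \<longrightarrow> A \<inter> B = {}"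
  shows "card \<A> + card X < s"
proof -
  have fX: "finite X" using X finite_heavy by (rule finite_subset)
  have i: "inj_on (\<lambda>e. {e}) X" by simp
  have "\<A> \<inter> (\<lambda>e. {e}) ` X = {}" using core by fastforce
  then have "card (\<A> \<union> (\<lambda>e. {e}) ` X) = card \<A> + card X"
    using fin fX by (simp add: card_Un_disjoint card_image[OF i])
  moreover have "card (\<A> \<union> (\<lambda>e. {e}) ` X) < s"
  proof (rule card_disjoint_cores_less[where A = "\<lambda>A. A"])
    show "spread_core R (graph n) F A \<and> card A \<le> M" if "A \<in> \<A> \<union> (\<lambda>e. {e}) ` X" for A
      using that core heavy_core X by blast
    show "A \<inter> B = {}" if "A \<in> \<A> \<union> (\<lambda>e. {e}) ` X" "B \<in> \<A> \<union> (\<lambda>e. {e}) ` X" "A \<noteq> B" for A B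
    proof -
      consider "A \<in> \<A>" "B \<in> \<A>" | e where "A \<in> \<A>" "e \<in> X" "B = {e}" | e where "B \<in> \<A>" "e \<in> X" "A = {e}"
        | e f where "A = {e}" "B = {f}" using \<open>A \<in> _\<close> \<open>B \<in> _\<close> by blast
      then show ?thesis
      proof cases
        case 1 then show ?thesis using disj \<open>A \<noteq> B\<close> by blast
      next
        case 2 then show ?thesis using core[OF 2(1)] by blast
      next
        case 3 then show ?thesis using core[OF 3(1)] by blast
      next
        case 4 then show ?thesis using \<open>A \<noteq> B\<close> by blast
      qed
    qed
  qed (use fin fX in simp)
  ultimately show ?thesis by simp
qed

lemma empty_not_core: "\<not> spread_core R (graph n) F {}"
proof
  assume "spread_core R (graph n) F {}"
  then have "card {..<s} < s" by (intro card_disjoint_cores_less[where A = "\<lambda>_. {}"]) auto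
  then show False by simp
qed

lemma fact_mono': "(fact (n - 3) :: nat) \<le> fact (n - 2)" "(fact (n - 2) :: nat) \<le> fact (n - 1)"
  by (auto intro: fact_mono)

lemma d1_bounds: "fact (n - 1) \<le> 27 * d1 n" "28 * d1 n \<le> 27 * fact (n - 1)"
  using n_ge(1) d1_lower[of n] d1_upper[of n] by auto

lemma star_not_heavy:
  assumes "y \<notin> heavy"
  shows "512 * card (F \<inter> star n y) \<le> fact (n - 1)"
proof (cases "y \<in> {1..n} \<times> {1..n}")
  case True
  then show ?thesis using assms by (auto simp: heavy_def)
next
  case False
  then have "F \<inter> star n y = {}" using graph_subset by (auto simp: star_def)
  then show ?thesis by simp
qed

text \<open>If \<open>u \<ge> 1\<close> heavy pairs were missing, the cores off \<open>heavy\<close>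
  would have matching number at most \<open>u\<close>. Members on no heavy star then lie on one of
  \<open>u\<close> light stars, contain a set of some \<open>\<W> j\<close>, or are coreless,
  altogether at most \<open>(2 * u + 1) / 512\<close> of \<open>fact (n - 1)\<close>. But
  \<open>large\<close> asks for \<open>u * fact (n - 1) - d1 n\<close> of them, and
  \<open>d1 n\<close> is at most 27/28 of \<open>fact (n - 1)\<close>.\<close>

lemma card_heavy_ge: "s - 1 \<le> card heavy"
proof (rule ccontr)
  assume "\<not> s - 1 \<le> card heavy"
  define u where "u = s - 1 - card heavy"
  have u: "1 \<le> u" "s - 1 = card heavy + u" "u \<le> s" using \<open>\<not> s - 1 \<le> card heavy\<close> by (auto simp: u_def)
  define \<C> where "\<C> = {A. A \<subseteq> {1..n} \<times> {1..n} \<and> A \<inter> heavy = {} \<and> card A \<le> M \<and> spread_core R (graph n) F A}"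
  have fC: "finite \<C>" by (rule finite_subset[of _ "Pow ({1..n} \<times> {1..n})"]) (auto simp: \<C>_def)
  have "matching_at_most u \<C>"
    unfolding matching_at_most_def
  proof (intro allI impI)
    fix \<M> assume M: "\<M> \<subseteq> \<C>" "\<forall>A\<in>\<M>. \<forall>B\<in>\<M>. A \<noteq> B \<longrightarrow> A \<inter> B = {}"
    have "finite \<M>" using M(1) fC by (rule finite_subset)
    then have "card \<M> + card heavy < s"
      by (intro card_cores_plus_heavy_less) (use M in \<open>auto simp: \<C>_def\<close>)
    then show "card \<M> \<le> u" using u by linarith
  qed
  moreover have "A \<subseteq> {1..n} \<times> {1..n} \<and> A \<noteq> {} \<and> card A \<le> M" if "A \<in> \<C>" for A
    using that empty_not_core by (auto simp: \<C>_def)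
  ultimately have "\<exists>Y \<W>. finite Y \<and> card Y \<le> u \<and>
    (\<forall>j\<in>{2..M}. finite (\<W> j) \<and> (\<forall>B\<in>\<W> j. card B = j) \<and> card (\<W> j) \<le> (u * j) ^ j) \<and>
    (\<forall>A\<in>\<C>. A \<inter> Y \<noteq> {} \<or> (\<exists>j\<in>{2..M}. \<exists>B\<in>\<W> j. B \<subseteq> A))" (is "\<exists>Y \<W>. ?cov Y \<W>")
    by (intro matching_at_most_cover[of "{1..n} \<times> {1..n}"]) auto
  then obtain Y \<W> where "?cov Y \<W>" by (elim exE)
  then have Y: "finite Y" "card Y \<le> u"
    and W: "\<And>j. j \<in> {2..M} \<Longrightarrow> finite (\<W> j) \<and> (\<forall>B\<in>\<W> j. card B = j) \<and> card (\<W> j) \<le> (u * j) ^ j"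
    and cov: "\<And>A. A \<in> \<C> \<Longrightarrow> A \<inter> Y \<noteq> {} \<or> (\<exists>j\<in>{2..M}. \<exists>B\<in>\<W> j. B \<subseteq> A)"
    by auto
  let ?a = "fact (n - 1) :: nat"
  let ?S1 = "\<Union>e\<in>heavy. F \<inter> star n e" and ?S2 = "\<Union>y\<in>Y - heavy. F \<inter> star n y"
    and ?S3 = "\<Union>j\<in>{2..M}. \<Union>B\<in>\<W> j. {p \<in> Sym n. B \<subseteq> graph n p}"
  have "F \<subseteq> ?S1 \<union> ?S2 \<union> ?S3 \<union> coreless F"
  proof
    fix p assume p: "p \<in> F"
    then have pS: "p \<in> Sym n" using F by auto
    show "p \<in> ?S1 \<union> ?S2 \<union> ?S3 \<union> coreless F"
    proof (cases "p \<in> coreless F \<or> graph n p \<inter> heavy \<noteq> {}")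
      case True
      then show ?thesis using p pS by (auto simp: star_def)
    next
      case False
      then obtain A where A: "A \<subseteq> graph n p" "card A \<le> M" "spread_core R (graph n) F A"
        using p by (auto simp: coreless_def)
      have "A \<in> \<C>" using A False graph_subset[OF pS] by (auto simp: \<C>_def)
      from cov[OF this] show ?thesis
      proof
        assume "A \<inter> Y \<noteq> {}"
        then obtain y where "y \<in> A" "y \<in> Y" by blast
        then have "y \<in> Y - heavy" "p \<in> F \<inter> star n y" using A(1) False p pS by (auto simp: star_def)
        then show ?thesis by blast
      next
        assume "\<exists>j\<in>{2..M}. \<exists>B\<in>\<W> j. B \<subseteq> A"
        then obtain j B where "j \<in> {2..M}" "B \<in> \<W> j" "B \<subseteq> graph n p" using A(1) by blast
        then have "p \<in> ?S3" using pS by blast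
        then show ?thesis by blast
      qed
    qed
  qed
  moreover have "finite (?S1 \<union> ?S2 \<union> ?S3 \<union> coreless F)"
    using finite_heavy Y W finF by (auto simp: coreless_def)
  ultimately have "card F \<le> card (?S1 \<union> ?S2 \<union> ?S3 \<union> coreless F)" by (rule card_mono[rotated])
  also have "\<dots> \<le> card ?S1 + card ?S2 + card ?S3 + card (coreless F)"
    by (meson add_mono card_Un_le le_refl le_trans)
  finally have c: "card F \<le> card ?S1 + card ?S2 + card ?S3 + card (coreless F)" .
  have c1: "card ?S1 \<le> card heavy * ?a"
  proof -
    have "card ?S1 \<le> (\<Sum>e\<in>heavy. card (F \<inter> star n e))" using finite_heavy by (rule card_UN_le)
    also have "\<dots> \<le> (\<Sum>e\<in>heavy. ?a)"
    proof (rule sum_mono)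
      fix e assume "e \<in> heavy"
      then have "card (star n e) = ?a" by (intro card_star) (auto simp: heavy_def)
      then show "card (F \<inter> star n e) \<le> ?a" by (metis card_mono finite_star inf_le2)
    qed
    finally show ?thesis by simp
  qed
  have c2: "512 * card ?S2 \<le> u * ?a"
  proof -
    have "512 * card ?S2 \<le> 512 * (\<Sum>y\<in>Y - heavy. card (F \<inter> star n y))"
      using Y by (intro mult_le_mono card_UN_le) auto
    also have "\<dots> \<le> (\<Sum>y\<in>Y - heavy. ?a)"
      unfolding sum_distrib_left by (intro sum_mono star_not_heavy) auto
    also have "\<dots> = card (Y - heavy) * ?a" by simp
    also have "\<dots> \<le> u * ?a"
    proof (rule mult_le_mono1)
      have "card (Y - heavy) \<le> card Y" using Y by (intro card_mono) auto
      then show "card (Y - heavy) \<le> u" using Y by linarith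
    qed
    finally show ?thesis .
  qed
  have c3: "512 * card ?S3 \<le> u * ?a"
  proof -
    have "card ?S3 \<le> (\<Sum>j\<in>{2..M}. card (\<Union>B\<in>\<W> j. {p \<in> Sym n. B \<subseteq> graph n p}))"
      by (intro card_UN_le) auto
    also have "\<dots> \<le> (\<Sum>j\<in>{2..M}. (u * j) ^ j * fact (n - j))"
    proof (rule sum_mono)
      fix j assume j: "j \<in> {2..M}"
      have "card (\<Union>B\<in>\<W> j. {p \<in> Sym n. B \<subseteq> graph n p}) \<le> (\<Sum>B\<in>\<W> j. card {p \<in> Sym n. B \<subseteq> graph n p})"
        using W[OF j] by (intro card_UN_le) auto
      also have "\<dots> \<le> (\<Sum>B\<in>\<W> j. fact (n - j))"
        using card_Sym_containing_le W[OF j] by (intro sum_mono) metis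
      also have "\<dots> = card (\<W> j) * fact (n - j)" by simp
      also have "\<dots> \<le> (u * j) ^ j * fact (n - j)" using W[OF j] by (intro mult_le_mono1) auto
      finally show "card (\<Union>B\<in>\<W> j. {p \<in> Sym n. B \<subseteq> graph n p}) \<le> (u * j) ^ j * fact (n - j)" .
    qed
    finally have "512 * card ?S3 \<le> 512 * (\<Sum>j\<in>{2..M}. (u * j) ^ j * fact (n - j))" by simp
    then show ?thesis using sum_branching_le[OF u(3)] by linarith
  qed
  have c4: "512 * card (coreless F) \<le> ?a" using card_coreless[OF F] fact_mono' by linarith
  have "(s - 1) * ?a = card heavy * ?a + u * ?a" unfolding u(2) by (rule distrib_right)
  moreover have "1 * ?a \<le> u * ?a" using u(1) by (rule mult_le_mono1)
  ultimately show False using large c c1 c2 c3 c4 d1_bounds(2) by linarith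
qed

lemma extremal_structure:
  "\<exists>X e0 \<sigma>. X \<subseteq> {1..n} \<times> {1..n} \<and> finite X \<and> card X = s - 1 \<and> e0 \<in> X \<and> \<sigma> \<in> Sym n \<and> graph n \<sigma> \<inter> X = {} \<and>
    (\<forall>e\<in>X. \<forall>f\<in>X. fst e = fst f \<or> snd e = snd f) \<and>
    F = (\<Union>e\<in>X - {e0}. star n e) \<union> {p \<in> star n e0. perm_intersect n p \<sigma>} \<union> {\<sigma>} \<and>
    card F + d1 n = (s - 1) * fact (n - 1) + 1"
proof -
  let ?a = "fact (n - 1) :: nat"
  have a1: "1 \<le> ?a" by (simp add: fact_ge_1)
  obtain X where X: "X \<subseteq> heavy" "card X = s - 1" "finite X"
    using card_heavy_ge by (rule obtain_subset_with_card_n)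
  have Xn: "X \<subseteq> {1..n} \<times> {1..n}" using X(1) by (auto simp: heavy_def)
  define F1 where "F1 = {p\<in>F. graph n p \<inter> X = {}}"
  have fF1: "finite F1" using finF by (simp add: F1_def)
  \<comment> \<open>A small core inside such a member would form, with the singletons of
    \<open>X\<close>, a system of \<open>s\<close> disjoint cores.\<close>
  have "F1 \<subseteq> coreless F"
  proof
    fix p assume p: "p \<in> F1"
    show "p \<in> coreless F"
    proof (rule ccontr)
      assume "p \<notin> coreless F"
      then obtain A where A: "A \<subseteq> graph n p" "card A \<le> M" "spread_core R (graph n) F A"
        using p by (auto simp: coreless_def F1_def)
      have "card {A} + card X < s"
        by (rule card_cores_plus_heavy_less[OF X(1)]) (use A p in \<open>auto simp: F1_def\<close>)
      then show False using X(2) s2 by simp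
    qed
  qed
  then have "card F1 \<le> card (coreless F)" using finF by (intro card_mono) (auto simp: coreless_def)
  then have g: "512 * card F1 < fact (n - 3)" using card_coreless[OF F] by linarith
  have "card X < s" using X(2) s2 by simp
  then obtain \<sigma> where "\<sigma> \<in> F" "graph n \<sigma> \<inter> X = {}" using cover[OF Xn] by blast
  then have \<sigma>F1: "\<sigma> \<in> F1" by (simp add: F1_def)
  have F1S: "\<tau> \<in> Sym n" "\<tau> \<in> F" "graph n \<tau> \<inter> X = {}" if "\<tau> \<in> F1" for \<tau> using that F by (auto simp: F1_def)
  have D: "card {p \<in> star n e. \<not> perm_intersect n p \<tau>} = d1 n" if t: "\<tau> \<in> F1" and e: "e \<in> X" for \<tau> e
  proof -
    obtain a b where ab: "e = (a, b)" by (cases e)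
    have n: "(a, b) \<in> {1..n} \<times> {1..n}" using e Xn ab by auto
    have "(a, b) \<notin> graph n \<tau>" using F1S(3)[OF t] e ab by blast
    then have "\<tau> a \<noteq> b" using n by auto
    then show ?thesis unfolding ab using n F1S(1)[OF t] n2 by (intro card_star_disjoint_eq_d1) auto
  qed
  have K: "card {p \<in> star n e. perm_intersect n p \<tau>} + d1 n = ?a" if t: "\<tau> \<in> F1" and e: "e \<in> X" for \<tau> e
  proof -
    have "star n e = {p \<in> star n e. perm_intersect n p \<tau>} \<union> {p \<in> star n e. \<not> perm_intersect n p \<tau>}" by auto
    then have "card (star n e) = card {p \<in> star n e. perm_intersect n p \<tau>} + card {p \<in> star n e. \<not> perm_intersect n p \<tau>}"
      by (metis (no_types, lifting) card_Un_disjoint disjoint_iff finite_Un finite_star mem_Collect_eq)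
    then show ?thesis using D[OF t e] card_star[of e n] Xn e by auto
  qed
  \<comment> \<open>Otherwise each of the \<open>s - 1\<close> stars has enough members missing
    \<open>\<sigma>\<close>, and \<open>\<sigma>\<close> extends to a matching of size
    \<open>s\<close>.\<close>
  have "\<exists>e\<in>X. 512 * card {p \<in> F \<inter> star n e. \<not> perm_intersect n p \<sigma>} < ?a"
  proof (rule ccontr)
    assume "\<not> ?thesis"
    then have "?a \<le> 512 * card {p \<in> F \<inter> star n e. \<not> perm_intersect n p \<sigma>}" if "e \<in> X" for e
      using that by (meson not_le)
    then have "card {\<sigma>} + card X < s"
      using X \<open>card X < s\<close> F1S(2)[OF \<sigma>F1]
      by (intro extend_matching[where P = "\<lambda>e. {p \<in> F \<inter> star n e. \<not> perm_intersect n p \<sigma>}"]) auto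
    then show False using X(2) s2 by simp
  qed
  then obtain e0 where e0: "e0 \<in> X" and b: "512 * card {p \<in> F \<inter> star n e0. \<not> perm_intersect n p \<sigma>} < ?a" by blast
  have f0: "card (F \<inter> star n e0) + d1 n \<le> ?a + card {p \<in> F \<inter> star n e0. \<not> perm_intersect n p \<sigma>}"
  proof -
    have "card (F \<inter> star n e0) \<le> card ({p \<in> star n e0. perm_intersect n p \<sigma>} \<union> {p \<in> F \<inter> star n e0. \<not> perm_intersect n p \<sigma>})"
      by (intro card_mono) auto
    also have "\<dots> \<le> card {p \<in> star n e0. perm_intersect n p \<sigma>} + card {p \<in> F \<inter> star n e0. \<not> perm_intersect n p \<sigma>}"
      by (rule card_Un_le)
    finally show ?thesis using K[OF \<sigma>F1 e0] by linarith
  qed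
  have fs: "card (F \<inter> star n e) \<le> ?a" if "e \<in> X" for e
  proof -
    have "card (F \<inter> star n e) \<le> card (star n e)" by (intro card_mono) auto
    then show ?thesis using card_star[of e n] that Xn by auto
  qed
  \<comment> \<open>The deficit \<open>d1 n\<close> permitted by \<open>large\<close> is already
    used up by the star of \<open>e0\<close>. Any other star can lack only two error terms, each at
    most 1/512: the members of the star of \<open>e0\<close> missing \<open>\<sigma>\<close>, and
    \<open>F1\<close>.\<close>
  have full: "512 * ?a \<le> 512 * card (F \<inter> star n e) + 2 * ?a" if e: "e \<in> X - {e0}" for e
  proof -
    have "F \<subseteq> (\<Union>x\<in>X. F \<inter> star n x) \<union> F1" using F by (auto simp: F1_def star_def)
    then have "card F \<le> card ((\<Union>x\<in>X. F \<inter> star n x) \<union> F1)" using X fF1 finF by (intro card_mono) auto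
    also have "\<dots> \<le> card (\<Union>x\<in>X. F \<inter> star n x) + card F1" by (rule card_Un_le)
    also have "card (\<Union>x\<in>X. F \<inter> star n x) \<le> (\<Sum>x\<in>X. card (F \<inter> star n x))" using X(3) by (rule card_UN_le)
    also have "(\<Sum>x\<in>X. card (F \<inter> star n x)) = card (F \<inter> star n e0) + (card (F \<inter> star n e) + (\<Sum>x\<in>X - {e0} - {e}. card (F \<inter> star n x)))"
      using X(3) e0 e by (simp add: sum.remove[of X e0] sum.remove[of "X - {e0}" e])
    also have "(\<Sum>x\<in>X - {e0} - {e}. card (F \<inter> star n x)) \<le> (\<Sum>x\<in>X - {e0} - {e}. ?a)"
      by (intro sum_mono fs) auto
    also have "\<dots> = card (X - {e0} - {e}) * ?a" by simp
    finally have "card F \<le> card (F \<inter> star n e0) + (card (F \<inter> star n e) + card (X - {e0} - {e}) * ?a) + card F1"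
      by simp
    moreover have "(s - 1) * ?a = card (X - {e0} - {e}) * ?a + 2 * ?a"
    proof -
      have "card X = Suc (card (X - {e0}))" using X(3) e0 by (rule card.remove)
      also have "card (X - {e0}) = Suc (card (X - {e0} - {e}))" using X(3) e by (intro card.remove) auto
      finally have "s - 1 = card (X - {e0} - {e}) + 2" using X(2) by simp
      then show ?thesis by (simp only: distrib_right)
    qed
    ultimately show ?thesis using large f0 b g fact_mono' by linarith
  qed
  \<comment> \<open>If \<open>p\<close> and \<open>\<tau>\<close> were disjoint,
    \<open>s - 2\<close> further members would complete a matching of size \<open>s\<close>. At
    least 1/27 of each remaining star misses both and at most 2/512 of it is outside
    \<open>F\<close>, which leaves more than 1/512.\<close>
  have meet: "perm_intersect n p \<tau>" if p: "p \<in> F \<inter> star n e0" "\<And>e. e \<in> X - {e0} \<Longrightarrow> p \<notin> star n e" and t: "\<tau> \<in> F1" for p \<tau>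
  proof (rule ccontr)
    assume np: "\<not> perm_intersect n p \<tau>"
    then have pt: "p \<noteq> \<tau>" using perm_intersect_refl by auto
    define P where "P e = {q \<in> F \<inter> star n e. \<not> perm_intersect n q p \<and> \<not> perm_intersect n q \<tau>}" for e
    have pS: "p \<in> Sym n" using p(1) F by auto
    have P: "?a \<le> 512 * card (P e)" if e: "e \<in> X - {e0}" for e
    proof -
      let ?Q = "{q \<in> Sym n. {e} \<subseteq> graph n q \<and> \<not> perm_intersect n q p \<and> \<not> perm_intersect n q \<tau>}"
      have "\<exists>p\<in>Sym n. {e} \<subseteq> graph n p" using e Xn by (intro partial_permutation_extends) auto
      then obtain p0 where p0: "p0 \<in> Sym n" "{e} \<subseteq> graph n p0" by blast
      have "e \<notin> graph n p" using p(2)[OF e] pS by (auto simp: star_def)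
      moreover have "e \<notin> graph n \<tau>" using F1S(3)[OF t] e by blast
      ultimately have "fact (n - card {e}) \<le> 27 * card ?Q"
        using n_ge(1) by (intro fact_le_card_disjoint[OF p0 _ _ pS F1S(1)[OF t]]) auto
      then have q: "?a \<le> 27 * card ?Q" by simp
      have "card ?Q \<le> card ((star n e - F) \<union> P e)"
        using finF by (intro card_mono) (auto simp: P_def star_def)
      also have "\<dots> \<le> card (star n e - F) + card (P e)" by (rule card_Un_le)
      finally have "card ?Q \<le> card (star n e - F) + card (P e)" .
      moreover have "card (star n e - F) + card (F \<inter> star n e) = ?a"
      proof -
        have "card ((star n e - F) \<union> (F \<inter> star n e)) = card (star n e - F) + card (F \<inter> star n e)"
          by (intro card_Un_disjoint) auto
        moreover have "(star n e - F) \<union> (F \<inter> star n e) = star n e" by auto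
        ultimately show ?thesis using card_star[of e n] e Xn by auto
      qed
      ultimately show ?thesis using q full[OF e] by linarith
    qed
    have "card {p, \<tau>} + card (X - {e0}) < s"
    proof (rule extend_matching[where P = P])
      show "finite (X - {e0})" using X by simp
      show "card (X - {e0}) \<le> s" using X e0 by simp
      show "{p, \<tau>} \<subseteq> F" using p(1) F1S(2)[OF t] by auto
      show "\<not> perm_intersect n u v" if "u \<in> {p, \<tau>}" "v \<in> {p, \<tau>}" "u \<noteq> v" for u v
        using that np perm_intersect_sym by auto
    qed (use P in \<open>auto simp: P_def\<close>)
    then show False using pt X e0 s2 by simp
  qed
  \<comment> \<open>\<open>K0\<close> is cut by all of \<open>F1\<close>, \<open>K\<sigma>\<close>
    by \<open>\<sigma>\<close> alone; what \<open>K0\<close> loses in addition will exclude a second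
    member of \<open>F1\<close>.\<close>
  define K0 where "K0 = {p \<in> star n e0. \<forall>\<tau>\<in>F1. perm_intersect n p \<tau>}"
  define K\<sigma> where "K\<sigma> = {p \<in> star n e0. perm_intersect n p \<sigma>}"
  let ?U = "\<Union>e\<in>X - {e0}. star n e"
  have FK: "F \<subseteq> ?U \<union> K0 \<union> F1"
  proof
    fix p assume p: "p \<in> F"
    show "p \<in> ?U \<union> K0 \<union> F1"
    proof (cases "p \<in> F1 \<or> p \<in> ?U")
      case False
      then have "graph n p \<inter> X \<noteq> {}" "p \<in> Sym n" using p F by (auto simp: F1_def)
      then obtain e where "e \<in> X" "p \<in> star n e" by (auto simp: star_def)
      then have "p \<in> F \<inter> star n e0" using False p by blast
      then have "p \<in> K0" unfolding K0_def using meet[of p] False by blast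
      then show ?thesis by blast
    qed auto
  qed
  have K0\<sigma>: "K0 \<subseteq> K\<sigma>" using \<sigma>F1 by (auto simp: K0_def K\<sigma>_def)
  have fK: "finite K0" "finite K\<sigma>" by (auto simp: K0_def K\<sigma>_def)
  have cU: "card ?U + ?a \<le> (s - 1) * ?a"
  proof -
    have "card ?U \<le> (\<Sum>e\<in>X - {e0}. card (star n e))" using X(3) by (intro card_UN_le) auto
    also have "\<dots> = (\<Sum>e\<in>X - {e0}. ?a)" using Xn by (intro sum.cong card_star) auto
    also have "\<dots> = card (X - {e0}) * ?a" by simp
    finally have "card ?U + ?a \<le> Suc (card (X - {e0})) * ?a" by simp
    moreover have "s - 1 = Suc (card (X - {e0}))" using card.remove[OF X(3) e0] X(2) by simp
    ultimately show ?thesis by simp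
  qed
  have cF: "card F \<le> card ?U + card K0 + card F1"
  proof -
    have "card F \<le> card (?U \<union> K0 \<union> F1)" using FK X(3) fF1 fK by (intro card_mono) auto
    also have "\<dots> \<le> card ?U + card K0 + card F1" by (meson add_mono card_Un_le le_refl le_trans)
    finally show ?thesis .
  qed
  have cK: "card K\<sigma> + d1 n = ?a" using K[OF \<sigma>F1 e0] by (simp add: K\<sigma>_def)
  \<comment> \<open>Two stars off a common line overlap, and the union bound counts the overlap
    twice. That loss of at least \<open>fact (n - 3)\<close> exceeds everything \<open>F1\<close>
    could make up for.\<close>
  have line: "fst e = fst f \<or> snd e = snd f" if ef: "e \<in> X" "f \<in> X" for e f
  proof (rule ccontr)
    assume nl: "\<not> (fst e = fst f \<or> snd e = snd f)"
    then have "e \<noteq> f" by auto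
    define S where "S x = (if x = e0 then K\<sigma> else star n x)" for x
    have "card (\<Union>x\<in>X. S x) + card (S e \<inter> S f) \<le> (\<Sum>x\<in>X. card (S x))"
      using X(3) ef \<open>e \<noteq> f\<close> fK by (intro card_UN_add_inter_le) (auto simp: S_def)
    also have "\<dots> = card K\<sigma> + (\<Sum>x\<in>X - {e0}. card (S x))"
      using X(3) e0 by (simp add: sum.remove[of X e0] S_def)
    also have "(\<Sum>x\<in>X - {e0}. card (S x)) = (\<Sum>x\<in>X - {e0}. ?a)"
    proof (rule sum.cong)
      fix x assume "x \<in> X - {e0}"
      then have "x \<in> {1..n} \<times> {1..n}" "S x = star n x" using Xn by (auto simp: S_def)
      then show "card (S x) = ?a" by (simp only: card_star)
    qed simp
    finally have s1: "card (\<Union>x\<in>X. S x) + card (S e \<inter> S f) \<le> card K\<sigma> + card (X - {e0}) * ?a"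
      by simp
    have s3: "(s - 1) * ?a = card (X - {e0}) * ?a + ?a"
    proof -
      have "s - 1 = Suc (card (X - {e0}))" using card.remove[OF X(3) e0] X(2) by simp
      then show ?thesis by simp
    qed
    \<comment> \<open>The third cell \<open>(r, \<sigma> r)\<close> makes the common permutations
      meet \<open>\<sigma>\<close>, so they remain in \<open>K\<sigma>\<close> even when
      \<open>e\<close> or \<open>f\<close> is \<open>e0\<close>.\<close>
    obtain r where r: "r \<in> {1..n}" "r \<noteq> fst e" "r \<noteq> fst f" "\<sigma> r \<noteq> snd e" "\<sigma> r \<noteq> snd f"
    proof -
      have inj: "inj \<sigma>" using F1S(1)[OF \<sigma>F1] by (auto simp: Sym_def permutes_inj)
      have "card {fst e, fst f, inv \<sigma> (snd e), inv \<sigma> (snd f)} \<le> 4" by (simp add: card_insert_if)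
      then have "card {fst e, fst f, inv \<sigma> (snd e), inv \<sigma> (snd f)} < card {1..n}" using n_ge(1) by simp
      then obtain r where "r \<in> {1..n}" "r \<notin> {fst e, fst f, inv \<sigma> (snd e), inv \<sigma> (snd f)}"
        by (meson card_mono finite.emptyI finite.insertI not_le subsetI)
      moreover from this have "\<sigma> r \<noteq> snd e" "\<sigma> r \<noteq> snd f" using inv_f_f[OF inj, of r] by auto
      ultimately show ?thesis using that by blast
    qed
    have r\<sigma>: "\<sigma> r \<in> {1..n}" using r(1) F1S(1)[OF \<sigma>F1] graph_subset by (auto simp: Sym_def dest: permutes_in_image)
    define C where "C = {e, f, (r, \<sigma> r)}"
    have "card {p \<in> Sym n. C \<subseteq> graph n p} = fact (n - card C)"
      using ef Xn r r\<sigma> nl by (intro card_stars_common) (auto simp: C_def inj_on_def)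
    moreover have "card C = 3" using nl r \<open>e \<noteq> f\<close> by (auto simp: C_def card_insert_if)
    moreover have "{p \<in> Sym n. C \<subseteq> graph n p} \<subseteq> S e \<inter> S f"
      using r(1) by (auto simp: C_def S_def K\<sigma>_def star_def perm_intersect_def)
    moreover have "finite (S e \<inter> S f)" using fK by (auto simp: S_def)
    ultimately have s2: "fact (n - 3) \<le> card (S e \<inter> S f)" by (metis card_mono)
    have "F \<subseteq> (\<Union>x\<in>X. S x) \<union> F1"
    proof
      fix p assume "p \<in> F"
      then consider e where "e \<in> X - {e0}" "p \<in> star n e" | "p \<in> K\<sigma>" | "p \<in> F1" using FK K0\<sigma> by blast
      then show "p \<in> (\<Union>x\<in>X. S x) \<union> F1"
        by cases (use e0 in \<open>auto simp: S_def\<close>)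
    qed
    then have "card F \<le> card ((\<Union>x\<in>X. S x) \<union> F1)" using X(3) fF1 fK by (intro card_mono) (auto simp: S_def)
    also have "\<dots> \<le> card (\<Union>x\<in>X. S x) + card F1" by (rule card_Un_le)
    finally show False using s1 s2 s3 cK large g by linarith
  qed
  \<comment> \<open>Besides the \<open>d1 n\<close> permutations missing \<open>\<tau>\<close>, a
    second \<open>\<tau>\<close> in \<open>F1\<close> costs \<open>K0\<close> those through
    \<open>(r, \<tau> r)\<close> missing \<open>\<sigma>\<close>: at least
    \<open>fact (n - 2) / 27\<close>, more than \<open>card F1\<close>.\<close>
  have F1\<sigma>: "F1 = {\<sigma>}"
  proof (rule ccontr)
    assume "F1 \<noteq> {\<sigma>}"
    then obtain \<tau> where t: "\<tau> \<in> F1" "\<tau> \<noteq> \<sigma>" using \<sigma>F1 by blast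
    obtain a b where ab: "e0 = (a, b)" by (cases e0)
    have abn: "a \<in> {1..n}" "b \<in> {1..n}" using e0 Xn ab by auto
    have nb: "\<upsilon> a \<noteq> b" if "\<upsilon> \<in> F1" for \<upsilon>
    proof -
      have "(a, b) \<notin> graph n \<upsilon>" using F1S(3)[OF that] e0 ab by blast
      then show ?thesis using abn by simp
    qed
    obtain r where r: "r \<in> {1..n}" "\<tau> r \<noteq> \<sigma> r" "r \<noteq> a" "\<tau> r \<noteq> b"
      using permutations_differ_off_pair[OF F1S(1)[OF t(1)] F1S(1)[OF \<sigma>F1] t(2) nb[OF t(1)] nb[OF \<sigma>F1] abn(2)] by blast
    have rn: "\<tau> r \<in> {1..n}" using r(1) F1S(1)[OF t(1)] by (auto simp: Sym_def dest: permutes_in_image)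
    define C where "C = {e0, (r, \<tau> r)}"
    have c2: "card C = 2" using r ab by (auto simp: C_def)
    have "\<exists>p\<in>Sym n. C \<subseteq> graph n p"
      using abn r rn ab by (intro partial_permutation_extends) (auto simp: C_def inj_on_def)
    then obtain p0 where p0: "p0 \<in> Sym n" "C \<subseteq> graph n p0" by blast
    let ?Q = "{p \<in> Sym n. C \<subseteq> graph n p \<and> \<not> perm_intersect n p \<sigma> \<and> \<not> perm_intersect n p \<sigma>}"
    have "C \<inter> graph n \<sigma> = {}" using nb[OF \<sigma>F1] r ab by (auto simp: C_def)
    then have "fact (n - card C) \<le> 27 * card ?Q"
      using c2 n_ge(1) F1S(1)[OF \<sigma>F1] by (intro fact_le_card_disjoint[OF p0]) auto
    then have q: "fact (n - 2) \<le> 27 * card ?Q" using c2 by simp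
    have "K0 \<union> ({p \<in> star n e0. \<not> perm_intersect n p \<tau>} \<union> ?Q) \<subseteq> star n e0"
      by (auto simp: K0_def C_def star_def)
    then have "card (K0 \<union> ({p \<in> star n e0. \<not> perm_intersect n p \<tau>} \<union> ?Q)) \<le> card (star n e0)"
      by (intro card_mono) auto
    moreover have "card (star n e0) = ?a" using e0 Xn by (intro card_star) auto
    moreover have "card (K0 \<union> ({p \<in> star n e0. \<not> perm_intersect n p \<tau>} \<union> ?Q))
        = card K0 + card ({p \<in> star n e0. \<not> perm_intersect n p \<tau>} \<union> ?Q)"
      using t(1) \<sigma>F1 fK by (intro card_Un_disjoint) (auto simp: K0_def)
    moreover have "card ({p \<in> star n e0. \<not> perm_intersect n p \<tau>} \<union> ?Q)
        = card {p \<in> star n e0. \<not> perm_intersect n p \<tau>} + card ?Q"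
      using r(1) by (intro card_Un_disjoint) (auto simp: C_def perm_intersect_def)
    ultimately have "card K0 + (d1 n + card ?Q) \<le> ?a" using D[OF t(1) e0] by simp
    then show False using q large cF cU g fact_mono' by linarith
  qed
  let ?G = "?U \<union> K\<sigma> \<union> {\<sigma>}"
  have FG: "F \<subseteq> ?G" using FK K0\<sigma> F1\<sigma> by blast
  have fG: "finite ?G" using X(3) fK by auto
  have "card ?G \<le> card ?U + card K\<sigma> + card {\<sigma>}" by (meson add_mono card_Un_le le_refl le_trans)
  then have cG: "card ?G \<le> card ?U + card K\<sigma> + 1" by simp
  \<comment> \<open>The size of \<open>?G\<close> is at most the bound that \<open>large\<close>
    says \<open>F\<close> reaches, so the inclusion of \<open>F\<close> in \<open>?G\<close> is an
    equality.\<close>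
  have "card ?G \<le> card F" using cG cU cK large by linarith
  then have FeqG: "F = ?G" using FG fG by (metis card_seteq)
  have "card F \<le> card ?G" using FG fG by (rule card_mono[rotated])
  then have "card F + d1 n = (s - 1) * ?a + 1" using cG cU cK large by linarith
  with Xn X(3,2) e0 F1S(1,3)[OF \<sigma>F1] line FeqG show ?thesis
    unfolding K\<sigma>_def by (intro exI[of _ X] exI[of _ e0] exI[of _ \<sigma>] conjI ballI) assumption+
qed
end

section \<open>The normal form\<close>

text \<open>A pair off the row of \<open>e0\<close> lies in its column and a pair off its column
  lies in its row; two such pairs share neither row nor column.\<close>

lemma pairwise_aligned_cases:
  assumes "\<forall>e\<in>X. \<forall>f\<in>X. fst e = fst f \<or> snd e = snd f" "e0 \<in> X"
  shows "(\<forall>e\<in>X. fst e = fst e0) \<or> (\<forall>e\<in>X. snd e = snd e0)"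
proof (rule ccontr)
  assume "\<not> ?thesis"
  then obtain e f where "e \<in> X" "fst e \<noteq> fst e0" "f \<in> X" "snd f \<noteq> snd e0" by blast
  then show False using assms by metis
qed

text \<open>\<open>\<pi>\<close> moves row \<open>a\<close> to row 1, while \<open>\<rho>\<close>
  takes 1 to \<open>b0\<close> and \<open>{2..s - 1}\<close> onto the other values of
  \<open>B\<close>. The exceptional star thus corresponds to \<open>(1, 1)\<close>, the full ones to
  \<open>(1, i)\<close>, and agreement with \<open>\<sigma>\<close> to agreement with
  \<open>\<sigma>' = inv \<rho> \<circ> \<sigma> \<circ> inv \<pi>\<close>.\<close>

lemma row_family_eq_F0:
  assumes a: "a \<in> {1..n}" and B: "B \<subseteq> {1..n}" "card B = s - 1" "b0 \<in> B" and s: "2 \<le> s"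
    and \<sigma>: "\<sigma> \<in> Sym n" "\<sigma> a \<notin> B"
    and F: "F = (\<Union>b\<in>B - {b0}. star n (a, b)) \<union> {p \<in> star n (a, b0). perm_intersect n p \<sigma>} \<union> {\<sigma>}"
  shows "\<exists>\<rho>\<in>Sym n. \<exists>\<pi>\<in>Sym n. \<exists>\<sigma>'\<in>Sym n. \<sigma>' 1 \<notin> {1..s-1} \<and> F = (\<lambda>g. \<rho> \<circ> g \<circ> \<pi>) ` F0 n s \<sigma>'"
proof -
  have fB: "finite B" using B(1) by (rule finite_subset) simp
  have n1: "1 \<in> {1..n}" using a by auto
  have sn: "s - 1 \<le> n" using card_mono[OF _ B(1)] B(2) by simp
  define \<pi> where "\<pi> = transpose a 1"
  have \<pi>: "\<pi> \<in> Sym n" "\<pi> a = 1" using a n1 by (auto simp: \<pi>_def Sym_def permutes_swap_id)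
  have "card (B - {b0}) = card {2..s - 1}" using fB B(2,3) s by simp
  then obtain h where h: "bij_betw h {2..s - 1} (B - {b0})"
    using fB by (metis finite_atLeastAtMost finite_Diff finite_same_card_bij)
  define C where "C = insert (1, b0) ((\<lambda>i. (i, h i)) ` {2..s - 1})"
  have hB: "h i \<in> B - {b0}" if "i \<in> {2..s - 1}" for i using h that by (auto simp: bij_betw_def)
  have hin: "inj_on h {2..s - 1}" using h by (auto simp: bij_betw_def)
  have "\<exists>\<rho>\<in>Sym n. C \<subseteq> graph n \<rho>"
  proof (rule partial_permutation_extends)
    show "C \<subseteq> {1..n} \<times> {1..n}" using n1 B hB sn unfolding C_def by force
    show "inj_on fst C" by (auto simp: C_def inj_on_def)
    have "\<forall>i\<in>{2..s - 1}. h i \<noteq> b0" using hB by blast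
    then show "inj_on snd C" using hin unfolding C_def inj_on_def by force
  qed (simp add: C_def)
  then obtain \<rho> where \<rho>: "\<rho> \<in> Sym n" "C \<subseteq> graph n \<rho>" by blast
  have \<rho>1: "\<rho> 1 = b0" using \<rho>(2) by (auto simp: C_def)
  have \<rho>i: "\<rho> i = h i" if "i \<in> {2..s - 1}" for i
  proof -
    have "(i, h i) \<in> graph n \<rho>" using \<rho>(2) that unfolding C_def by blast
    then show ?thesis by simp
  qed
  have \<rho>im: "\<rho> ` {2..s - 1} = B - {b0}" using h \<rho>i by (auto simp: bij_betw_def)
  have b\<rho>: "bij \<rho>" and b\<pi>: "bij \<pi>" using \<rho>(1) \<pi>(1) by (auto simp: Sym_def permutes_bij)
  have \<pi>n: "\<pi> i \<in> {1..n} \<longleftrightarrow> i \<in> {1..n}" for i using \<pi>(1) by (simp only: Sym_def mem_Collect_eq permutes_in_image)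
  define \<sigma>' where "\<sigma>' = inv \<rho> \<circ> \<sigma> \<circ> inv \<pi>"
  have \<sigma>': "\<sigma>' \<in> Sym n" unfolding \<sigma>'_def using \<rho>(1) \<sigma>(1) \<pi>(1) by (intro comp_Sym inv_Sym)
  have unconj: "\<rho> \<circ> (inv \<rho> \<circ> q \<circ> inv \<pi>) \<circ> \<pi> = q" for q
    using b\<rho> b\<pi> by (simp add: fun_eq_iff bij_is_surj surj_f_inv_f bij_is_inj inv_f_f)
  have conj_unconj: "inv \<rho> \<circ> (\<rho> \<circ> g \<circ> \<pi>) \<circ> inv \<pi> = g" for g
    using b\<rho> b\<pi> by (simp add: fun_eq_iff bij_is_surj surj_f_inv_f bij_is_inj inv_f_f)
  have "\<sigma>' 1 \<notin> {1..s - 1}"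
  proof
    assume "\<sigma>' 1 \<in> {1..s - 1}"
    then have "\<sigma>' 1 = 1 \<or> \<sigma>' 1 \<in> {2..s - 1}" by auto
    then have "\<rho> (\<sigma>' 1) \<in> insert b0 (\<rho> ` {2..s - 1})" using \<rho>1 by (elim disjE) simp_all
    then have "\<rho> (\<sigma>' 1) \<in> B" unfolding \<rho>im using B(3) by blast
    moreover have "\<rho> (\<sigma>' 1) = \<sigma> a"
      using fun_cong[OF unconj[of \<sigma>], of a] \<pi>(2) unfolding \<sigma>'_def by simp
    ultimately show False using \<sigma>(2) by simp
  qed
  moreover have "F = (\<lambda>g. \<rho> \<circ> g \<circ> \<pi>) ` F0 n s \<sigma>'"
  proof -
    have pair: "\<rho> \<circ> g \<circ> \<pi> \<in> star n (a, \<rho> i) \<longleftrightarrow> g \<in> Sym_pair n 1 i" if "g \<in> Sym n" for g i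
    proof -
      have "\<rho> \<circ> g \<circ> \<pi> \<in> Sym n" using that \<rho>(1) \<pi>(1) by (intro comp_Sym)
      then show ?thesis using that a \<pi>(2) b\<rho> by (auto simp: star_def Sym_pair_def bij_is_inj inj_eq)
    qed
    have int: "perm_intersect n (\<rho> \<circ> g \<circ> \<pi>) \<sigma> \<longleftrightarrow> perm_intersect n g \<sigma>'" for g
    proof -
      have e: "(\<rho> \<circ> g \<circ> \<pi>) i = \<sigma> i \<longleftrightarrow> g (\<pi> i) = \<sigma>' (\<pi> i)" for i
      proof -
        have "\<sigma> i = \<rho> (\<sigma>' (\<pi> i))" using fun_cong[OF unconj[of \<sigma>], of i] unfolding \<sigma>'_def by simp
        then show ?thesis using b\<rho> by (simp add: bij_is_inj inj_eq)
      qed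
      have "(\<exists>i\<in>{1..n}. g (\<pi> i) = \<sigma>' (\<pi> i)) \<longleftrightarrow> (\<exists>j\<in>{1..n}. g j = \<sigma>' j)"
        using \<pi>n b\<pi> by (metis bij_is_surj surj_f_inv_f)
      then show ?thesis unfolding perm_intersect_def e .
    qed
    have mem: "\<rho> \<circ> g \<circ> \<pi> \<in> F \<longleftrightarrow> g \<in> F0 n s \<sigma>'" if g: "g \<in> Sym n" for g
    proof -
      have "\<rho> \<circ> g \<circ> \<pi> = \<sigma> \<longleftrightarrow> g = \<sigma>'"
        using unconj[of \<sigma>] conj_unconj[of g] unfolding \<sigma>'_def by metis
      moreover have "\<rho> \<circ> g \<circ> \<pi> \<in> (\<Union>b\<in>B - {b0}. star n (a, b)) \<longleftrightarrow> g \<in> (\<Union>i\<in>{2..s-1}. Sym_pair n 1 i)"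
        unfolding \<rho>im[symmetric] using pair[OF g] by auto
      ultimately show ?thesis
        unfolding F F0_def using pair[OF g, of 1] int[of g] \<rho>1 by auto
    qed
    have FS: "F \<subseteq> Sym n" unfolding F using \<sigma>(1) by (auto simp: star_def)
    have F0S: "F0 n s \<sigma>' \<subseteq> Sym n" using \<sigma>' by (auto simp: F0_def Sym_pair_def)
    show ?thesis
    proof
      show "F \<subseteq> (\<lambda>g. \<rho> \<circ> g \<circ> \<pi>) ` F0 n s \<sigma>'"
      proof
        fix p assume p: "p \<in> F"
        let ?g = "inv \<rho> \<circ> p \<circ> inv \<pi>"
        have "?g \<in> Sym n" using p FS \<rho>(1) \<pi>(1) by (intro comp_Sym inv_Sym) auto
        then have "?g \<in> F0 n s \<sigma>'" using mem[of ?g] unconj[of p] p by simp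
        then show "p \<in> (\<lambda>g. \<rho> \<circ> g \<circ> \<pi>) ` F0 n s \<sigma>'" using unconj[of p] by (metis image_eqI)
      qed
      show "(\<lambda>g. \<rho> \<circ> g \<circ> \<pi>) ` F0 n s \<sigma>' \<subseteq> F" using mem F0S by auto
    qed
  qed
  ultimately show ?thesis using \<rho>(1) \<pi>(1) \<sigma>' by blast
qed

lemma inv_mem_star_swap:
  assumes "p \<in> Sym n" "(a, b) \<in> {1..n} \<times> {1..n}"
  shows "inv p \<in> star n (b, a) \<longleftrightarrow> p \<in> star n (a, b)"
proof -
  have "bij p" using assms(1) by (auto simp: Sym_def permutes_bij)
  then have "inv p b = a \<longleftrightarrow> p a = b" by (metis bij_inv_eq_iff)
  then show ?thesis using assms inv_Sym[OF assms(1)] by (auto simp: star_def)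
qed

lemma perm_intersect_inv:
  assumes "p \<in> Sym n" "q \<in> Sym n"
  shows "perm_intersect n (inv p) (inv q) \<longleftrightarrow> perm_intersect n p q"
proof -
  have one: "perm_intersect n (inv p) (inv q)" if "perm_intersect n p q" "p \<in> Sym n" "q \<in> Sym n" for p q
  proof -
    obtain i where i: "i \<in> {1..n}" "p i = q i" using \<open>perm_intersect n p q\<close> by (auto simp: perm_intersect_def)
    have "inj p" "inj q" "p i \<in> {1..n}"
      using \<open>p \<in> Sym n\<close> \<open>q \<in> Sym n\<close> i(1) unfolding Sym_def by (simp_all only: mem_Collect_eq permutes_inj permutes_in_image)
    moreover from this have "inv p (p i) = inv q (p i)" using i(2) by (simp add: inv_f_f) (metis inv_f_f)
    ultimately show ?thesis unfolding perm_intersect_def by blast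
  qed
  have "inv (inv p) = p" "inv (inv q) = q"
    using assms by (auto simp: Sym_def permutes_bij inv_inv_eq)
  then show ?thesis using one assms inv_Sym by metis
qed

text \<open>Inversion transposes cells, so a column becomes a row and the row case applies to the
  inverses. Inverting back exchanges the outer factors:
  \<open>inv (\<rho> \<circ> g \<circ> \<pi>)\<close> is
  \<open>inv \<pi> \<circ> inv g \<circ> inv \<rho>\<close>.\<close>

lemma aligned_family_eq_F0:
  assumes X: "X \<subseteq> {1..n} \<times> {1..n}" "finite X" "card X = s - 1" "e0 \<in> X"
    and al: "\<forall>e\<in>X. \<forall>f\<in>X. fst e = fst f \<or> snd e = snd f" and s: "2 \<le> s"
    and \<sigma>: "\<sigma> \<in> Sym n" "graph n \<sigma> \<inter> X = {}"
    and F: "F = (\<Union>e\<in>X - {e0}. star n e) \<union> {p \<in> star n e0. perm_intersect n p \<sigma>} \<union> {\<sigma>}"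
  shows "\<exists>\<rho>\<in>Sym n. \<exists>\<pi>\<in>Sym n. \<exists>\<sigma>\<in>Sym n. \<sigma> 1 \<notin> {1..s-1} \<and>
          (F = (\<lambda>g. \<rho> \<circ> g \<circ> \<pi>) ` F0 n s \<sigma> \<or> F = (\<lambda>g. \<rho> \<circ> g \<circ> \<pi>) ` (inv ` F0 n s \<sigma>))"
proof -
  obtain a b where ab: "e0 = (a, b)" by (cases e0)
  have abn: "a \<in> {1..n}" "b \<in> {1..n}" using X ab by auto
  from pairwise_aligned_cases[OF al X(4)] show ?thesis
  proof
    assume row: "\<forall>e\<in>X. fst e = fst e0"
    define B where "B = snd ` X"
    have XB: "X = Pair a ` B" using row ab unfolding B_def by force
    have "\<exists>\<rho>\<in>Sym n. \<exists>\<pi>\<in>Sym n. \<exists>\<sigma>'\<in>Sym n. \<sigma>' 1 \<notin> {1..s-1} \<and> F = (\<lambda>g. \<rho> \<circ> g \<circ> \<pi>) ` F0 n s \<sigma>'"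
    proof (rule row_family_eq_F0[OF abn(1) _ _ _ s \<sigma>(1)])
      show "B \<subseteq> {1..n}" using X(1) by (auto simp: B_def)
      show "card B = s - 1" using X(3) unfolding XB by (simp add: card_image inj_on_def)
      show "b \<in> B" using X(4) ab by (force simp: B_def)
      have "(a, \<sigma> a) \<in> graph n \<sigma>" using abn by simp
      then show "\<sigma> a \<notin> B" using \<sigma>(2) unfolding XB by blast
      have "X - {e0} = Pair a ` (B - {b})" unfolding XB ab by auto
      then show "F = (\<Union>b\<in>B - {b}. star n (a, b)) \<union> {p \<in> star n (a, b). perm_intersect n p \<sigma>} \<union> {\<sigma>}"
        unfolding F ab by simp
    qed
    then show ?thesis by blast
  next
    assume col: "\<forall>e\<in>X. snd e = snd e0"
    define B where "B = fst ` X"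
    have XB: "X = (\<lambda>x. (x, b)) ` B" using col ab unfolding B_def by force
    have Bn: "B \<subseteq> {1..n}" using X(1) by (auto simp: B_def)
    have FS: "F \<subseteq> Sym n" unfolding F using \<sigma>(1) by (auto simp: star_def)
    have ii: "inv (inv p) = p" if "p \<in> Sym n" for p using that by (auto simp: Sym_def permutes_bij inv_inv_eq)
    have Fi: "inv ` F = (\<Union>x\<in>B - {a}. star n (b, x)) \<union> {p \<in> star n (b, a). perm_intersect n p (inv \<sigma>)} \<union> {inv \<sigma>}" (is "_ = ?G")
    proof -
      have X0: "X - {e0} = (\<lambda>x. (x, b)) ` (B - {a})" unfolding XB ab by auto
      have mem: "inv p \<in> ?G \<longleftrightarrow> p \<in> F" if p: "p \<in> Sym n" for p
      proof -
        have "inv p = inv \<sigma> \<longleftrightarrow> p = \<sigma>" using ii p \<sigma>(1) by metis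
        moreover have "inv p \<in> (\<Union>x\<in>B - {a}. star n (b, x)) \<longleftrightarrow> p \<in> (\<Union>e\<in>X - {e0}. star n e)"
        proof -
          have "inv p \<in> star n (b, x) \<longleftrightarrow> p \<in> star n (x, b)" if "x \<in> B" for x
            using that Bn abn by (intro inv_mem_star_swap[OF p]) auto
          then show ?thesis unfolding X0 by auto
        qed
        moreover have "inv p \<in> star n (b, a) \<longleftrightarrow> p \<in> star n e0"
          unfolding ab using inv_mem_star_swap[OF p] abn by auto
        ultimately show ?thesis unfolding F using perm_intersect_inv[OF p \<sigma>(1)] by auto
      qed
      have GS: "?G \<subseteq> Sym n" using inv_Sym[OF \<sigma>(1)] by (auto simp: star_def)
      show ?thesis
      proof
        show "inv ` F \<subseteq> ?G" using mem FS by blast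
        show "?G \<subseteq> inv ` F"
        proof
          fix q assume q: "q \<in> ?G"
          then have qS: "q \<in> Sym n" using GS by blast
          then have "inv q \<in> F" using mem[OF inv_Sym[OF qS]] q ii[OF qS] by simp
          then show "q \<in> inv ` F" using ii[OF qS] by (metis image_eqI)
        qed
      qed
    qed
    have "\<exists>\<rho>\<in>Sym n. \<exists>\<pi>\<in>Sym n. \<exists>\<sigma>'\<in>Sym n. \<sigma>' 1 \<notin> {1..s-1} \<and> inv ` F = (\<lambda>g. \<rho> \<circ> g \<circ> \<pi>) ` F0 n s \<sigma>'"
    proof (rule row_family_eq_F0[OF abn(2) Bn _ _ s inv_Sym[OF \<sigma>(1)] _ Fi])
      show "card B = s - 1" using X(3) unfolding XB by (simp add: card_image inj_on_def)
      show "a \<in> B" using X(4) ab by (force simp: B_def)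
      show "inv \<sigma> b \<notin> B"
      proof
        assume "inv \<sigma> b \<in> B"
        moreover have "\<sigma> (inv \<sigma> b) = b" using \<sigma>(1) by (simp add: Sym_def permutes_surj surj_f_inv_f)
        ultimately have "(inv \<sigma> b, b) \<in> graph n \<sigma> \<inter> X" using Bn unfolding XB by auto
        then show False using \<sigma>(2) by blast
      qed
    qed
    then obtain \<rho> \<pi> \<sigma>' where r: "\<rho> \<in> Sym n" "\<pi> \<in> Sym n" "\<sigma>' \<in> Sym n" "\<sigma>' 1 \<notin> {1..s-1}"
      and e: "inv ` F = (\<lambda>g. \<rho> \<circ> g \<circ> \<pi>) ` F0 n s \<sigma>'" by blast
    have F0S: "F0 n s \<sigma>' \<subseteq> Sym n" using r(3) by (auto simp: F0_def Sym_pair_def)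
    have "F = inv ` inv ` F"
    proof -
      have "inv ` inv ` F = (\<lambda>p. p) ` F" unfolding image_image using ii FS by (intro image_cong) auto
      then show ?thesis by simp
    qed
    also have "\<dots> = (\<lambda>g. inv (\<rho> \<circ> g \<circ> \<pi>)) ` F0 n s \<sigma>'" unfolding e by (simp add: image_image)
    also have "\<dots> = (\<lambda>g. inv \<pi> \<circ> inv g \<circ> inv \<rho>) ` F0 n s \<sigma>'"
    proof (rule image_cong)
      fix g assume "g \<in> F0 n s \<sigma>'"
      then have b: "bij g" "bij \<rho>" "bij \<pi>" using F0S r by (auto simp: Sym_def permutes_bij)
      show "inv (\<rho> \<circ> g \<circ> \<pi>) = inv \<pi> \<circ> inv g \<circ> inv \<rho>"
        using b by (simp add: o_inv_distrib bij_comp o_assoc)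
    qed simp
    also have "\<dots> = (\<lambda>g. inv \<pi> \<circ> g \<circ> inv \<rho>) ` (inv ` F0 n s \<sigma>')" by (simp add: image_image)
    finally show ?thesis using r inv_Sym[OF r(1)] inv_Sym[OF r(2)] by blast
  qed
qed

section \<open>From the hypotheses of the theorem to the parameters\<close>

text \<open>\<open>M\<close> is the binary logarithm of \<open>n\<close> rounded up, at most
  \<open>5 / 3 * ln n + 1\<close>; this is below \<open>2 * ln n\<close> as soon as
  \<open>ln n \<ge> 3\<close>.\<close>

lemma large_parameters_exist:
  fixes n s :: nat
  assumes "real s \<le> real n / (2 ^ 17 * ln (real n))" "2 \<le> s"
  shows "\<exists>M. large_parameters n s M"
proof -
  have l2: "3 / 5 \<le> ln (2::real)"
  proof -
    \<comment> \<open>The fourth power of 17/20 is about 0.522, just above 1/2.\<close>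
    have "(17 / 20 :: real) ^ 4 \<le> exp (- 3 / 20) ^ 4"
      using exp_ge_add_one_self[of "- 3 / 20 :: real"] by (intro power_mono) auto
    also have "\<dots> = exp (- 3 / 5)" by (simp add: exp_of_nat_mult[symmetric])
    finally have "1 / 2 \<le> exp (- 3 / 5 :: real)" by (simp add: power_numeral_reduce)
    then have "exp (3 / 5 :: real) \<le> 2" by (simp add: exp_minus field_simps)
    then have "ln (exp (3 / 5 :: real)) \<le> ln 2" by (subst ln_le_cancel_iff) auto
    then show ?thesis by simp
  qed
  have n2: "2 \<le> n"
  proof (rule ccontr)
    assume "\<not> 2 \<le> n"
    then have "n = 0 \<or> n = 1" by auto
    \<comment> \<open>Here \<open>ln\<close> vanishes at 0 and at 1, and division by zero yields
      0.\<close>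
    then have "real n / (2 ^ 17 * ln (real n)) = 0" by auto
    then have "real s \<le> 0" using assms(1) by linarith
    then show False using assms(2) by simp
  qed
  have ln2: "3 / 5 \<le> ln (real n)" using l2 n2 ln_le_cancel_iff[of 2 "real n"] by linarith
  then have c: "real s * (2 ^ 17 * ln (real n)) \<le> real n"
    using assms(1) by (simp add: le_divide_eq)
  \<comment> \<open>A crude bound on \<open>ln n\<close> improves itself:
    \<open>ln n \<ge> 3 / 5\<close> gives \<open>n \<ge> 2 ^ 17\<close> by the hypothesis, and then
    \<open>ln n \<ge> 17 * ln 2\<close>.\<close>
  have "2 * (2 ^ 17 * ln (real n)) \<le> real s * (2 ^ 17 * ln (real n))"
    using assms(2) ln2 by (intro mult_right_mono) auto
  then have "262144 * ln (real n) \<le> real n" using c by simp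
  then have "131072 \<le> real n" using ln2 by linarith
  then have "2 ^ 17 \<le> real n" by simp
  then have "ln (2 ^ 17) \<le> ln (real n)" by (subst ln_le_cancel_iff) auto
  moreover have "ln (2 ^ 17 :: real) = 17 * ln 2" by (subst ln_realpow) auto
  ultimately have ln17: "3 \<le> ln (real n)" using l2 by linarith
  define M where "M = nat \<lceil>log 2 (real n)\<rceil>"
  have lg: "log 2 (real n) \<ge> 0" using n2 by simp
  have M1: "log 2 (real n) \<le> real M" using lg unfolding M_def by linarith
  have M2: "real M \<le> log 2 (real n) + 1" using lg unfolding M_def by linarith
  have "real n = 2 powr log 2 (real n)" using n2 by simp
  also have "\<dots> \<le> 2 powr real M" using M1 by (intro powr_mono) auto
  also have "\<dots> = 2 ^ M" by (simp add: powr_realpow)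
  finally have "real n \<le> real (2 ^ M)" by simp
  then have nM: "n \<le> 2 ^ M" by (simp only: of_nat_le_iff)
  have "log 2 (real n) \<le> 5 / 3 * ln (real n)"
  proof -
    have "ln (real n) * 3 \<le> ln (real n) * (5 * ln 2)" using l2 ln17 by (intro mult_left_mono) auto
    then show ?thesis using l2 unfolding log_def by (simp add: divide_le_eq)
  qed
  then have "real M \<le> 2 * ln (real n)" using M2 ln17 by linarith
  then have "real s * real M \<le> real s * (2 * ln (real n))" by (intro mult_left_mono) auto
  then have "2 ^ 16 * (real s * real M) \<le> real n" using c by (simp add: mult_ac)
  then have "real (2 ^ 16 * (s * M)) \<le> real n" by simp
  then have "2 ^ 16 * (s * M) \<le> n" by (simp only: of_nat_le_iff)
  then have "large_parameters n s M" using assms(2) n2 nM by unfold_locales auto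
  then show ?thesis by blast
qed

lemma card_le_nu:
  assumes F: "finite F" and G: "G \<subseteq> F" "\<forall>p\<in>G. \<forall>q\<in>G. p \<noteq> q \<longrightarrow> \<not> perm_intersect n p q"
  shows "card G \<le> nu n F"
  unfolding nu_def
proof (rule Max_ge)
  have "{card G | G. G \<subseteq> F \<and> (\<forall>p\<in>G. \<forall>q\<in>G. p \<noteq> q \<longrightarrow> \<not> perm_intersect n p q)} \<subseteq> card ` Pow F" by auto
  then show "finite {card G | G. G \<subseteq> F \<and> (\<forall>p\<in>G. \<forall>q\<in>G. p \<noteq> q \<longrightarrow> \<not> perm_intersect n p q)}"
    by (rule finite_subset) (simp add: F)
qed (use G in blast)

lemma tau_le_card:
  assumes X: "X \<subseteq> {1..n} \<times> {1..n}" "\<forall>p\<in>F. \<exists>(x, y)\<in>X. p x = y"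
  shows "tau n F \<le> card X"
  unfolding tau_def
proof (rule Min_le)
  have "{card X | X. X \<subseteq> {1..n} \<times> {1..n} \<and> (\<forall>p\<in>F. \<exists>(x, y)\<in>X. p x = y)} \<subseteq> card ` Pow ({1..n} \<times> {1..n})" by auto
  then show "finite {card X | X. X \<subseteq> {1..n} \<times> {1..n} \<and> (\<forall>p\<in>F. \<exists>(x, y)\<in>X. p x = y)}"
    by (rule finite_subset) simp
qed (use X in blast)

theorem theorem6:
  fixes n s :: nat and F :: "(nat \<Rightarrow> nat) set"
  assumes "real s \<le> real n / (2 ^ 17 * ln (real n))"
    and "F \<subseteq> Sym n"
    and "nu n F < s"
    and "tau n F \<ge> s"
  shows "int (card F) \<le> (int s - 1) * int (fact (n - 1)) - int (d1 n) + 1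
    \<and> (int (card F) = (int s - 1) * int (fact (n - 1)) - int (d1 n) + 1 \<longrightarrow>
        (\<exists>\<rho>\<in>Sym n. \<exists>\<pi>\<in>Sym n. \<exists>\<sigma>\<in>Sym n. \<sigma> 1 \<notin> {1..s-1} \<and>
          (F = (\<lambda>g. \<rho> \<circ> g \<circ> \<pi>) ` F0 n s \<sigma> \<or>
           F = (\<lambda>g. \<rho> \<circ> g \<circ> \<pi>) ` (inv ` F0 n s \<sigma>))))"
proof -
  have fF: "finite F" using assms(2) by (rule finite_subset) simp
  \<comment> \<open>For \<open>s = 1\<close> the hypothesis on \<open>nu\<close> makes
    \<open>F\<close> empty, and the empty set of pairs covers it, against
    \<open>tau n F \<ge> 1\<close>.\<close>
  have s2: "2 \<le> s"
  proof (rule ccontr)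
    assume "\<not> 2 \<le> s"
    then have s1: "s = 1" using assms(3) by simp
    have "F = {}"
    proof (rule ccontr)
      assume "F \<noteq> {}"
      then obtain p where "p \<in> F" by blast
      then have "card {p} \<le> nu n F" by (intro card_le_nu[OF fF]) auto
      then show False using assms(3) s1 by simp
    qed
    then have "tau n F \<le> card ({} :: (nat \<times> nat) set)" by (intro tau_le_card) auto
    then show False using assms(4) s1 by simp
  qed
  obtain M where M: "large_parameters n s M" using large_parameters_exist[OF assms(1) s2] by blast
  have conv: "int (card F) - ((int s - 1) * int (fact (n - 1)) - int (d1 n) + 1)
      = int (card F + d1 n) - int ((s - 1) * fact (n - 1) + 1)"
    using s2 by (simp add: of_nat_diff)
  show ?thesis
  \<comment> \<open>Below the bound the inequality is strict and the equality clause is vacuous;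
    otherwise the structure theorem applies.\<close>
  proof (cases "(s - 1) * fact (n - 1) + 1 \<le> card F + d1 n")
    case False
    then have "int (card F + d1 n) - int ((s - 1) * fact (n - 1) + 1) < 0" by linarith
    then show ?thesis using conv by linarith
  next
    case True
    have ext: "extremal_family n s M F"
    proof (intro extremal_family.intro M extremal_family_axioms.intro)
      show "card G < s" if "G \<subseteq> F" "\<forall>p\<in>G. \<forall>q\<in>G. p \<noteq> q \<longrightarrow> \<not> perm_intersect n p q" for G
        using card_le_nu[OF fF that] assms(3) by linarith
      show "\<exists>p\<in>F. graph n p \<inter> X = {}" if X: "X \<subseteq> {1..n} \<times> {1..n}" "card X < s" for X
      proof (rule ccontr)
        assume "\<not> ?thesis"
        then have n: "\<forall>p\<in>F. graph n p \<inter> X \<noteq> {}" by blast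
        have "\<forall>p\<in>F. \<exists>(x, y)\<in>X. p x = y"
        proof
          fix p assume "p \<in> F"
          then obtain x y where "(x, y) \<in> graph n p" "(x, y) \<in> X" using n by fastforce
          then show "\<exists>(x, y)\<in>X. p x = y" by auto
        qed
        then show False using tau_le_card[OF X(1)] X(2) assms(4) by (meson le_trans not_le)
      qed
    qed (use assms(2) True in auto)
    from extremal_family.extremal_structure[OF ext]
    obtain X e0 \<sigma> where "X \<subseteq> {1..n} \<times> {1..n}" "finite X" "card X = s - 1" "e0 \<in> X" "\<sigma> \<in> Sym n"
      "graph n \<sigma> \<inter> X = {}" "\<forall>e\<in>X. \<forall>f\<in>X. fst e = fst f \<or> snd e = snd f"
      "F = (\<Union>e\<in>X - {e0}. star n e) \<union> {p \<in> star n e0. perm_intersect n p \<sigma>} \<union> {\<sigma>}"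
      and eq: "card F + d1 n = (s - 1) * fact (n - 1) + 1"
      by (elim exE conjE) (rule that; assumption)
    then have "\<exists>\<rho>\<in>Sym n. \<exists>\<pi>\<in>Sym n. \<exists>\<sigma>\<in>Sym n. \<sigma> 1 \<notin> {1..s-1} \<and>
          (F = (\<lambda>g. \<rho> \<circ> g \<circ> \<pi>) ` F0 n s \<sigma> \<or> F = (\<lambda>g. \<rho> \<circ> g \<circ> \<pi>) ` (inv ` F0 n s \<sigma>))"
      using s2 by (intro aligned_family_eq_F0)
    moreover have "int (card F) \<le> (int s - 1) * int (fact (n - 1)) - int (d1 n) + 1"
      using conv eq by linarith
    ultimately show ?thesis by blast
  qed
qed

end
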